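(* Let $K$ be a field, $q\in K$ nonzero, $m,n$ positive integers, and $\gamma=[A\mid B]=[a_1,\dots,a_t\mid b_1,\dots,b_t]$ a quantum minor in $\mathcal{O}_q(M_{mn}(K))$. Then the subalgebra $T$ of $\mathcal{O}_q(M_{mn}(K))$ associated to $\gamma$ is an iterated Ore extension (of $K$).
   Context: All algebras are associative and unital. **Quantum matrices.** $\mathcal{O}_q(M_{mn}(K))$ is the $K$-algebra generated by $x_{ij}$ ($1\le i\le m$, $1\le j\le n$) subject to: $x_{ij}x_{il}=qx_{il}x_{ij}$ for $j<l$; $x_{ij}x_{kj}=qx_{kj}x_{ij}$ for $i<k$; $x_{ij}x_{kl}=x_{kl}x_{ij}$ for $k<i$, $j<l$; $x_{ij}x_{kl}-x_{kl}x_{ij}=(q-q^{-1})x_{il}x_{kj}$ for $i<k$, $j<l$. **Quantum minors.** For $t$-element subsets $I=\{i_1<\dots<i_t\}\subseteq\{1,\dots,m\}$ and $J=\{j_1<\dots<j_t\}\subseteq\{1,\dots,n\}$, $[I\mid J]=\sum_{\sigma\in S_t}(-q)^{l(\sigma)}x_{i_1j_{\sigma(1)}}\cdots x_{i_tj_{\sigma(t)}}$, where $l$ is the length function. **The algebra $T$.** Here $A=\{a_1<\dots<a_t\}$, $B=\{b_1<\dots<b_t\}$. $S$ is the subalgebra generated by the $x_{a_ib_j}$ ($1\le i,j\le t$). $T$ is the subalgebra of $\mathcal{O}_q(M_{mn}(K))$ generated by $S$ together with all quantum minors $[A\mid (B\setminus\{b_j\})\sqcup\{c\}]$ with $c\in\{1,\dots,n\}\setminus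 B$, $b_j<c$, and all quantum minors $[(A\setminus\{a_j\})\sqcup\{r\}\mid B]$ with $r\in\{1,\dots,m\}\setminus A$, $a_j<r$. **Ore extensions.** For an algebra $R$, an automorphism $\sigma$ of $R$ and a $\sigma$-derivation $\delta$ (i.e. $K$-linear with $\delta(ab)=\sigma(a)\delta(b)+\delta(a)b$), the Ore extension $R[y;\sigma,\delta]$ is the free left $R$-module on the powers of $y$ with multiplication determined by $ya=\sigma(a)y+\delta(a)$ for $a\in R$. An iterated Ore extension of $K$ is an algebra obtained from $K$ by finitely many successive Ore extensions. *)

theory Defs
  imports "HOL-Algebra.QuotRing" "HOL-Algebra.Subrings" "HOL-Algebra.Module"
    "HOL-Combinatorics.Permutations"
begin

section \<open>Algebras over a field\<close>

text \<open>The locale \<^locale>\<open>algebra\<close> of the library is restricted to commutative algebras; the record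
  type \<^typ>\<open>('k, 'a) module\<close> is reused here for associative unital algebras.\<close>

locale assoc_algebra = ring A for A :: "('k::field, 'a, 'b) module_scheme" (structure) +
  assumes smult_closed: "x \<in> carrier A \<Longrightarrow> c \<odot> x \<in> carrier A"
    and smult_add_left: "x \<in> carrier A \<Longrightarrow> (c + d) \<odot> x = c \<odot> x \<oplus> d \<odot> x"
    and smult_add_right:
      "x \<in> carrier A \<Longrightarrow> y \<in> carrier A \<Longrightarrow> c \<odot> (x \<oplus> y) = c \<odot> x \<oplus> c \<odot> y"
    and smult_smult: "x \<in> carrier A \<Longrightarrow> c \<odot> (d \<odot> x) = (c * d) \<odot> x"
    and smult_one: "x \<in> carrier A \<Longrightarrow> 1 \<odot> x = x"
    and smult_mult_left:
      "x \<in> carrier A \<Longrightarrow> y \<in> carrier A \<Longrightarrow> (c \<odot> x) \<otimes> y = c \<odot> (x \<otimes> y)"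
    and smult_mult_right:
      "x \<in> carrier A \<Longrightarrow> y \<in> carrier A \<Longrightarrow> x \<otimes> (c \<odot> y) = c \<odot> (x \<otimes> y)"

definition unital_subalgebra :: "('k::field, 'a, 'b) module_scheme \<Rightarrow> 'a set \<Rightarrow> bool" where
  "unital_subalgebra A V \<longleftrightarrow> subring V A \<and> (\<forall>c. \<forall>x\<in>V. c \<odot>\<^bsub>A\<^esub> x \<in> V)"

definition generated_subalgebra :: "('k::field, 'a, 'b) module_scheme \<Rightarrow> 'a set \<Rightarrow> 'a set" where
  "generated_subalgebra A X = \<Inter>{V. unital_subalgebra A V \<and> X \<subseteq> V}"

definition algebra_automorphism :: "('k::field, 'a, 'b) module_scheme \<Rightarrow> ('a \<Rightarrow> 'a) \<Rightarrow> bool" where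
  "algebra_automorphism R \<sigma> \<longleftrightarrow>
     \<sigma> \<in> ring_iso R R \<and> (\<forall>c. \<forall>a\<in>carrier R. \<sigma> (c \<odot>\<^bsub>R\<^esub> a) = c \<odot>\<^bsub>R\<^esub> \<sigma> a)"

definition skew_derivation ::
  "('k::field, 'a, 'b) module_scheme \<Rightarrow> ('a \<Rightarrow> 'a) \<Rightarrow> ('a \<Rightarrow> 'a) \<Rightarrow> bool" where
  "skew_derivation R \<sigma> \<delta> \<longleftrightarrow>
     \<delta> \<in> carrier R \<rightarrow> carrier R \<and>
     (\<forall>a\<in>carrier R. \<forall>b\<in>carrier R. \<delta> (a \<oplus>\<^bsub>R\<^esub> b) = \<delta> a \<oplus>\<^bsub>R\<^esub> \<delta> b) \<and>
     (\<forall>c. \<forall>a\<in>carrier R. \<delta> (c \<odot>\<^bsub>R\<^esub> a) = c \<odot>\<^bsub>R\<^esub> \<delta> a) \<and>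
     (\<forall>a\<in>carrier R. \<forall>b\<in>carrier R. \<delta> (a \<otimes>\<^bsub>R\<^esub> b) = \<sigma> a \<otimes>\<^bsub>R\<^esub> \<delta> b \<oplus>\<^bsub>R\<^esub> \<delta> a \<otimes>\<^bsub>R\<^esub> b)"


section \<open>Iterated Ore extensions\<close>

text \<open>The algebra \<open>S\<close> is the Ore extension \<open>R[y; \<sigma>, \<delta>]\<close> of its subalgebra \<open>R\<close>. The last
  conjunct says that \<open>S\<close> is a free left \<open>R\<close>-module on the powers of \<open>y\<close>: every element of \<open>S\<close> is
  \<open>\<Sum>\<^sub>i f\<^sub>i y\<^sup>i\<close> for exactly one finitely supported coefficient sequence \<open>f\<close> in \<open>R\<close>.\<close>

definition ore_extension ::
  "('k::field, 'a, 'b) module_scheme \<Rightarrow> 'a set \<Rightarrow> 'a \<Rightarrow> ('a \<Rightarrow> 'a) \<Rightarrow> ('a \<Rightarrow> 'a) \<Rightarrow> bool" where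
  "ore_extension S R y \<sigma> \<delta> \<longleftrightarrow>
     assoc_algebra S \<and> unital_subalgebra S R \<and> y \<in> carrier S \<and>
     algebra_automorphism (S\<lparr>carrier := R\<rparr>) \<sigma> \<and>
     skew_derivation (S\<lparr>carrier := R\<rparr>) \<sigma> \<delta> \<and>
     (\<forall>a\<in>R. y \<otimes>\<^bsub>S\<^esub> a = \<sigma> a \<otimes>\<^bsub>S\<^esub> y \<oplus>\<^bsub>S\<^esub> \<delta> a) \<and>
     bij_betw (\<lambda>f. \<Oplus>\<^bsub>S\<^esub>i\<in>{i. f i \<noteq> \<zero>\<^bsub>S\<^esub>}. f i \<otimes>\<^bsub>S\<^esub> y [^]\<^bsub>S\<^esub> i)
       {f :: nat \<Rightarrow> 'a. (\<forall>i. f i \<in> R) \<and> finite {i. f i \<noteq> \<zero>\<^bsub>S\<^esub>}} (carrier S)"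

text \<open>In the base case the structure map \<open>K \<rightarrow> R\<close>, \<open>c \<mapsto> c\<cdot>1\<close>, is an isomorphism of algebras.\<close>

inductive iterated_ore_extension :: "('k::field, 'a, 'b) module_scheme \<Rightarrow> bool" where
  base: "iterated_ore_extension R"
    if "assoc_algebra R" "bij_betw (\<lambda>c. c \<odot>\<^bsub>R\<^esub> \<one>\<^bsub>R\<^esub>) UNIV (carrier R)"
| step: "iterated_ore_extension S"
    if "iterated_ore_extension (S\<lparr>carrier := R\<rparr>)" "ore_extension S R y \<sigma> \<delta>"


section \<open>Algebras given by generators and relations\<close>

text \<open>The free algebra on \<open>X\<close>: finitely supported functions on words in \<open>X\<close>, with convolution
  over all factorizations of a word as product.\<close>

definition free_algebra :: "'x set \<Rightarrow> ('k::field, 'x list \<Rightarrow> 'k) module" where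
  "free_algebra X =
     \<lparr>carrier = {f. finite {w. f w \<noteq> 0} \<and> {w. f w \<noteq> 0} \<subseteq> lists X},
      monoid.mult = (\<lambda>f g w. \<Sum>i\<le>length w. f (take i w) * g (drop i w)),
      one = (\<lambda>w. if w = [] then 1 else 0),
      zero = (\<lambda>w. 0),
      add = (\<lambda>f g w. f w + g w),
      smult = (\<lambda>c f w. c * f w)\<rparr>"

definition free_gen :: "'x \<Rightarrow> 'x list \<Rightarrow> 'k::field" where
  "free_gen x = (\<lambda>w. if w = [x] then 1 else 0)"

text \<open>The quotient ring by a two-sided ideal, with the induced scalar multiplication
  \<open>c \<cdot> (x + I) = c \<cdot> x + I\<close> written in the style of \<^const>\<open>rcoset_mult\<close>.\<close>

definition quotient_algebra ::
  "('k::field, 'a, 'b) module_scheme \<Rightarrow> 'a set \<Rightarrow> ('k, 'a set) module" where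
  "quotient_algebra A I =
     \<lparr>carrier = carrier (A Quot I), monoid.mult = monoid.mult (A Quot I), one = one (A Quot I),
      zero = zero (A Quot I), add = add (A Quot I),
      smult = (\<lambda>c C. \<Union>x\<in>C. I +>\<^bsub>A\<^esub> (c \<odot>\<^bsub>A\<^esub> x))\<rparr>"


section \<open>Quantum matrices and quantum minors\<close>

definition qmat_relations :: "'k::field \<Rightarrow> nat \<Rightarrow> nat \<Rightarrow> ((nat \<times> nat) list \<Rightarrow> 'k) set" where
  "qmat_relations q m n =
     (let F = free_algebra ({1..m} \<times> {1..n}); x = (\<lambda>i j. free_gen (i, j)) in
      {x i j \<otimes>\<^bsub>F\<^esub> x i l \<ominus>\<^bsub>F\<^esub> q \<odot>\<^bsub>F\<^esub> (x i l \<otimes>\<^bsub>F\<^esub> x i j) | i j l.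
         i \<in> {1..m} \<and> j \<in> {1..n} \<and> l \<in> {1..n} \<and> j < l} \<union>
      {x i j \<otimes>\<^bsub>F\<^esub> x k j \<ominus>\<^bsub>F\<^esub> q \<odot>\<^bsub>F\<^esub> (x k j \<otimes>\<^bsub>F\<^esub> x i j) | i j k.
         i \<in> {1..m} \<and> k \<in> {1..m} \<and> j \<in> {1..n} \<and> i < k} \<union>
      {x i j \<otimes>\<^bsub>F\<^esub> x k l \<ominus>\<^bsub>F\<^esub> x k l \<otimes>\<^bsub>F\<^esub> x i j | i j k l.
         i \<in> {1..m} \<and> k \<in> {1..m} \<and> j \<in> {1..n} \<and> l \<in> {1..n} \<and> k < i \<and> j < l} \<union>
      {(x i j \<otimes>\<^bsub>F\<^esub> x k l \<ominus>\<^bsub>F\<^esub> x k l \<otimes>\<^bsub>F\<^esub> x i j)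
          \<ominus>\<^bsub>F\<^esub> (q - inverse q) \<odot>\<^bsub>F\<^esub> (x i l \<otimes>\<^bsub>F\<^esub> x k j) | i j k l.
         i \<in> {1..m} \<and> k \<in> {1..m} \<and> j \<in> {1..n} \<and> l \<in> {1..n} \<and> i < k \<and> j < l})"

definition quantum_matrices ::
  "'k::field \<Rightarrow> nat \<Rightarrow> nat \<Rightarrow> ('k, ((nat \<times> nat) list \<Rightarrow> 'k) set) module" where
  "quantum_matrices q m n =
     (let F = free_algebra ({1..m} \<times> {1..n})
      in quotient_algebra F (genideal F (qmat_relations q m n)))"

definition qmat_gen ::
  "'k::field \<Rightarrow> nat \<Rightarrow> nat \<Rightarrow> nat \<Rightarrow> nat \<Rightarrow> ((nat \<times> nat) list \<Rightarrow> 'k) set" where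
  "qmat_gen q m n i j =
     (let F = free_algebra ({1..m} \<times> {1..n})
      in genideal F (qmat_relations q m n) +>\<^bsub>F\<^esub> free_gen (i, j))"

text \<open>The length of a permutation of \<open>{0, \<dots>, t - 1}\<close> is its number of inversions.\<close>

definition perm_length :: "nat \<Rightarrow> (nat \<Rightarrow> nat) \<Rightarrow> nat" where
  "perm_length t \<sigma> = card {(i, j). i < j \<and> j < t \<and> \<sigma> j < \<sigma> i}"

text \<open>Positions are counted from \<open>0\<close>: the entry \<open>sorted_list_of_set I ! k\<close> is the
  \<open>(k + 1)\<close>-st smallest element of \<open>I\<close>. Meaningful for \<open>card I = card J\<close>.\<close>

definition quantum_minor ::
  "'k::field \<Rightarrow> nat \<Rightarrow> nat \<Rightarrow> nat set \<Rightarrow> nat set \<Rightarrow> ((nat \<times> nat) list \<Rightarrow> 'k) set" where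
  "quantum_minor q m n I J =
     (let Q = quantum_matrices q m n; t = card I in
      \<Oplus>\<^bsub>Q\<^esub>\<sigma>\<in>{\<sigma>. \<sigma> permutes {..<t}}. (- q) ^ perm_length t \<sigma> \<odot>\<^bsub>Q\<^esub>
        foldr (\<otimes>\<^bsub>Q\<^esub>)
          (map (\<lambda>k. qmat_gen q m n (sorted_list_of_set I ! k) (sorted_list_of_set J ! \<sigma> k)) [0..<t])
          \<one>\<^bsub>Q\<^esub>)"


section \<open>The subalgebra associated to a quantum minor\<close>

definition minor_core ::
  "'k::field \<Rightarrow> nat \<Rightarrow> nat \<Rightarrow> nat set \<Rightarrow> nat set \<Rightarrow> ((nat \<times> nat) list \<Rightarrow> 'k) set set" where
  "minor_core q m n A B =
     generated_subalgebra (quantum_matrices q m n) {qmat_gen q m n a b | a b. a \<in> A \<and> b \<in> B}"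

definition minor_subalgebra ::
  "'k::field \<Rightarrow> nat \<Rightarrow> nat \<Rightarrow> nat set \<Rightarrow> nat set \<Rightarrow> ((nat \<times> nat) list \<Rightarrow> 'k) set set" where
  "minor_subalgebra q m n A B =
     generated_subalgebra (quantum_matrices q m n)
       (minor_core q m n A B \<union>
        {quantum_minor q m n A (insert c (B - {b})) | b c. b \<in> B \<and> c \<in> {1..n} - B \<and> b < c} \<union>
        {quantum_minor q m n (insert r (A - {a})) B | a r. a \<in> A \<and> r \<in> {1..m} - A \<and> a < r})"

end

theory Submission
  imports Defs "HOL-Combinatorics.Multiset_Permutations" "HOL-Library.Function_Algebras"
begin

text \<open>
  The subalgebra of a minor \<open>\<gamma> = [A | B]\<close> is built by adjoining its generators one at a time: the
  entries \<open>x\<^sub>i\<^sub>j\<close> with \<open>i \<in> A\<close>, \<open>j \<in> B\<close> row by row, next the minors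
  \<open>[(A \<setminus> {a}) \<squnion> {r} | B]\<close> with \<open>r\<close> decreasing and, for equal \<open>r\<close>, with \<open>a\<close> increasing, and finally the minors
  \<open>[A | (B \<setminus> {b}) \<squnion> {c}]\<close> with \<open>c\<close> decreasing and, for equal \<open>c\<close>, with \<open>b\<close> increasing. Adjoining \<open>y\<close>
  to the algebra \<open>R\<close> generated by its predecessors is an Ore extension as soon as

    \<^item> \<open>y g = c g y + d\<close> with a nonzero scalar \<open>c\<close> and \<open>d \<in> R\<close>, for every earlier generator \<open>g\<close>, and

    \<^item> the powers of \<open>y\<close> are left linearly independent over \<open>R\<close>.

  The twist then multiplies each generator by a scalar. It is injective because the same tower
  provides a basis of monomials on which it acts diagonally. A list of generators satisfying both
  conditions is called a tower below, and \<open>tower_iterated_ore\<close> turns it into an iterated Ore extension.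

  Both conditions come from one device, the shear. Let \<open>p\<close> and \<open>r\<close> be two columns. On \<open>\<int>\<close>-indexed
  sequences there are an invertible operator \<open>k\<close>, diagonal with entries \<open>q\<^sup>n\<close>, and a shift \<open>\<beta>\<close> such that
  \<open>k \<beta> = q \<beta> k\<close>. Replacing column \<open>r\<close> by \<open>x\<^sub>r k\<^sup>\<plusminus>\<^sup>1 + x\<^sub>p \<beta>\<close>, column \<open>p\<close> by \<open>x\<^sub>p k\<^sup>\<minusplus>\<^sup>1\<close> and the columns
  strictly between them by \<open>0\<close> gives again a quantum matrix, so that it defines a homomorphism
  \<open>\<phi>\<close> on the algebra of quantum matrices (\<open>qmat_shear\<close>). A minor whose column set contains \<open>r\<close>
  but not \<open>p\<close> is mapped to \<open>M k\<^sup>\<plusminus>\<^sup>1 + M' \<beta>\<close>, where \<open>M'\<close> is the minor with \<open>r\<close> replaced by \<open>p\<close>; minors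
  whose column set contains both or neither are fixed (\<open>qdet_shear\<close>).

  Commutation relations: applying \<open>\<phi>\<close> to a relation between two minors and comparing coefficients
  of \<open>\<beta>\<close> moves a column index to a neighbouring place (\<open>move_column\<close>, \<open>crossing\<close>). Hence each
  relation that is needed follows from an extremal one, in which a minor commutes with every entry of
  the other up to a scalar that is a product of a row weight and a column weight
  (\<open>minor_weights\<close>). Rows are treated by transposition.

  Freeness: suppose that \<open>\<phi>(y) = y k\<^sup>e + y' \<beta>\<close> and that \<open>\<phi>\<close> maps the earlier generators to diagonal
  operators. Then the top level of a relation \<open>\<Sum>\<^sub>i\<^sub>\<le>\<^sub>p f\<^sub>i y\<^sup>i = 0\<close> reads \<open>f\<^sub>p y'\<^sup>p = 0\<close>. Thus \<open>y\<close> is free if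
  right multiplication by \<open>y'\<close> is injective (\<open>free_of_regular_shift\<close>). A refinement for generators that
  are shifted as well lets \<open>y\<close> inherit freeness from \<open>y'\<close> (\<open>free_of_free_shift\<close>). For the entries this gives the basis of ordered monomials of the algebra of
  quantum matrices, which is therefore a domain. For the minors \<open>[A | (B \<setminus> {b}) \<squnion> {c}]\<close> the chain
  of shears ends with \<open>y' = \<gamma>\<close>, which is nonzero because some scalar quantum matrix has
  \<open>\<gamma> = 1\<close>.

  All of this is carried out in rings given by a type. The bridge to the presented algebra, whose
  elements are cosets, is a faithful representation by right linear operators on functions
  on words (\<open>iota\<close>, \<open>rep\<close>). Its defining relations provide exactly the homomorphisms that the shears require.
\<close>

section \<open>Algebras as types\<close>

text \<open>An algebra is a ring type together with a scalar multiplication, so that the same ring may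
  carry operators and scalars without any carrier set; subalgebras are sets of the form \<open>gsub X\<close>.\<close>

locale kalgebra = vector_space sm
  for sm :: "'k::field \<Rightarrow> 'a::ring_1 \<Rightarrow> 'a" (infixr \<open>\<cdot>\<close> 75) +
  assumes sm_mult_left [simp]: "(c \<cdot> x) * y = c \<cdot> (x * y)"
    and sm_mult_right [simp]: "x * (c \<cdot> y) = c \<cdot> (x * y)"
begin

inductive_set gsub :: "'a set \<Rightarrow> 'a set" for X where
  gen: "x \<in> X \<Longrightarrow> x \<in> gsub X"
| one: "1 \<in> gsub X"
| add: "x \<in> gsub X \<Longrightarrow> y \<in> gsub X \<Longrightarrow> x + y \<in> gsub X"
| mult: "x \<in> gsub X \<Longrightarrow> y \<in> gsub X \<Longrightarrow> x * y \<in> gsub X"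
| scale: "x \<in> gsub X \<Longrightarrow> c \<cdot> x \<in> gsub X"

lemma gsub_zero: "0 \<in> gsub X"
  using gsub.scale[OF gsub.one, of 0] by simp

lemma gsub_minus: "x \<in> gsub X \<Longrightarrow> - x \<in> gsub X"
  using gsub.scale[of x X "-1"] by simp

lemma gsub_diff: "x \<in> gsub X \<Longrightarrow> y \<in> gsub X \<Longrightarrow> x - y \<in> gsub X"
  using gsub.add[of x X "- y"] gsub_minus[of y X] by simp

lemma gsub_sum: "(\<And>i. i \<in> I \<Longrightarrow> f i \<in> gsub X) \<Longrightarrow> sum f I \<in> gsub X"
  by (induction I rule: infinite_finite_induct) (auto intro: gsub.add gsub_zero)

lemma gsub_power: "x \<in> gsub X \<Longrightarrow> x ^ n \<in> gsub X"
  by (induction n) (auto intro: gsub.one gsub.mult)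

lemma gsub_least:
  assumes "x \<in> gsub X" "X \<subseteq> gsub Y" shows "x \<in> gsub Y"
  using assms(1) by induction (use assms(2) in \<open>auto intro: gsub.intros\<close>)

lemma gsub_mono: "X \<subseteq> Y \<Longrightarrow> gsub X \<subseteq> gsub Y"
  by (meson gsub.gen gsub_least subset_iff)

section \<open>Quantum matrices and their minors\<close>

text \<open>Quantum matrices have rows and columns indexed by all natural numbers. A matrix of finite
  size is extended by zero, which is compatible with the relations.\<close>

definition qmat :: "'k \<Rightarrow> (nat \<Rightarrow> nat \<Rightarrow> 'a) \<Rightarrow> bool" where
  "qmat q x \<longleftrightarrow>
     (\<forall>i j l. j < l \<longrightarrow> x i j * x i l = q \<cdot> (x i l * x i j)) \<and>
     (\<forall>i j k. i < k \<longrightarrow> x i j * x k j = q \<cdot> (x k j * x i j)) \<and>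
     (\<forall>i j k l. i < k \<and> j < l \<longrightarrow> x i l * x k j = x k j * x i l) \<and>
     (\<forall>i j k l. i < k \<and> j < l \<longrightarrow>
        x i j * x k l = x k l * x i j + (q - inverse q) \<cdot> (x i l * x k j))"

lemma qmat_row: "qmat q x \<Longrightarrow> j < l \<Longrightarrow> x i j * x i l = q \<cdot> (x i l * x i j)"
  and qmat_col: "qmat q x \<Longrightarrow> i < k \<Longrightarrow> x i j * x k j = q \<cdot> (x k j * x i j)"
  and qmat_anti: "qmat q x \<Longrightarrow> i < k \<Longrightarrow> j < l \<Longrightarrow> x i l * x k j = x k j * x i l"
  and qmat_diag: "qmat q x \<Longrightarrow> i < k \<Longrightarrow> j < l \<Longrightarrow>
        x i j * x k l = x k l * x i j + (q - inverse q) \<cdot> (x i l * x k j)"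
  unfolding qmat_def by iprover+

lemma qmat_transpose:
  assumes "qmat q x" shows "qmat q (\<lambda>i j. x j i)"
  unfolding qmat_def
proof (intro conjI allI impI; (elim conjE)?)
  fix i j k l :: nat assume ij: "i < k" "j < l"
  have anti: "x l i * x j k = x j k * x l i"
    using qmat_anti[OF assms ij(2,1)] by (rule sym)
  then show "x l i * x j k = x j k * x l i" .
  show "x j i * x l k = x l k * x j i + (q - inverse q) \<cdot> (x l i * x j k)"
    unfolding anti by (rule qmat_diag[OF assms ij(2,1)])
next
  fix i j l :: nat assume "j < l"
  then show "x j i * x l i = q \<cdot> (x l i * x j i)" by (rule qmat_col[OF assms])
next
  fix i j k :: nat assume "i < k"
  then show "x j i * x j k = q \<cdot> (x j k * x j i)" by (rule qmat_row[OF assms])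
qed

text \<open>Expansion along the first row. The sign counts the columns of \<open>J\<close> to the left of \<open>j\<close>, that
  is the inversions caused by \<open>j\<close>. Homomorphisms visibly preserve this expansion.\<close>

fun qdet :: "'k \<Rightarrow> (nat \<Rightarrow> nat \<Rightarrow> 'a) \<Rightarrow> nat list \<Rightarrow> nat set \<Rightarrow> 'a" where
  "qdet q x [] J = (if J = {} then 1 else 0)"
| "qdet q x (i # is) J =
     (\<Sum>j\<in>J. (- q) ^ card {l\<in>J. l < j} \<cdot> (x i j * qdet q x is (J - {j})))"

definition minor :: "'k \<Rightarrow> (nat \<Rightarrow> nat \<Rightarrow> 'a) \<Rightarrow> nat set \<Rightarrow> nat set \<Rightarrow> 'a" where
  "minor q x A B = qdet q x (sorted_list_of_set A) B"

lemma minor_expand: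
  assumes "finite A" "A \<noteq> {}"
  shows "minor q x A B = (\<Sum>j\<in>B. (- q) ^ card {l\<in>B. l < j} \<cdot>
           (x (Min A) j * minor q x (A - {Min A}) (B - {j})))"
  unfolding minor_def by (subst sorted_list_of_set_nonempty[OF assms]) simp

lemma minor_empty: "minor q x {} B = (if B = {} then 1 else 0)"
  by (simp add: minor_def)

lemma qdet_in_gsub:
  assumes "\<And>i j. i \<in> set is \<Longrightarrow> j \<in> J \<Longrightarrow> x i j \<in> gsub X"
  shows "qdet q x is J \<in> gsub X"
  using assms
proof (induction "is" arbitrary: J)
  case (Cons i "is")
  then have "qdet q x is (J - {j}) \<in> gsub X" for j by (intro Cons.IH) auto
  then show ?case using Cons.prems by (auto intro!: gsub_sum gsub.scale gsub.mult)
qed (auto intro: gsub.one gsub_zero)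

lemma minor_in_gsub:
  assumes "\<And>i j. i \<in> A \<Longrightarrow> j \<in> B \<Longrightarrow> x i j \<in> gsub X" "finite A"
  shows "minor q x A B \<in> gsub X"
  unfolding minor_def by (rule qdet_in_gsub) (use assms in auto)

text \<open>Expanding the minor along the first row and then along the first column, or in the other
  order, gives the same double sum over \<open>i \<in> A \<setminus> {a}\<close> and \<open>j \<in> B \<setminus> {b}\<close>, because \<open>x\<^sub>a\<^sub>j\<close> and \<open>x\<^sub>i\<^sub>b\<close>
  lie on an antidiagonal and hence commute. The induction hypothesis transposes the smaller
  minors.\<close>

lemma minor_transpose:
  assumes "finite A" "finite B" "card A = card B" "qmat q x"
  shows "minor q x A B = minor q (\<lambda>i j. x j i) B A"
  using assms(1-3)
proof (induction "card A" arbitrary: A B rule: less_induct)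
  case less
  show ?case
  proof (cases "A = {}")
    case True
    then have "B = {}" using less.prems by simp
    then show ?thesis using True by (simp add: minor_empty)
  next
    case False
    then have B: "B \<noteq> {}" using less.prems by auto
    define a b where "a = Min A" and "b = Min B"
    have a: "a \<in> A" and b: "b \<in> B" using False B less.prems by (auto simp: a_def b_def)
    have alt: "a < i" if "i \<in> A - {a}" for i
      using that less.prems by (auto simp: a_def order.not_eq_order_implies_strict)
    have blt: "b < j" if "j \<in> B - {b}" for j
      using that less.prems by (auto simp: b_def order.not_eq_order_implies_strict)
    have ca: "card {l\<in>A. l < i} = Suc (card {l\<in>A - {a}. l < i})" if "i \<in> A - {a}" for i
    proof -
      have "{l\<in>A. l < i} = insert a {l\<in>A - {a}. l < i}" using a alt[OF that] by auto
      then show ?thesis using less.prems by simp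
    qed
    have cb: "card {l\<in>B. l < j} = Suc (card {l\<in>B - {b}. l < j})" if "j \<in> B - {b}" for j
    proof -
      have "{l\<in>B. l < j} = insert b {l\<in>B - {b}. l < j}" using b blt[OF that] by auto
      then show ?thesis using less.prems by simp
    qed
    have ca0: "{l\<in>A. l < a} = {}" using less.prems by (auto simp: a_def not_less)
    have cb0: "{l\<in>B. l < b} = {}" using less.prems by (auto simp: b_def not_less)
    let ?y = "\<lambda>i j. x j i"
    have cA: "card (A - {i}) < card A" if "i \<in> A" for i
      using that less.prems by (intro card_Diff1_less)
    have IH: "minor q x (A - {i}) (B - {j}) = minor q ?y (B - {j}) (A - {i})" if "i \<in> A" "j \<in> B" for i j
      using less.hyps[of "A - {i}" "B - {j}"] that less.prems cA by simp
    have IH2: "minor q x (A - {i} - {a}) (B - {j} - {b}) = minor q ?y (B - {j} - {b}) (A - {i} - {a})"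
      if "i \<in> A - {a}" "j \<in> B - {b}" for i j
    proof (rule less.hyps)
      have "card (A - {i} - {a}) \<le> card (A - {i})" using less.prems by (intro card_mono) auto
      then show "card (A - {i} - {a}) < card A" using cA[of i] that by simp
      show "card (A - {i} - {a}) = card (B - {j} - {b})"
        using that a b less.prems by (simp add: card_Diff_singleton_if)
    qed (use less.prems in auto)
    have Diff_right_commute: "X - {u} - {v} = X - {v} - {u}" for X :: "nat set" and u v by auto
    define m where "m i j = minor q x (A - {a} - {i}) (B - {b} - {j})" for i j
    have L: "minor q x (A - {a}) (B - {j}) =
        (\<Sum>i\<in>A - {a}. (- q) ^ card {l\<in>A - {a}. l < i} \<cdot> (x i b * m i j))" if "j \<in> B - {b}" for j
    proof -
      have "Min (B - {j}) = b" using that b blt less.prems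
        by (intro Min_eqI) (auto simp: b_def)
      moreover have "B - {j} \<noteq> {}" using b that by auto
      ultimately have "minor q ?y (B - {j}) (A - {a}) = (\<Sum>i\<in>A - {a}. (- q) ^ card {l\<in>A - {a}. l < i} \<cdot>
          (x i b * minor q ?y (B - {j} - {b}) (A - {a} - {i})))"
        using minor_expand[of "B - {j}" q ?y "A - {a}"] less.prems by simp
      moreover have "minor q ?y (B - {j} - {b}) (A - {a} - {i}) = m i j" if "i \<in> A - {a}" for i
        using IH2[OF that \<open>j \<in> B - {b}\<close>] by (simp add: m_def Diff_right_commute)
      ultimately show ?thesis using IH[of a j] a that by simp
    qed
    have R: "minor q ?y (B - {b}) (A - {i}) =
        (\<Sum>j\<in>B - {b}. (- q) ^ card {l\<in>B - {b}. l < j} \<cdot> (x a j * m i j))" if "i \<in> A - {a}" for i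
    proof -
      have "Min (A - {i}) = a" using that a alt less.prems
        by (intro Min_eqI) (auto simp: a_def)
      moreover have "A - {i} \<noteq> {}" using a that by auto
      ultimately have "minor q x (A - {i}) (B - {b}) = (\<Sum>j\<in>B - {b}. (- q) ^ card {l\<in>B - {b}. l < j} \<cdot>
          (x a j * minor q x (A - {i} - {a}) (B - {b} - {j})))"
        using minor_expand[of "A - {i}" q x "B - {b}"] less.prems by simp
      moreover have "A - {i} - {a} = A - {a} - {i}" by auto
      ultimately show ?thesis using IH[of i b] b that by (simp add: m_def)
    qed
    have "minor q x A B = (x a b * minor q x (A - {a}) (B - {b})) +
        (\<Sum>j\<in>B - {b}. (- q) ^ card {l\<in>B. l < j} \<cdot> (x a j * minor q x (A - {a}) (B - {j})))"
      using minor_expand[OF less.prems(1) False, of q x B] cb0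
      by (simp add: a_def[symmetric] sum.remove[OF less.prems(2) b])
    also have "(\<Sum>j\<in>B - {b}. (- q) ^ card {l\<in>B. l < j} \<cdot> (x a j * minor q x (A - {a}) (B - {j}))) =
       (\<Sum>j\<in>B - {b}. \<Sum>i\<in>A - {a}. (- q) ^ (Suc (card {l\<in>B - {b}. l < j} + card {l\<in>A - {a}. l < i}))
          \<cdot> (x i b * (x a j * m i j)))"
    proof (rule sum.cong[OF refl])
      fix j assume j: "j \<in> B - {b}"
      have "x a j * x i b = x i b * x a j" if "i \<in> A - {a}" for i
        using qmat_anti[OF assms(4) alt[OF that] blt[OF j]] .
      then have "x a j * (x i b * m i j) = x i b * (x a j * m i j)" if "i \<in> A - {a}" for i
        using that by (metis mult.assoc)
      then show "(- q) ^ card {l\<in>B. l < j} \<cdot> (x a j * minor q x (A - {a}) (B - {j})) =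
        (\<Sum>i\<in>A - {a}. (- q) ^ (Suc (card {l\<in>B - {b}. l < j} + card {l\<in>A - {a}. l < i}))
          \<cdot> (x i b * (x a j * m i j)))"
        by (simp add: L[OF j] cb[OF j] sum_distrib_left scale_sum_right power_add mult_ac)
    qed
    also have "\<dots> = (\<Sum>i\<in>A - {a}. \<Sum>j\<in>B - {b}. (- q) ^ (Suc (card {l\<in>B - {b}. l < j} + card {l\<in>A - {a}. l < i}))
          \<cdot> (x i b * (x a j * m i j)))" by (rule sum.swap)
    also have "\<dots> = (\<Sum>i\<in>A - {a}. (- q) ^ card {l\<in>A. l < i} \<cdot> (x i b * minor q ?y (B - {b}) (A - {i})))"
      by (rule sum.cong[OF refl])
         (simp add: R ca sum_distrib_left scale_sum_right power_add mult_ac)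
    also have "x a b * minor q x (A - {a}) (B - {b}) + \<dots> = minor q ?y B A"
      using minor_expand[OF less.prems(2) B, of q ?y A] ca0 IH[OF a b]
      by (simp add: b_def[symmetric] sum.remove[OF less.prems(1) a])
    finally show ?thesis .
  qed
qed

lemma qdet_weights:
  assumes "\<And>i j. i \<in> set is \<Longrightarrow> j \<in> J \<Longrightarrow> z * x i j = (u i * v j) \<cdot> (x i j * z)"
    and "finite J" "card J = length is"
  shows "z * qdet q x is J = (prod_list (map u is) * prod v J) \<cdot> (qdet q x is J * z)"
  using assms
proof (induction "is" arbitrary: J)
  case Nil
  then show ?case by simp
next
  case (Cons i "is")
  have IH: "z * qdet q x is (J - {j}) = (prod_list (map u is) * prod v (J - {j})) \<cdot> (qdet q x is (J - {j}) * z)"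
    if "j \<in> J" for j
    by (rule Cons.IH) (use Cons.prems that in auto)
  have "z * (x i j * qdet q x is (J - {j})) =
      (prod_list (map u (i # is)) * prod v J) \<cdot> (x i j * qdet q x is (J - {j}) * z)" if "j \<in> J" for j
  proof -
    have "z * (x i j * qdet q x is (J - {j})) = (z * x i j) * qdet q x is (J - {j})" by (simp add: mult.assoc)
    also have "\<dots> = (u i * v j) \<cdot> (x i j * (z * qdet q x is (J - {j})))"
      using Cons.prems that by (simp add: mult.assoc)
    also have "\<dots> = (prod_list (map u (i # is)) * prod v J) \<cdot> (x i j * qdet q x is (J - {j}) * z)"
      by (simp add: IH[OF that] prod.remove[OF Cons.prems(2) that] mult_ac mult.assoc)
    finally show ?thesis .
  qed
  then show ?case
    by (simp add: sum_distrib_left sum_distrib_right scale_sum_right mult_ac)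
qed

text \<open>Each summand of the minor contains every row of \<open>A\<close> and every column of \<open>B\<close> exactly once, so
  all summands commute with \<open>z\<close> up to the same scalar. This is the source of all extremal
  relations.\<close>

lemma minor_weights:
  assumes "\<And>i j. i \<in> A \<Longrightarrow> j \<in> B \<Longrightarrow> z * x i j = (u i * v j) \<cdot> (x i j * z)"
    and "finite A" "finite B" "card A = card B"
  shows "z * minor q x A B = (prod u A * prod v B) \<cdot> (minor q x A B * z)"
proof -
  have "prod_list (map u (sorted_list_of_set A)) = prod u A"
    using assms(2) by (metis distinct_sorted_list_of_set prod.distinct_set_conv_list set_sorted_list_of_set)
  then show ?thesis unfolding minor_def
    using qdet_weights[of "sorted_list_of_set A" B z x u v q] assms by simp
qed

end

section \<open>Right linear operators\<close>

text \<open>Right linear operators on functions: the target of the shears for \<open>\<int>\<close>-indexed sequences, and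
  the ring in which the presented algebra is represented for functions on words. Right linearity
  leaves room for left multiplications.\<close>

typedef (overloaded) ('i, 'a::ring_1) rop =
  "{T :: ('i \<Rightarrow> 'a) \<Rightarrow> ('i \<Rightarrow> 'a). (\<forall>f g. T (\<lambda>i. f i + g i) = (\<lambda>i. T f i + T g i)) \<and>
     (\<forall>f a. T (\<lambda>i. f i * a) = (\<lambda>i. T f i * a))}"
  morphisms rapp Rop
  by (rule exI[of _ "\<lambda>f. f"]) auto

setup_lifting type_definition_rop

instantiation rop :: (type, ring_1) ring_1
begin
lift_definition zero_rop :: "('a, 'b) rop" is "\<lambda>f i. 0" by auto
lift_definition one_rop :: "('a, 'b) rop" is "\<lambda>f. f" by auto
lift_definition plus_rop :: "('a, 'b) rop \<Rightarrow> ('a, 'b) rop \<Rightarrow> ('a, 'b) rop"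
  is "\<lambda>S T f i. S f i + T f i" by (auto simp: fun_eq_iff algebra_simps)
lift_definition minus_rop :: "('a, 'b) rop \<Rightarrow> ('a, 'b) rop \<Rightarrow> ('a, 'b) rop"
  is "\<lambda>S T f i. S f i - T f i" by (auto simp: fun_eq_iff algebra_simps)
lift_definition uminus_rop :: "('a, 'b) rop \<Rightarrow> ('a, 'b) rop"
  is "\<lambda>S f i. - S f i" by (auto simp: fun_eq_iff algebra_simps)
lift_definition times_rop :: "('a, 'b) rop \<Rightarrow> ('a, 'b) rop \<Rightarrow> ('a, 'b) rop"
  is "\<lambda>S T f. S (T f)" by auto
instance
proof
  show "(0::('a, 'b) rop) \<noteq> 1"
  proof (transfer, rule notI)
    assume "(\<lambda>f i. 0 :: 'b) = (\<lambda>f::'a \<Rightarrow> 'b. f)"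
    from fun_cong[OF fun_cong[OF this, of "\<lambda>_. 1"]] show False by simp
  qed
qed (transfer; auto simp: fun_eq_iff algebra_simps)+
end

lift_definition dgf :: "('i \<Rightarrow> 'a::ring_1) \<Rightarrow> ('i, 'a) rop" is "\<lambda>u f i. u i * f i"
  by (auto simp: algebra_simps)

abbreviation dg :: "'a::ring_1 \<Rightarrow> ('i, 'a) rop" where "dg a \<equiv> dgf (\<lambda>_. a)"

lift_definition bt :: "(int, 'a::ring_1) rop" is "\<lambda>f n. f (n - 1)" by auto

definition single :: "'i \<Rightarrow> 'a \<Rightarrow> 'i \<Rightarrow> 'a::ring_1" where
  "single n a = (\<lambda>i. if i = n then a else 0)"

lemma rapp_simps [simp]:
  "rapp (S + T) f n = rapp S f n + rapp T f n"
  "rapp (S - T) f n = rapp S f n - rapp T f n"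
  "rapp (S * T) f = rapp S (rapp T f)"
  "rapp 1 f = f"
  "rapp 0 f n = 0"
  "rapp (dgf u) f i = u i * f i"
  "rapp bt g k = g (k - 1)"
  by (transfer; simp)+

lemma rapp_dgf: "rapp (dgf u) f = (\<lambda>i. u i * f i)"
  by (rule ext) simp

lemma dgf_mult: "dgf u * dgf v = dgf (\<lambda>i. u i * v i)"
  and dgf_add: "dgf u + dgf v = dgf (\<lambda>i. u i + v i)"
  by (transfer; simp add: algebra_simps)+

lemma dg_0 [simp]: "dgf (\<lambda>_. 0) = 0" and dg_1 [simp]: "dgf (\<lambda>_. 1) = 1"
  by (transfer; simp)+

lemma dg_sum: "dg (sum f A) = (\<Sum>a\<in>A. dg (f a))"
  by (induction A rule: infinite_finite_induct) (auto simp: dgf_add[symmetric])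

lemma bt_dg: "bt * dg u = dg u * bt"
  by (transfer; simp)

lemma rapp_mult_right: "rapp T (\<lambda>i. f i * a) = (\<lambda>i. rapp T f i * a)"
  by transfer auto

lemma rapp_add_right: "rapp T (\<lambda>i. f i + g i) = (\<lambda>i. rapp T f i + rapp T g i)"
  by transfer auto

lemma rop_eqI: "(\<And>f n. rapp S f n = rapp T f n) \<Longrightarrow> S = T"
  by transfer (auto simp: fun_eq_iff)

context kalgebra
begin

text \<open>Scalars act by left multiplication, which is central because \<open>c \<cdot> 1\<close> is central in the
  coefficient ring.\<close>

definition rsm :: "'k \<Rightarrow> ('i, 'a) rop \<Rightarrow> ('i, 'a) rop" where
  "rsm c T = dg (c \<cdot> 1) * T"

lemma rapp_rsm [simp]: "rapp (rsm c T) f n = c \<cdot> rapp T f n"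
  by (simp add: rsm_def)

lemma rapp_scale: "rapp T (\<lambda>i. c \<cdot> f i) = (\<lambda>i. c \<cdot> rapp T f i)"
  using rapp_mult_right[of T f "c \<cdot> 1"] by simp

lemma kalgebra_rsm: "kalgebra (rsm :: 'k \<Rightarrow> ('i, 'a) rop \<Rightarrow> ('i, 'a) rop)"
  by standard (auto intro!: rop_eqI simp: scale_right_distrib scale_left_distrib rapp_scale
      rapp_add_right, auto simp: rsm_def[abs_def] rapp_scale rapp_dgf)

lemma dg_scale: "dg (c \<cdot> u) = rsm c (dg u)"
  by (rule rop_eqI) simp

end

section \<open>Elementary shears\<close>

locale qalgebra = kalgebra sm
  for sm :: "'k::field \<Rightarrow> 'a::ring_1 \<Rightarrow> 'a" (infixr \<open>\<cdot>\<close> 75) +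
  fixes q :: 'k
  assumes q_nonzero: "q \<noteq> 0"
begin

text \<open>The relations of a quantum matrix involve at most two columns at a time. Splitting them into
  relations inside one column and between two columns lets column operations be checked on the
  columns that they change.\<close>

definition selfcol :: "(nat \<Rightarrow> 'a) \<Rightarrow> bool" where
  "selfcol C \<longleftrightarrow> (\<forall>i k. i < k \<longrightarrow> C i * C k = q \<cdot> (C k * C i))"

definition colpair :: "(nat \<Rightarrow> 'a) \<Rightarrow> (nat \<Rightarrow> 'a) \<Rightarrow> bool" where
  "colpair C D \<longleftrightarrow> (\<forall>i. C i * D i = q \<cdot> (D i * C i)) \<and>
     (\<forall>i k. i < k \<longrightarrow> D i * C k = C k * D i) \<and>
     (\<forall>i k. i < k \<longrightarrow> C i * D k = D k * C i + (q - inverse q) \<cdot> (D i * C k))"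

lemma qmat_columns:
  "qmat q x \<longleftrightarrow> (\<forall>j. selfcol (\<lambda>i. x i j)) \<and> (\<forall>j l. j < l \<longrightarrow> colpair (\<lambda>i. x i j) (\<lambda>i. x i l))"
  unfolding qmat_def selfcol_def colpair_def by iprover

lemma selfcolD: "selfcol C \<Longrightarrow> i < k \<Longrightarrow> C i * C k = q \<cdot> (C k * C i)"
  unfolding selfcol_def by iprover

lemma colpairD:
  assumes "colpair C D"
  shows "C i * D i = q \<cdot> (D i * C i)"
    and "i < k \<Longrightarrow> D i * C k = C k * D i"
    and "i < k \<Longrightarrow> C i * D k = D k * C i + (q - inverse q) \<cdot> (C k * D i)"
  using assms unfolding colpair_def by simp_all

lemma colpair_add: "colpair X Y \<Longrightarrow> colpair X Z \<Longrightarrow> colpair X (\<lambda>i. Y i + Z i)"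
  and colpair_add': "colpair Y X \<Longrightarrow> colpair Z X \<Longrightarrow> colpair (\<lambda>i. Y i + Z i) X"
  unfolding colpair_def by (simp_all add: distrib_left distrib_right scale_right_distrib)

lemma colpair_mult:
  assumes "colpair X Y" "\<And>i. S * X i = X i * S"
  shows "colpair X (\<lambda>i. Y i * S)"
proof -
  have "Y i * S * X k = (Y i * X k) * S" for i k by (simp add: assms(2) mult.assoc)
  moreover have "X i * (Y k * S) = (X i * Y k) * S" for i k by (simp add: mult.assoc)
  ultimately show ?thesis using assms(1) unfolding colpair_def by (simp add: distrib_right)
qed

lemma colpair_mult':
  assumes "colpair Y X" "\<And>i. S * X i = X i * S"
  shows "colpair (\<lambda>i. Y i * S) X"
proof -
  have "Y i * S * X k = (Y i * X k) * S" for i k by (simp add: assms(2) mult.assoc)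
  moreover have "X i * (Y k * S) = (X i * Y k) * S" for i k by (simp add: mult.assoc)
  ultimately show ?thesis using assms(1) unfolding colpair_def by (simp add: distrib_right)
qed

lemma colpair_0: "colpair X (\<lambda>_. 0)" "colpair (\<lambda>_. 0) X" and selfcol_0: "selfcol (\<lambda>_. 0)"
  by (simp_all add: colpair_def selfcol_def)

lemma selfcol_mult:
  assumes "selfcol C" "\<And>i. S * C i = C i * S"
  shows "selfcol (\<lambda>i. C i * S)"
proof -
  have "C i * S * (C k * S) = (C i * C k) * (S * S)" for i k
    by (metis assms(2) mult.assoc)
  then show ?thesis using assms(1) unfolding selfcol_def by simp
qed

lemma assoc_left: "x * y = w \<Longrightarrow> x * (y * z) = w * z" for x y z w :: 'a
  by (simp add: mult.assoc[symmetric])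

text \<open>A combination \<open>D S + C T\<close> of two columns of a quantum matrix satisfies the relations of a
  single column if \<open>S\<close> and \<open>T\<close> commute with the entries and \<open>T S = q S T\<close>: this factor turns the
  commutator term \<open>(q - q\<inverse>) C D\<close> of the diagonal relation into the required power of \<open>q\<close>.\<close>

lemma shear_selfcol_right:
  assumes "selfcol C" "selfcol D" "colpair C D"
    and S: "\<And>i. S * C i = C i * S" "\<And>i. S * D i = D i * S"
    and T: "\<And>i. T * C i = C i * T" "\<And>i. T * D i = D i * T" and TS: "T * S = q \<cdot> (S * T)"
  shows "selfcol (\<lambda>i. D i * S + C i * T)"
  unfolding selfcol_def
proof (intro allI impI)
  fix i k :: nat assume "i < k"
  have 1: "D i * D k = q \<cdot> (D k * D i)" "C i * C k = q \<cdot> (C k * C i)" "D i * C k = C k * D i"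
    "C i * D k = D k * C i + (q - inverse q) \<cdot> (C k * D i)"
    by (rule selfcolD[OF assms(2) \<open>i < k\<close>] selfcolD[OF assms(1) \<open>i < k\<close>] colpairD[OF assms(3)] \<open>i < k\<close>)+
  note S' = S[THEN assoc_left] T[THEN assoc_left] TS[THEN assoc_left] and R1 = 1[THEN assoc_left]
  show "(D i * S + C i * T) * (D k * S + C k * T) = q \<cdot> ((D k * S + C k * T) * (D i * S + C i * T))"
    using q_nonzero
    by (simp add: distrib_left distrib_right mult.assoc S T TS S' 1 R1 scale_right_distrib
        scale_left_distrib scale_left_diff_distrib algebra_simps)
qed

lemma shear_selfcol_left:
  assumes "selfcol C" "selfcol D" "colpair C D"
    and S: "\<And>i. S * C i = C i * S" "\<And>i. S * D i = D i * S"
    and T: "\<And>i. T * C i = C i * T" "\<And>i. T * D i = D i * T" and TS: "S * T = q \<cdot> (T * S)"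
  shows "selfcol (\<lambda>i. C i * S + D i * T)"
  unfolding selfcol_def
proof (intro allI impI)
  fix i k :: nat assume "i < k"
  have 1: "D i * D k = q \<cdot> (D k * D i)" "C i * C k = q \<cdot> (C k * C i)" "D i * C k = C k * D i"
    "C i * D k = D k * C i + (q - inverse q) \<cdot> (C k * D i)"
    by (rule selfcolD[OF assms(2) \<open>i < k\<close>] selfcolD[OF assms(1) \<open>i < k\<close>] colpairD[OF assms(3)] \<open>i < k\<close>)+
  note S' = S[THEN assoc_left] T[THEN assoc_left] TS[THEN assoc_left] and R1 = 1[THEN assoc_left]
  show "(C i * S + D i * T) * (C k * S + D k * T) = q \<cdot> ((C k * S + D k * T) * (C i * S + D i * T))"
    using q_nonzero
    by (simp add: distrib_left distrib_right mult.assoc S T TS S' 1 R1 scale_right_distrib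
        scale_left_distrib scale_left_diff_distrib algebra_simps)
qed

lemma shear_colpair_right:
  assumes "selfcol C" "selfcol D" "colpair C D"
    and S: "\<And>i. S * C i = C i * S" "\<And>i. S * D i = D i * S"
    and S': "\<And>i. S' * C i = C i * S'" "\<And>i. S' * D i = D i * S'" and SS: "S' * S = S * S'"
    and T: "\<And>i. T * C i = C i * T" "\<And>i. T * D i = D i * T" and TS: "S * T = q \<cdot> (T * S)"
  shows "colpair (\<lambda>i. C i * S) (\<lambda>i. D i * S' + C i * T)"
proof -
  note S1 = S[THEN assoc_left] T[THEN assoc_left] TS[THEN assoc_left] SS[THEN assoc_left] S'[THEN assoc_left]
  have "C i * S * (D i * S' + C i * T) = q \<cdot> ((D i * S' + C i * T) * (C i * S))" for i
  proof -
    have 1: "C i * D i = q \<cdot> (D i * C i)" by (rule colpairD[OF assms(3)])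
    show ?thesis
      by (simp add: distrib_left distrib_right mult.assoc S T TS SS S' S1 1 1[THEN assoc_left] scale_right_distrib)
  qed
  moreover have "(D i * S' + C i * T) * (C k * S) = C k * S * (D i * S' + C i * T)"
    "C i * S * (D k * S' + C k * T) = (D k * S' + C k * T) * (C i * S) + (q - inverse q) \<cdot> ((D i * S' + C i * T) * (C k * S))"
    if "i < k" for i k
  proof -
    have 1: "C i * C k = q \<cdot> (C k * C i)" "D i * C k = C k * D i"
    "C i * D k = D k * C i + (q - inverse q) \<cdot> (C k * D i)"
      by (rule selfcolD[OF assms(2) that] selfcolD[OF assms(1) that] colpairD[OF assms(3)] that)+
    show "(D i * S' + C i * T) * (C k * S) = C k * S * (D i * S' + C i * T)"
      "C i * S * (D k * S' + C k * T) = (D k * S' + C k * T) * (C i * S) + (q - inverse q) \<cdot> ((D i * S' + C i * T) * (C k * S))"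
      using q_nonzero
      by (simp_all add: distrib_left distrib_right mult.assoc S T TS SS S' S1 1 1[THEN assoc_left]
        scale_right_distrib scale_left_distrib scale_left_diff_distrib algebra_simps)
  qed
  ultimately show ?thesis unfolding colpair_def by blast
qed

lemma shear_colpair_left:
  assumes "selfcol C" "selfcol D" "colpair C D"
    and S: "\<And>i. S * C i = C i * S" "\<And>i. S * D i = D i * S"
    and S': "\<And>i. S' * C i = C i * S'" "\<And>i. S' * D i = D i * S'" and SS: "S' * S = S * S'"
    and T: "\<And>i. T * C i = C i * T" "\<And>i. T * D i = D i * T" and TS: "T * S' = q \<cdot> (S' * T)"
  shows "colpair (\<lambda>i. C i * S + D i * T) (\<lambda>i. D i * S')"
proof -
  note S1 = S[THEN assoc_left] T[THEN assoc_left] TS[THEN assoc_left] SS[THEN assoc_left] S'[THEN assoc_left]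
  have "(C i * S + D i * T) * (D i * S') = q \<cdot> (D i * S' * (C i * S + D i * T))" for i
  proof -
    have 1: "C i * D i = q \<cdot> (D i * C i)" by (rule colpairD[OF assms(3)])
    show ?thesis
      by (simp add: distrib_left distrib_right mult.assoc S T TS SS S' S1 1 1[THEN assoc_left] scale_right_distrib)
  qed
  moreover have "D i * S' * (C k * S + D k * T) = (C k * S + D k * T) * (D i * S')"
    "(C i * S + D i * T) * (D k * S') = D k * S' * (C i * S + D i * T) + (q - inverse q) \<cdot> (D i * S' * (C k * S + D k * T))"
    if "i < k" for i k
  proof -
    have 1: "D i * D k = q \<cdot> (D k * D i)" "D i * C k = C k * D i"
    "C i * D k = D k * C i + (q - inverse q) \<cdot> (C k * D i)"
      by (rule selfcolD[OF assms(2) that] selfcolD[OF assms(1) that] colpairD[OF assms(3)] that)+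
    show "D i * S' * (C k * S + D k * T) = (C k * S + D k * T) * (D i * S')"
      "(C i * S + D i * T) * (D k * S') = D k * S' * (C i * S + D i * T) + (q - inverse q) \<cdot> (D i * S' * (C k * S + D k * T))"
      using q_nonzero
      by (simp_all add: distrib_left distrib_right mult.assoc S T TS SS S' S1 1 1[THEN assoc_left]
        scale_right_distrib scale_left_distrib scale_left_diff_distrib algebra_simps)
  qed
  ultimately show ?thesis unfolding colpair_def by blast
qed

end

context qalgebra
begin

interpretation M: qalgebra "rsm :: 'k \<Rightarrow> (int, 'a) rop \<Rightarrow> (int, 'a) rop" q
  by (intro qalgebra.intro kalgebra_rsm qalgebra_axioms.intro q_nonzero)

text \<open>The power \<open>k\<^sup>e\<close> of the diagonal operator with entry \<open>q\<^sup>n\<close> on level \<open>n\<close>.\<close>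

definition kp :: "int \<Rightarrow> (int, 'a) rop" where
  "kp e = dgf (\<lambda>n. (q powi (e * n)) \<cdot> 1)"

lemma rapp_kp [simp]: "rapp (kp e) f n = (q powi (e * n)) \<cdot> f n"
  by (simp add: kp_def)

lemma kp_mult: "kp e * kp e' = kp (e + e')"
  by (rule rop_eqI) (simp add: power_int_add q_nonzero distrib_right)

lemma kp_0 [simp]: "kp 0 = 1"
  by (rule rop_eqI) simp

lemma kp_dg: "kp e * dg u = dg u * kp e"
  by (rule rop_eqI) simp

lemma bt_kp: "bt * kp e = rsm (q powi (- e)) (kp e * bt)"
  by (rule rop_eqI) (simp add: power_int_add[symmetric] q_nonzero algebra_simps)

lemma kp_bt: "kp e * bt = rsm (q powi e) (bt * kp e)"
  by (simp add: bt_kp power_int_add[symmetric] q_nonzero)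

text \<open>Column \<open>r\<close> is the source and column \<open>p\<close> the target: in a minor, an index \<open>r\<close> can be replaced
  by \<open>p\<close> at the cost of \<open>\<beta>\<close>. The smaller one of the two columns is multiplied by \<open>k\<close>, the larger
  one by \<open>k\<inverse>\<close>.\<close>

definition shear :: "nat \<Rightarrow> nat \<Rightarrow> (nat \<Rightarrow> nat \<Rightarrow> 'a) \<Rightarrow> nat \<Rightarrow> nat \<Rightarrow> (int, 'a) rop" where
  "shear p r x i j =
     (if j = r then dg (x i r) * kp (if r < p then 1 else -1) + dg (x i p) * bt
      else if j = p then dg (x i p) * kp (if r < p then -1 else 1)
      else if min p r < j \<and> j < max p r then 0
      else dg (x i j))"

lemma dg_selfcol:
  assumes "selfcol C" shows "M.selfcol (\<lambda>i. dg (C i))"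
  unfolding M.selfcol_def dgf_mult dg_scale[symmetric]
  using selfcolD[OF assms] by simp

lemma dg_colpair:
  assumes "colpair C D" shows "M.colpair (\<lambda>i. dg (C i)) (\<lambda>i. dg (D i))"
proof -
  have "dg (C i) * dg (D i) = rsm q (dg (D i) * dg (C i))" for i
    by (simp only: dgf_mult dg_scale[symmetric] colpairD(1)[OF assms])
  moreover have "dg (D i) * dg (C k) = dg (C k) * dg (D i)" if "i < k" for i k
    by (simp only: dgf_mult colpairD(2)[OF assms that])
  moreover have "dg (C i) * dg (D k) = dg (D k) * dg (C i) + rsm (q - inverse q) (dg (D i) * dg (C k))"
    if "i < k" for i k
    by (simp only: dgf_mult dgf_add dg_scale[symmetric] colpairD(2,3)[OF assms that])
  ultimately show ?thesis unfolding M.colpair_def by iprover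
qed

text \<open>Only the pair of columns \<open>p\<close>, \<open>r\<close> needs a computation, for which \<open>k \<beta> = q \<beta> k\<close> is the right
  normalization. Towards a column outside the interval between \<open>p\<close> and \<open>r\<close> both behave alike, so a
  combination of them does as well; a column inside the interval would violate the relations and
  is therefore removed.\<close>

lemma qmat_shear:
  assumes x: "qmat q x" and "p \<noteq> r"
  shows "M.qmat q (shear p r x)"
proof -
  let ?y = "shear p r x"
  have sc: "selfcol (\<lambda>i. x i j)" for j using x by (simp add: qmat_columns)
  have cp: "colpair (\<lambda>i. x i j) (\<lambda>i. x i l)" if "j < l" for j l using x that by (simp add: qmat_columns)
  note dsc = sc[THEN dg_selfcol] and dcp = cp[THEN dg_colpair]
  have bt1: "bt * kp (-1) = rsm q (kp (-1) * bt)" and bt2: "kp 1 * bt = rsm q (bt * kp 1)"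
    using bt_kp[of "-1"] kp_bt[of 1] by simp_all
  have kk: "kp (-1) * kp 1 = kp 1 * kp (-1)" by (simp add: kp_mult)
  have core: "M.selfcol (\<lambda>i. ?y i r) \<and> M.selfcol (\<lambda>i. ?y i p) \<and>
      M.colpair (\<lambda>i. ?y i (min p r)) (\<lambda>i. ?y i (max p r))"
  proof (cases "p < r")
    case True
    then have y: "(\<lambda>i. ?y i r) = (\<lambda>i. dg (x i r) * kp (-1) + dg (x i p) * bt)"
      "(\<lambda>i. ?y i p) = (\<lambda>i. dg (x i p) * kp 1)" by (auto simp: shear_def fun_eq_iff)
    have mm: "min p r = p" "max p r = r" using True by auto
    show ?thesis unfolding mm y
      by (intro conjI M.shear_selfcol_right M.shear_colpair_right M.selfcol_mult dsc dcp True
          kp_dg bt_dg bt1 bt2 kk)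
  next
    case False
    then have rp: "r < p" using assms by simp
    then have y: "(\<lambda>i. ?y i r) = (\<lambda>i. dg (x i r) * kp 1 + dg (x i p) * bt)"
      "(\<lambda>i. ?y i p) = (\<lambda>i. dg (x i p) * kp (-1))" by (auto simp: shear_def fun_eq_iff)
    have mm: "min p r = r" "max p r = p" using rp by auto
    show ?thesis unfolding mm y
      by (intro conjI M.shear_selfcol_left M.shear_colpair_left M.selfcol_mult dsc dcp rp
          kp_dg bt_dg bt1 bt2 kk)
  qed
  have yo: "(\<lambda>i. ?y i j) = (\<lambda>i. 0) \<or> (\<lambda>i. ?y i j) = (\<lambda>i. dg (x i j)) \<and> (j < min p r \<or> max p r < j)"
    if "j \<noteq> p" "j \<noteq> r" for j
    using that unfolding shear_def by (auto simp: fun_eq_iff)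
  have yp: "\<exists>S S'. (\<lambda>i. ?y i j) = (\<lambda>i. dg (x i r) * S + dg (x i p) * S') \<and>
      (\<forall>u. S * dg u = dg u * S) \<and> (\<forall>u. S' * dg u = dg u * S')" if "j = p \<or> j = r" for j
  proof (cases "j = r")
    case True
    then show ?thesis unfolding shear_def
      by (intro exI[of _ "kp (if r < p then 1 else -1)"] exI[of _ bt]) (auto simp: kp_dg bt_dg)
  next
    case False
    then show ?thesis using that unfolding shear_def
      by (intro exI[of _ 0] exI[of _ "kp (if r < p then -1 else 1)"]) (auto simp: kp_dg)
  qed
  have left: "M.colpair (\<lambda>i. dg (x i j)) (\<lambda>i. ?y i l)" if "l = p \<or> l = r" "j < min p r" for j l
    using yp[OF that(1)] that(2) by (auto intro!: M.colpair_add M.colpair_mult dcp)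
  have right: "M.colpair (\<lambda>i. ?y i j) (\<lambda>i. dg (x i l))" if "j = p \<or> j = r" "max p r < l" for j l
    using yp[OF that(1)] that(2) by (auto intro!: M.colpair_add' M.colpair_mult' dcp)
  show ?thesis unfolding M.qmat_columns
  proof (intro conjI allI impI)
    fix j show "M.selfcol (\<lambda>i. ?y i j)"
      using core yo[of j] dsc M.selfcol_0 by (cases "j = p \<or> j = r") auto
  next
    fix j l :: nat assume jl: "j < l"
    show "M.colpair (\<lambda>i. ?y i j) (\<lambda>i. ?y i l)"
    proof (cases "j = p \<or> j = r")
      case True
      show ?thesis
      proof (cases "l = p \<or> l = r")
        case l: True
        then have "j = min p r" "l = max p r" using True jl by auto
        then show ?thesis using core by simp
      next
        case False
        then show ?thesis using yo[of l] right[OF True, of l] M.colpair_0 True jl by auto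
      qed
    next
      case False
      show ?thesis
      proof (cases "l = p \<or> l = r")
        case l: True
        then show ?thesis using yo[of j] left[OF l, of j] M.colpair_0 False jl by auto
      next
        case l: False
        then show ?thesis using yo[of j] yo[of l] False M.colpair_0 dcp[OF jl] by auto
      qed
    qed
  qed
qed

text \<open>If \<open>p\<close> and \<open>r\<close> both occur in \<open>J\<close>, the \<open>\<beta>\<close>-terms for \<open>j = p\<close> and \<open>j = r\<close> are proportional and
  cancel: the signs differ by one inversion, which gives the factor \<open>-q\<close> or its inverse, and
  commuting \<open>\<beta>\<close> past \<open>k\<close> gives the other power. This is the quantum version of a determinant with
  two equal columns.\<close>

lemma qdet_shear:
  assumes "p \<noteq> r" "finite J" and mid: "\<And>j. j \<in> J \<Longrightarrow> \<not> (min p r < j \<and> j < max p r)"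
  defines "e \<equiv> (if r < p then 1 else -1 :: int)"
  shows "p \<notin> J \<Longrightarrow> r \<notin> J \<Longrightarrow> M.qdet q (shear p r x) is J = dg (qdet q x is J)"
    and "p \<in> J \<Longrightarrow> r \<notin> J \<Longrightarrow> M.qdet q (shear p r x) is J = dg (qdet q x is J) * kp (- e)"
    and "p \<notin> J \<Longrightarrow> r \<in> J \<Longrightarrow> M.qdet q (shear p r x) is J =
           dg (qdet q x is J) * kp e + dg (qdet q x is (insert p (J - {r}))) * bt"
    and "p \<in> J \<Longrightarrow> r \<in> J \<Longrightarrow> M.qdet q (shear p r x) is J = dg (qdet q x is J)"
proof -
  let ?y = "shear p r x"
  have yr: "?y i r = dg (x i r) * kp e + dg (x i p) * bt" for i by (simp add: shear_def e_def)
  have yp: "?y i p = dg (x i p) * kp (- e)" for i using \<open>p \<noteq> r\<close> by (simp add: shear_def e_def)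
  have kk: "kp e * kp (- e) = 1" "kp (- e) * kp e = 1" by (simp_all add: kp_mult)
  have main: "(p \<notin> J \<and> r \<notin> J \<longrightarrow> M.qdet q ?y is J = dg (qdet q x is J)) \<and>
    (p \<in> J \<and> r \<notin> J \<longrightarrow> M.qdet q ?y is J = dg (qdet q x is J) * kp (- e)) \<and>
    (p \<notin> J \<and> r \<in> J \<longrightarrow> M.qdet q ?y is J =
           dg (qdet q x is J) * kp e + dg (qdet q x is (insert p (J - {r}))) * bt) \<and>
    (p \<in> J \<and> r \<in> J \<longrightarrow> M.qdet q ?y is J = dg (qdet q x is J))"
    using assms(2) mid
  proof (induction "is" arbitrary: J)
    case Nil
    then show ?case by auto
  next
    case (Cons i "is")
    let ?D = "qdet q x is" and ?Y = "M.qdet q ?y is"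
    have IH: "p \<notin> J - {j} \<Longrightarrow> r \<notin> J - {j} \<Longrightarrow> ?Y (J - {j}) = dg (?D (J - {j}))"
      "p \<in> J - {j} \<Longrightarrow> r \<notin> J - {j} \<Longrightarrow> ?Y (J - {j}) = dg (?D (J - {j})) * kp (- e)"
      "p \<notin> J - {j} \<Longrightarrow> r \<in> J - {j} \<Longrightarrow> ?Y (J - {j}) =
           dg (?D (J - {j})) * kp e + dg (?D (insert p (J - {j} - {r}))) * bt"
      "p \<in> J - {j} \<Longrightarrow> r \<in> J - {j} \<Longrightarrow> ?Y (J - {j}) = dg (?D (J - {j}))" for j
      using Cons.IH[of "J - {j}"] Cons.prems by simp_all
    have yo: "?y i j = dg (x i j)" if "j \<in> J" "j \<noteq> p" "j \<noteq> r" for j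
      using that Cons.prems(2)[OF that(1)] by (auto simp: shear_def)
    define s where "s j = (- q) ^ card {l\<in>J. l < j}" for j
    have ydef: "M.qdet q ?y (i # is) J = (\<Sum>j\<in>J. rsm (s j) (?y i j * ?Y (J - {j})))"
      and xdef: "qdet q x (i # is) J = (\<Sum>j\<in>J. s j \<cdot> (x i j * ?D (J - {j})))"
      by (simp_all add: s_def)
    have dgx: "dg (qdet q x (i # is) J) = (\<Sum>j\<in>J. rsm (s j) (dg (x i j) * dg (?D (J - {j}))))"
      unfolding xdef by (simp add: dg_sum dg_scale dgf_mult del: qdet.simps)
    show ?case
    proof (intro conjI impI; elim conjE)
      assume "p \<notin> J" "r \<notin> J"
      then show "M.qdet q ?y (i # is) J = dg (qdet q x (i # is) J)"
        unfolding ydef dgx by (intro sum.cong refl) (metis Diff_iff IH(1) yo)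
    next
      assume pr: "p \<in> J" "r \<notin> J"
      have "?y i j * ?Y (J - {j}) = dg (x i j) * dg (?D (J - {j})) * kp (- e)" if j: "j \<in> J" for j
      proof (cases "j = p")
        case True
        then show ?thesis using IH(1)[of j] pr by (simp add: yp mult.assoc kp_dg)
      next
        case False
        then show ?thesis using IH(2)[of j] pr j by (metis Diff_iff mult.assoc singletonD yo)
      qed
      then show "M.qdet q ?y (i # is) J = dg (qdet q x (i # is) J) * kp (- e)"
        unfolding ydef dgx sum_distrib_right by (intro sum.cong refl) (simp add: mult.assoc)
    next
      assume pr: "p \<notin> J" "r \<in> J"
      define J' where "J' = insert p (J - {r})"
      define \<pi> where "\<pi> j = (if j = r then p else j)" for j
      have bij: "bij_betw \<pi> J J'"
        by (rule bij_betw_byWitness[where f' = "\<lambda>j. if j = p then r else j"]) (use pr in \<open>auto simp: \<pi>_def J'_def\<close>)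
      have mono: "\<pi> l < \<pi> j \<longleftrightarrow> l < j" if "l \<in> J" "j \<in> J" for l j
      proof -
        have "l \<noteq> p" "j \<noteq> p" using that pr by auto
        then show ?thesis
          using Cons.prems(2)[OF that(1)] Cons.prems(2)[OF that(2)] \<open>p \<noteq> r\<close> unfolding \<pi>_def min_def max_def
          by (simp split: if_splits) linarith+
      qed
      have card: "card {l\<in>J'. l < \<pi> j} = card {l\<in>J. l < j}" if "j \<in> J" for j
      proof -
        have "{l\<in>J'. l < \<pi> j} = \<pi> ` {l\<in>J. l < j}"
          using bij mono that by (auto simp: bij_betw_def)
        moreover have "inj_on \<pi> {l\<in>J. l < j}" using bij by (auto simp: bij_betw_def inj_on_def)
        ultimately show ?thesis by (simp add: card_image)
      qed
      have "?y i j * ?Y (J - {j}) = dg (x i j) * dg (?D (J - {j})) * kp e +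
          dg (x i (\<pi> j)) * dg (?D (J' - {\<pi> j})) * bt" if j: "j \<in> J" for j
      proof (cases "j = r")
        case True
        have "J' - {p} = J - {r}" using pr by (auto simp: J'_def)
        then show ?thesis using True IH(1)[of j] pr
          by (simp add: yr mult.assoc kp_dg bt_dg distrib_right \<pi>_def)
      next
        case False
        then have "j \<noteq> p" using pr j by auto
        have "J' - {j} = insert p (J - {j} - {r})" using False \<open>j \<noteq> p\<close> by (auto simp: J'_def)
        then show ?thesis using IH(3)[of j] pr j False yo[OF j \<open>j \<noteq> p\<close> False]
          by (simp add: distrib_left mult.assoc \<pi>_def)
      qed
      then have "M.qdet q ?y (i # is) J = dg (qdet q x (i # is) J) * kp e +
          (\<Sum>j\<in>J. rsm (s j) (dg (x i (\<pi> j)) * dg (?D (J' - {\<pi> j})))) * bt"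
        unfolding ydef dgx sum_distrib_right
        by (simp add: sum.distrib[symmetric] M.scale_right_distrib mult.assoc)
      also have "(\<Sum>j\<in>J. rsm (s j) (dg (x i (\<pi> j)) * dg (?D (J' - {\<pi> j})))) =
          (\<Sum>j\<in>J. rsm ((- q) ^ card {l\<in>J'. l < \<pi> j}) (dg (x i (\<pi> j)) * dg (?D (J' - {\<pi> j}))))"
        by (intro sum.cong refl) (simp add: card s_def)
      also have "\<dots> = (\<Sum>j\<in>J'. rsm ((- q) ^ card {l\<in>J'. l < j}) (dg (x i j) * dg (?D (J' - {j}))))"
        by (rule sum.reindex_bij_betw[OF bij])
      also have "\<dots> = dg (qdet q x (i # is) J')"
        by (simp add: dg_sum dg_scale dgf_mult)
      finally show "M.qdet q ?y (i # is) J = dg (qdet q x (i # is) J) * kp e +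
         dg (qdet q x (i # is) (insert p (J - {r}))) * bt" by (simp add: J'_def)
    next
      assume pr: "p \<in> J" "r \<in> J"
      \<comment> \<open>the common operator of the two beta-terms, with coefficient 1 for j = p and q^e for j = r\<close>
      define Z where "Z = dg (x i p) * dg (?D (J - {r})) * kp (- e) * bt"
      define w where "w j = (if j = p then 1 else if j = r then q powi e else 0)" for j
      have ins: "insert p (J - {p} - {r}) = J - {r}" using pr \<open>p \<noteq> r\<close> by auto
      have "?y i j * ?Y (J - {j}) = dg (x i j) * dg (?D (J - {j})) + rsm (w j) Z" if j: "j \<in> J" for j
      proof -
        consider "j = p" | "j = r" "j \<noteq> p" | "j \<noteq> r" "j \<noteq> p" by blast
        then show ?thesis
        proof cases
          case 1
          have "?y i j * ?Y (J - {j}) = dg (x i p) * kp (- e) * (dg (?D (J - {p})) * kp e + dg (?D (J - {r})) * bt)"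
            using 1 IH(3)[of p] pr \<open>p \<noteq> r\<close> by (simp add: yp ins)
          also have "\<dots> = dg (x i p) * (kp (- e) * dg (?D (J - {p}))) * kp e + dg (x i p) * (kp (- e) * dg (?D (J - {r}))) * bt"
            by (simp add: distrib_left mult.assoc)
          also have "\<dots> = dg (x i p) * dg (?D (J - {p})) + Z"
            by (simp add: kp_dg Z_def mult.assoc kk)
          finally show ?thesis using 1 by (simp add: w_def)
        next
          case 2
          have "?y i j * ?Y (J - {j}) = (dg (x i r) * kp e + dg (x i p) * bt) * (dg (?D (J - {r})) * kp (- e))"
            using 2 IH(2)[of r] pr by (simp add: yr)
          also have "\<dots> = dg (x i r) * (kp e * dg (?D (J - {r}))) * kp (- e) + dg (x i p) * (bt * dg (?D (J - {r}))) * kp (- e)"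
            by (simp add: distrib_right mult.assoc)
          also have "\<dots> = dg (x i r) * dg (?D (J - {r})) * (kp e * kp (- e)) + dg (x i p) * dg (?D (J - {r})) * (bt * kp (- e))"
            by (simp add: kp_dg bt_dg mult.assoc)
          also have "\<dots> = dg (x i r) * dg (?D (J - {r})) + rsm (q powi e) Z"
            by (simp add: kk bt_kp Z_def mult.assoc)
          finally show ?thesis using 2 by (simp add: w_def)
        next
          case 3
          then show ?thesis using IH(4)[of j] pr yo[OF j] by (simp add: w_def)
        qed
      qed
      then have "M.qdet q ?y (i # is) J = dg (qdet q x (i # is) J) + rsm (\<Sum>j\<in>J. s j * w j) Z"
        unfolding ydef dgx
        by (simp add: sum.distrib M.scale_right_distrib M.scale_sum_left)
      also have "(\<Sum>j\<in>J. s j * w j) = s p + s r * q powi e"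
      proof -
        have "J = insert p (insert r (J - {p, r}))" using pr by auto
        then have "(\<Sum>j\<in>J. s j * w j) = (\<Sum>j\<in>insert p (insert r (J - {p, r})). s j * w j)" by simp
        also have "\<dots> = s p * w p + (s r * w r + (\<Sum>j\<in>J - {p, r}. s j * w j))"
          using \<open>p \<noteq> r\<close> Cons.prems(1) by (simp add: sum.insert)
        also have "(\<Sum>j\<in>J - {p, r}. s j * w j) = 0" by (rule sum.neutral) (auto simp: w_def)
        finally show ?thesis using \<open>p \<noteq> r\<close> by (simp add: w_def)
      qed
      also have "s p + s r * q powi e = 0"
      proof (cases "r < p")
        case True
        have "{l\<in>J. l < p} = insert r {l\<in>J. l < r}"
        proof -
          have "l = r \<or> l < r" if "l \<in> J" "l < p" for l
            using Cons.prems(2)[OF that(1)] that(2) True by auto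
          then show ?thesis using pr True by auto
        qed
        then have "card {l\<in>J. l < p} = Suc (card {l\<in>J. l < r})" using Cons.prems(1) by simp
        then show ?thesis using True by (simp add: s_def e_def)
      next
        case False
        then have pr': "p < r" using \<open>p \<noteq> r\<close> by simp
        have "{l\<in>J. l < r} = insert p {l\<in>J. l < p}"
        proof -
          have "l = p \<or> l < p" if "l \<in> J" "l < r" for l
            using Cons.prems(2)[OF that(1)] that(2) pr' by auto
          then show ?thesis using pr pr' by auto
        qed
        then have "card {l\<in>J. l < r} = Suc (card {l\<in>J. l < p})" using Cons.prems(1) by simp
        then show ?thesis using False q_nonzero by (simp add: s_def e_def)
      qed
      finally show "M.qdet q ?y (i # is) J = dg (qdet q x (i # is) J)" by simp
    qed
  qed
  show "p \<notin> J \<Longrightarrow> r \<notin> J \<Longrightarrow> M.qdet q ?y is J = dg (qdet q x is J)"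
   and "p \<in> J \<Longrightarrow> r \<notin> J \<Longrightarrow> M.qdet q ?y is J = dg (qdet q x is J) * kp (- e)"
   and "p \<notin> J \<Longrightarrow> r \<in> J \<Longrightarrow> M.qdet q ?y is J =
           dg (qdet q x is J) * kp e + dg (qdet q x is (insert p (J - {r}))) * bt"
   and "p \<in> J \<Longrightarrow> r \<in> J \<Longrightarrow> M.qdet q ?y is J = dg (qdet q x is J)"
    using main by blast+
qed

end

section \<open>Induction along a finite set of naturals\<close>

text \<open>Induction from the least element of a finite set, stepping to the next larger element. The
  step receives consecutive elements \<open>p < r\<close>, which is the situation where the shear of columns
  \<open>p\<close>, \<open>r\<close> removes no relevant column.\<close>

lemma up_induct [consumes 2, case_names base step]:
  fixes B :: "nat set"
  assumes "finite B" "b \<in> B"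
    and base: "P (Min B)"
    and step: "\<And>p r. p \<in> B \<Longrightarrow> r \<in> B \<Longrightarrow> p < r \<Longrightarrow> (\<And>l. l \<in> B \<Longrightarrow> \<not> (p < l \<and> l < r)) \<Longrightarrow> P p \<Longrightarrow> P r"
  shows "P b"
  using assms(2)
proof (induction b rule: less_induct)
  case (less b)
  show ?case
  proof (cases "b = Min B")
    case False
    define L where "L = {l\<in>B. l < b}"
    have "Min B \<in> B" "Min B \<le> b" using less.prems assms(1) by (auto intro: Min_in)
    then have "Min B \<in> L" using False by (auto simp: L_def order.not_eq_order_implies_strict)
    then have ne: "L \<noteq> {}" and fin: "finite L" using assms(1) by (auto simp: L_def)
    have M: "Max L \<in> L" using Max_in[OF fin ne] .
    show ?thesis
    proof (rule step[of "Max L" b])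
      fix l assume "l \<in> B"
      then have "l < b \<Longrightarrow> l \<le> Max L" by (intro Max_ge fin) (simp add: L_def)
      then show "\<not> (Max L < l \<and> l < b)" by linarith
    next
      have LB: "Max L \<in> B" "Max L < b" using M by (simp_all add: L_def)
      then show "Max L \<in> B" "Max L < b" "P (Max L)" using less.IH by auto
    qed (use less in auto)
  qed (use base in simp)
qed

lemma down_induct [consumes 2, case_names base step]:
  fixes B :: "nat set"
  assumes "finite B" "b \<in> B"
    and base: "P (Max B)"
    and step: "\<And>p r. p \<in> B \<Longrightarrow> r \<in> B \<Longrightarrow> p < r \<Longrightarrow> (\<And>l. l \<in> B \<Longrightarrow> \<not> (p < l \<and> l < r)) \<Longrightarrow> P r \<Longrightarrow> P p"
  shows "P b"
  using assms(2)
proof (induction "Max B - b" arbitrary: b rule: less_induct)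
  case (less b)
  show ?case
  proof (cases "b = Max B")
    case False
    define L where "L = {l\<in>B. b < l}"
    have "Max B \<in> B" "b \<le> Max B" using less.prems assms(1) by (auto intro: Max_in)
    then have "Max B \<in> L" using False by (auto simp: L_def order.not_eq_order_implies_strict)
    then have ne: "L \<noteq> {}" and fin: "finite L" using assms(1) by (auto simp: L_def)
    have M: "Min L \<in> L" using Min_in[OF fin ne] .
    show ?thesis
    proof (rule step[of b "Min L"])
      fix l assume "l \<in> B"
      then have "b < l \<Longrightarrow> Min L \<le> l" by (intro Min_le fin) (simp add: L_def)
      then show "\<not> (b < l \<and> l < Min L)" by linarith
    next
      have LB: "Min L \<in> B" "b < Min L" using M by (simp_all add: L_def)
      then have "Min L \<le> Max B" using assms(1) by simp
      then have "Max B - Min L < Max B - b" using LB by linarith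
      then show "P (Min L)" using less.hyps LB by blast
      show "Min L \<in> B" "b < Min L" by fact+
    qed (use less in auto)
  qed (use base in simp)
qed

section \<open>Universal quantum matrices\<close>

context kalgebra
begin

text \<open>A homomorphism on a subalgebra \<open>G\<close> is a function on the whole type, because subalgebras are
  not types.\<close>

definition alg_hom :: "('k \<Rightarrow> 'b \<Rightarrow> 'b) \<Rightarrow> 'a set \<Rightarrow> ('a \<Rightarrow> 'b::ring_1) \<Rightarrow> bool" where
  "alg_hom sm' G \<phi> \<longleftrightarrow> \<phi> 1 = 1 \<and>
     (\<forall>a\<in>G. \<forall>b\<in>G. \<phi> (a + b) = \<phi> a + \<phi> b \<and> \<phi> (a * b) = \<phi> a * \<phi> b) \<and>
     (\<forall>c. \<forall>a\<in>G. \<phi> (c \<cdot> a) = sm' c (\<phi> a))"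

lemma alg_homD:
  assumes "alg_hom sm' G \<phi>"
  shows "\<phi> 1 = 1" "a \<in> G \<Longrightarrow> b \<in> G \<Longrightarrow> \<phi> (a + b) = \<phi> a + \<phi> b"
    "a \<in> G \<Longrightarrow> b \<in> G \<Longrightarrow> \<phi> (a * b) = \<phi> a * \<phi> b" "a \<in> G \<Longrightarrow> \<phi> (c \<cdot> a) = sm' c (\<phi> a)"
  using assms unfolding alg_hom_def by auto

lemma hom_zero:
  assumes "alg_hom sm' (gsub X) \<phi>" "kalgebra sm'"
  shows "\<phi> 0 = 0"
proof -
  interpret H: kalgebra sm' by fact
  show ?thesis using alg_homD(4)[OF assms(1) gsub.one, of 0] by simp
qed

lemma hom_minus:
  assumes "alg_hom sm' (gsub X) \<phi>" "kalgebra sm'" "a \<in> gsub X"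
  shows "\<phi> (- a) = - \<phi> a"
proof -
  interpret H: kalgebra sm' by fact
  show ?thesis using alg_homD(4)[OF assms(1,3), of "-1"] by simp
qed

lemma hom_diff:
  assumes "alg_hom sm' (gsub X) \<phi>" "kalgebra sm'" "a \<in> gsub X" "b \<in> gsub X"
  shows "\<phi> (a - b) = \<phi> a - \<phi> b"
  using alg_homD(2)[OF assms(1), of a "- b"] hom_minus[OF assms(1,2,4)] assms(3,4) gsub_minus by simp

lemma hom_sum:
  assumes "alg_hom sm' (gsub X) \<phi>" "kalgebra sm'" "\<And>i. i \<in> I \<Longrightarrow> f i \<in> gsub X"
  shows "\<phi> (sum f I) = (\<Sum>i\<in>I. \<phi> (f i))"
  using assms(3)
  by (induction I rule: infinite_finite_induct)
     (auto simp: hom_zero[OF assms(1,2)] alg_homD(2)[OF assms(1)] gsub_sum)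

lemma hom_power:
  assumes "alg_hom sm' (gsub X) \<phi>" "a \<in> gsub X"
  shows "\<phi> (a ^ k) = \<phi> a ^ k"
  by (induction k) (auto simp: alg_homD[OF assms(1)] assms(2) gsub_power)

lemma hom_qdet:
  assumes "alg_hom sm' (gsub X) \<phi>" "kalgebra sm'" "\<And>i j. x i j \<in> gsub X"
  shows "\<phi> (qdet q x is J) = kalgebra.qdet sm' q (\<lambda>i j. \<phi> (x i j)) is J"
proof -
  interpret H: kalgebra sm' by fact
  show ?thesis
  proof (induction "is" arbitrary: J)
    case Nil
    then show ?case by (simp add: alg_homD[OF assms(1)] hom_zero[OF assms(1,2)])
  next
    case (Cons i "is")
    have G: "qdet q x is J \<in> gsub X" for J by (rule qdet_in_gsub) (rule assms)
    then show ?case using Cons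
      by (simp add: hom_sum[OF assms(1,2)] alg_homD[OF assms(1)] assms(3) gsub.intros)
  qed
qed

lemma minor_single: "minor q x {a} {d} = x a d"
proof -
  have *: "{l. l = d \<and> l < d} = {}" by auto
  show ?thesis by (simp add: minor_def *)
qed

definition entries :: "(nat \<Rightarrow> nat \<Rightarrow> 'a) \<Rightarrow> 'a set" where
  "entries x = {x i j | i j. True}"

end

text \<open>The algebra of quantum matrices, seen from inside a larger ring. Its universal property is
  assumed for two targets only, the operators over the same ring (for shears) and the ground field
  (for characters), because a locale cannot quantify over the type of the target.\<close>

locale universal_qmat = qalgebra sm q
  for sm :: "'k::field \<Rightarrow> 'a::ring_1 \<Rightarrow> 'a" (infixr \<open>\<cdot>\<close> 75) and q :: 'k +
  fixes m n :: nat and x :: "nat \<Rightarrow> nat \<Rightarrow> 'a"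
  assumes qmat_x: "qmat q x"
    and x_outside: "i \<notin> {1..m} \<or> j \<notin> {1..n} \<Longrightarrow> x i j = 0"
    and hom_rop: "kalgebra.qmat (rsm :: 'k \<Rightarrow> (int, 'a) rop \<Rightarrow> (int, 'a) rop) q y \<Longrightarrow>
       (\<And>i j. i \<notin> {1..m} \<or> j \<notin> {1..n} \<Longrightarrow> y i j = 0) \<Longrightarrow>
       \<exists>\<phi>. alg_hom rsm (gsub (entries x)) \<phi> \<and> (\<forall>i j. \<phi> (x i j) = y i j)"
    and hom_field: "kalgebra.qmat ((*) :: 'k \<Rightarrow> 'k \<Rightarrow> 'k) q z \<Longrightarrow>
       (\<And>i j. i \<notin> {1..m} \<or> j \<notin> {1..n} \<Longrightarrow> z i j = 0) \<Longrightarrow>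
       \<exists>\<phi>. alg_hom (*) (gsub (entries x)) \<phi> \<and> (\<forall>i j. \<phi> (x i j) = z i j)"
begin

interpretation M: qalgebra "rsm :: 'k \<Rightarrow> (int, 'a) rop \<Rightarrow> (int, 'a) rop" q
  by (intro qalgebra.intro kalgebra_rsm qalgebra_axioms.intro q_nonzero)

abbreviation G where "G \<equiv> gsub (entries x)"

lemma x_in_G: "x i j \<in> G" by (auto intro: gsub.gen simp: entries_def)

lemma minor_in_G: "finite A \<Longrightarrow> minor q x A B \<in> G"
  by (rule minor_in_gsub) (auto intro: x_in_G)

lemma transpose: "universal_qmat sm q n m (\<lambda>i j. x j i)"
proof unfold_locales
  have eq: "entries (\<lambda>i j. x j i) = entries x" by (auto simp: entries_def)
  show "qmat q (\<lambda>i j. x j i)" by (rule qmat_transpose[OF qmat_x])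
  show "x j i = 0" if "i \<notin> {1..n} \<or> j \<notin> {1..m}" for i j using that by (intro x_outside) auto
  show "\<exists>\<phi>. alg_hom rsm (gsub (entries (\<lambda>i j. x j i))) \<phi> \<and> (\<forall>i j. \<phi> (x j i) = y i j)"
    if "M.qmat q y" "\<And>i j. i \<notin> {1..n} \<or> j \<notin> {1..m} \<Longrightarrow> y i j = 0" for y
    unfolding eq using hom_rop[OF M.qmat_transpose[OF that(1)]] that(2) by blast
  interpret F: kalgebra "(*) :: 'k \<Rightarrow> 'k \<Rightarrow> 'k" by standard (auto simp: algebra_simps)
  show "\<exists>\<phi>. alg_hom (*) (gsub (entries (\<lambda>i j. x j i))) \<phi> \<and> (\<forall>i j. \<phi> (x j i) = z i j)"
    if "F.qmat q z" "\<And>i j. i \<notin> {1..n} \<or> j \<notin> {1..m} \<Longrightarrow> z i j = 0" for z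
    unfolding eq using hom_field[OF F.qmat_transpose[OF that(1)]] that(2) by blast
qed

lemma shear_hom:
  assumes "p \<noteq> r" "r \<in> {1..n}"
  obtains \<phi> where "alg_hom rsm G \<phi>" "\<And>i j. \<phi> (x i j) = shear p r x i j"
proof -
  have "shear p r x i j = 0" if "i \<notin> {1..m} \<or> j \<notin> {1..n}" for i j
    using that assms x_outside[of i] x_outside[of _ j] by (auto simp: shear_def)
  then show ?thesis using hom_rop[OF qmat_shear[OF qmat_x assms(1)]] that by blast
qed

lemma shear_hom_minor:
  assumes "p \<noteq> r" "finite J" "alg_hom rsm G \<phi>" "\<And>i j. \<phi> (x i j) = shear p r x i j"
    "\<And>j. j \<in> J \<Longrightarrow> \<not> (min p r < j \<and> j < max p r)"
  defines "e \<equiv> (if r < p then 1 else -1 :: int)"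
  shows "p \<notin> J \<Longrightarrow> r \<notin> J \<Longrightarrow> \<phi> (minor q x A J) = dg (minor q x A J)"
    and "p \<in> J \<Longrightarrow> r \<notin> J \<Longrightarrow> \<phi> (minor q x A J) = dg (minor q x A J) * kp (- e)"
    and "p \<notin> J \<Longrightarrow> r \<in> J \<Longrightarrow> \<phi> (minor q x A J) =
           dg (minor q x A J) * kp e + dg (minor q x A (insert p (J - {r}))) * bt"
    and "p \<in> J \<Longrightarrow> r \<in> J \<Longrightarrow> \<phi> (minor q x A J) = dg (minor q x A J)"
proof -
  have "\<phi> (minor q x A J) = M.minor q (shear p r x) A J"
    unfolding minor_def M.minor_def
    by (subst hom_qdet[OF assms(3) kalgebra_rsm]) (auto simp: x_in_G assms(4))
  then show "p \<notin> J \<Longrightarrow> r \<notin> J \<Longrightarrow> \<phi> (minor q x A J) = dg (minor q x A J)"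
    and "p \<in> J \<Longrightarrow> r \<notin> J \<Longrightarrow> \<phi> (minor q x A J) = dg (minor q x A J) * kp (- e)"
    and "p \<notin> J \<Longrightarrow> r \<in> J \<Longrightarrow> \<phi> (minor q x A J) =
           dg (minor q x A J) * kp e + dg (minor q x A (insert p (J - {r}))) * bt"
    and "p \<in> J \<Longrightarrow> r \<in> J \<Longrightarrow> \<phi> (minor q x A J) = dg (minor q x A J)"
    using qdet_shear[OF assms(1,2,5)] unfolding minor_def M.minor_def e_def by simp_all
qed

text \<open>The coefficient of \<open>\<beta>\<close> is seen by applying both operators to the sequence concentrated on
  level \<open>0\<close> and looking at level \<open>1\<close>.\<close>

lemma shear_parts:
  assumes "dg a * kp e + dg b * bt = dg a' * kp e' + dg b' * bt"
  shows "b = b'"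
proof -
  have "rapp (dg a * kp e + dg b * bt) (single 0 1) 1 = rapp (dg a' * kp e' + dg b' * bt) (single 0 1) 1"
    using assms by simp
  then show ?thesis by (simp add: single_def)
qed

text \<open>The shear fixes the second minor and maps the first one to \<open>u k\<^sup>e + u' \<beta>\<close>, so the coefficient
  of \<open>\<beta>\<close> in a relation for \<open>u\<close> is the same relation for \<open>u'\<close>.\<close>

lemma move_column:
  assumes fin: "finite A" "finite A'" "finite J" "finite J'"
    and pr: "p \<notin> J" "r \<in> J" "p \<in> J'" "r \<in> J'" "r \<in> {1..n}"
    and mid: "\<And>j. j \<in> J \<union> J' \<Longrightarrow> \<not> (min p r < j \<and> j < max p r)"
    and comm: "minor q x A J * minor q x A' J' = c \<cdot> (minor q x A' J' * minor q x A J)"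
    and J1: "J1 = insert p (J - {r})"
  shows "minor q x A J1 * minor q x A' J' = c \<cdot> (minor q x A' J' * minor q x A J1)"
proof -
  have "p \<noteq> r" using pr by auto
  obtain \<phi> where \<phi>: "alg_hom rsm G \<phi>" "\<And>i j. \<phi> (x i j) = shear p r x i j"
    using shear_hom[OF \<open>p \<noteq> r\<close> pr(5)] by blast
  note min = shear_hom_minor[OF \<open>p \<noteq> r\<close> _ \<phi>]
  define e where "e = (if r < p then 1 else -1 :: int)"
  let ?u = "minor q x A J" and ?v = "minor q x A' J'" and ?w = "minor q x A J1"
  have u: "\<phi> ?u = dg ?u * kp e + dg ?w * bt"
    using min(3)[OF fin(3), of A] mid pr by (simp add: e_def J1)
  have v: "\<phi> ?v = dg ?v" using min(4)[OF fin(4), of A'] mid pr by simp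
  have "\<phi> (?u * ?v) = \<phi> (c \<cdot> (?v * ?u))" using comm by simp
  then have "\<phi> ?u * \<phi> ?v = rsm c (\<phi> ?v * \<phi> ?u)"
    by (simp add: alg_homD[OF \<phi>(1)] minor_in_G fin gsub.mult)
  then have "dg (?u * ?v) * kp e + dg (?w * ?v) * bt = dg (c \<cdot> (?v * ?u)) * kp e + dg (c \<cdot> (?v * ?w)) * bt"
    by (simp add: u v distrib_left distrib_right mult.assoc kp_dg bt_dg dg_scale
        M.scale_right_distrib dgf_mult[symmetric])
  then show ?thesis by (rule shear_parts)
qed

lemma move_row:
  assumes fin: "finite A" "finite A'" "finite J" "finite J'" and card: "card A = card J" "card A' = card J'"
    and pr: "p \<notin> A" "r \<in> A" "p \<in> A'" "r \<in> A'" "r \<in> {1..m}"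
    and mid: "\<And>j. j \<in> A \<union> A' \<Longrightarrow> \<not> (min p r < j \<and> j < max p r)"
    and comm: "minor q x A J * minor q x A' J' = c \<cdot> (minor q x A' J' * minor q x A J)"
    and A1: "A1 = insert p (A - {r})"
  shows "minor q x A1 J * minor q x A' J' = c \<cdot> (minor q x A' J' * minor q x A1 J)"
proof -
  interpret T: universal_qmat sm q n m "\<lambda>i j. x j i" by (rule transpose)
  have "A1 = insert p (A - {r})" "finite A1" "card A1 = card J"
    using A1 fin pr card card_Suc_Diff1[of A r] by auto
  then show ?thesis
    using T.move_column[OF fin(3,4,1,2) pr mid _ A1, of c] comm
      minor_transpose[OF fin(1,3) card(1) qmat_x] minor_transpose[OF fin(2,4) card(2) qmat_x]
      minor_transpose[of A1 J, OF _ fin(3) _ qmat_x] by simp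
qed

text \<open>Here both minors contain \<open>r\<close> and not \<open>p\<close>, so the coefficient of \<open>\<beta>\<close> has two contributions on
  each side, one for each minor in which the index is moved. The factor \<open>q\<inverse>\<close> arises where \<open>k\<inverse>\<close>
  meets \<open>\<beta>\<close>.\<close>

lemma crossing:
  assumes fin: "finite A" "finite A'" "finite J" "finite J'"
    and pr: "p \<notin> J" "r \<in> J" "p \<notin> J'" "r \<in> J'" "r \<in> {1..n}" "p < r"
    and mid: "\<And>j. j \<in> J \<union> J' \<Longrightarrow> \<not> (p < j \<and> j < r)"
    and comm: "minor q x A J * minor q x A' J' = c \<cdot> (minor q x A' J' * minor q x A J)"
    and J1: "J1 = insert p (J - {r})" "J1' = insert p (J' - {r})"
  shows "inverse q \<cdot> (minor q x A J * minor q x A' J1') + minor q x A J1 * minor q x A' J'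
     = c \<cdot> (inverse q \<cdot> (minor q x A' J' * minor q x A J1) + minor q x A' J1' * minor q x A J)"
proof -
  have "p \<noteq> r" using pr by auto
  obtain \<phi> where \<phi>: "alg_hom rsm G \<phi>" "\<And>i j. \<phi> (x i j) = shear p r x i j"
    using shear_hom[OF \<open>p \<noteq> r\<close> pr(5)] by blast
  note min = shear_hom_minor[OF \<open>p \<noteq> r\<close> _ \<phi>]
  let ?u = "minor q x A J" and ?v = "minor q x A' J'" and ?w = "minor q x A J1" and ?z = "minor q x A' J1'"
  have u: "\<phi> ?u = dg ?u * kp (-1) + dg ?w * bt"
    using min(3)[OF fin(3), of A] mid pr by (simp add: J1)
  have v: "\<phi> ?v = dg ?v * kp (-1) + dg ?z * bt"
    using min(3)[OF fin(4), of A'] mid pr by (simp add: J1)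
  have "\<phi> (?u * ?v) = \<phi> (c \<cdot> (?v * ?u))" using comm by simp
  then have "\<phi> ?u * \<phi> ?v = rsm c (\<phi> ?v * \<phi> ?u)"
    by (simp add: alg_homD[OF \<phi>(1)] minor_in_G fin gsub.mult)
  then have "rapp (\<phi> ?u * \<phi> ?v) (single 0 1) 1 = rapp (rsm c (\<phi> ?v * \<phi> ?u)) (single 0 1) 1" by simp
  then show ?thesis by (simp add: u v single_def distrib_left scale_right_distrib add.commute)
qed

section \<open>Commutation relations\<close>

text \<open>A quantum minor is central in the algebra generated by its own entries. The extremal case is
  the entry in the last row and first column, which commutes with all entries up to scalars that
  multiply to \<open>1\<close>. The column index is then moved up and the row index down.\<close>

lemma central_entry:
  assumes "finite A" "finite B" "card A = card B" "A \<subseteq> {1..m}" "B \<subseteq> {1..n}" "a \<in> A" "b \<in> B"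
  shows "minor q x A B * x a b = x a b * minor q x A B"
proof -
  define R where "R a b \<longleftrightarrow> minor q x {a} {b} * minor q x A B = 1 \<cdot> (minor q x A B * minor q x {a} {b})" for a b
  have "R (Max A) b"
    using assms(2,7)
  proof (induction rule: up_induct)
    case base
    define u where "u i = (if i = Max A then q else 1)" for i
    define v where "v j = (if j = Min B then inverse q else 1)" for j
    have ne: "A \<noteq> {}" "B \<noteq> {}" using assms by auto
    have "x (Max A) (Min B) * x i j = (u i * v j) \<cdot> (x i j * x (Max A) (Min B))" if "i \<in> A" "j \<in> B" for i j
    proof -
      have "i < Max A" if "i \<noteq> Max A" using \<open>i \<in> A\<close> that assms(1) by (simp add: order.not_eq_order_implies_strict)
      moreover have "Min B < j" if "j \<noteq> Min B" using \<open>j \<in> B\<close> that assms(2) by (simp add: order.not_eq_order_implies_strict)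
      moreover have "x i (Min B) * x (Max A) (Min B) = q \<cdot> (x (Max A) (Min B) * x i (Min B))" if "i < Max A"
        using qmat_col[OF qmat_x that] .
      moreover have "x (Max A) (Min B) * x (Max A) j = q \<cdot> (x (Max A) j * x (Max A) (Min B))" if "Min B < j"
        using qmat_row[OF qmat_x that] .
      moreover have "x i j * x (Max A) (Min B) = x (Max A) (Min B) * x i j" if "i < Max A" "Min B < j"
        using qmat_anti[OF qmat_x that] .
      ultimately show ?thesis using q_nonzero
        by (cases "i = Max A"; cases "j = Min B") (auto simp: u_def v_def)
    qed
    from minor_weights[OF this assms(1-3)]
    have "x (Max A) (Min B) * minor q x A B = (prod u A * prod v B) \<cdot> (minor q x A B * x (Max A) (Min B))" .
    moreover have "prod u A = q" "prod v B = inverse q"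
      using assms(1,2) ne by (simp_all add: u_def v_def prod.delta)
    ultimately show ?case using q_nonzero by (simp add: R_def minor_single)
  next
    case (step p r)
    show ?case unfolding R_def
      by (rule move_column[where J = "{p}" and r = p and p = r, OF _ _ _ _ _ _ _ _ _ _ step(5)[unfolded R_def]])
         (use step(1-4) assms in \<open>auto simp: min_def max_def\<close>)
  qed
  have "R a b"
    using assms(1,6)
  proof (induction rule: down_induct)
    case base
    show ?case by fact
  next
    case (step p r)
    show ?case unfolding R_def
      by (rule move_row[where A = "{r}" and r = r and p = p, OF _ _ _ _ _ _ _ _ _ _ _ _ step(5)[unfolded R_def]])
         (use step(1-4) assms in \<open>auto simp: min_def max_def\<close>)
  qed
  then show ?thesis by (simp add: R_def minor_single)
qed

text \<open>A minor and an entry in one of its rows, in a column to the left of all of its columns. The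
  entry in the last row commutes with the remaining rows, so only one weight \<open>q\<close> is collected.\<close>

lemma entry_left:
  assumes "finite A" "finite B" "card A = card B" "A \<subseteq> {1..m}" "a \<in> A" "\<And>j. j \<in> B \<Longrightarrow> d < j"
  shows "minor q x A B * x a d = inverse q \<cdot> (x a d * minor q x A B)"
proof -
  define R where "R a \<longleftrightarrow> minor q x {a} {d} * minor q x A B = q \<cdot> (minor q x A B * minor q x {a} {d})" for a
  have "R a"
    using assms(1,5)
  proof (induction rule: down_induct)
    case base
    define u where "u i = (if i = Max A then q else 1)" for i
    have ne: "A \<noteq> {}" using assms by auto
    have "x (Max A) d * x i j = (u i * 1) \<cdot> (x i j * x (Max A) d)" if "i \<in> A" "j \<in> B" for i j
    proof (cases "i = Max A")
      case True
      then show ?thesis using qmat_row[OF qmat_x assms(6)[OF that(2)]] by (simp add: u_def)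
    next
      case False
      then have "i < Max A" using that assms(1) by (simp add: order.not_eq_order_implies_strict)
      from qmat_anti[OF qmat_x this assms(6)[OF that(2)]] False show ?thesis by (simp add: u_def)
    qed
    from minor_weights[OF this assms(1-3)]
    have "x (Max A) d * minor q x A B = (prod u A * (\<Prod>j\<in>B. 1)) \<cdot> (minor q x A B * x (Max A) d)" .
    moreover have "prod u A = q"
      using assms(1) ne by (simp add: u_def prod.delta)
    ultimately show ?case by (simp add: R_def minor_single)
  next
    case (step p r)
    show ?case unfolding R_def
      by (rule move_row[where A = "{r}" and r = r and p = p, OF _ _ _ _ _ _ _ _ _ _ _ _ step(5)[unfolded R_def]])
         (use step(1-4) assms in \<open>auto simp: min_def max_def\<close>)
  qed
  then show ?thesis using q_nonzero by (simp add: R_def minor_single)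
qed

lemma entry_right:
  assumes "finite A" "finite B" "card A = card B" "A \<subseteq> {1..m}" "a \<in> A" "\<And>j. j \<in> B \<Longrightarrow> j < d"
  shows "minor q x A B * x a d = q \<cdot> (x a d * minor q x A B)"
proof -
  define R where "R a \<longleftrightarrow> minor q x {a} {d} * minor q x A B = inverse q \<cdot> (minor q x A B * minor q x {a} {d})" for a
  have "R a"
    using assms(1,5)
  proof (induction rule: up_induct)
    case base
    define u where "u i = (if i = Min A then inverse q else 1)" for i
    have ne: "A \<noteq> {}" using assms by auto
    have "x (Min A) d * x i j = (u i * 1) \<cdot> (x i j * x (Min A) d)" if "i \<in> A" "j \<in> B" for i j
    proof (cases "i = Min A")
      case True
      then show ?thesis using qmat_row[OF qmat_x assms(6)[OF that(2)], of "Min A"] q_nonzero by (simp add: u_def)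
    next
      case False
      then have "Min A < i" using that assms(1) by (simp add: order.not_eq_order_implies_strict)
      from qmat_anti[OF qmat_x this assms(6)[OF that(2)]] False show ?thesis by (simp add: u_def)
    qed
    from minor_weights[OF this assms(1-3)]
    have "x (Min A) d * minor q x A B = (prod u A * (\<Prod>j\<in>B. 1)) \<cdot> (minor q x A B * x (Min A) d)" .
    moreover have "prod u A = inverse q"
      using assms(1) ne by (simp add: u_def prod.delta)
    ultimately show ?case by (simp add: R_def minor_single)
  next
    case (step p r)
    show ?case unfolding R_def
      by (rule move_row[where A = "{p}" and r = p and p = r, OF _ _ _ _ _ _ _ _ _ _ _ _ step(5)[unfolded R_def]])
         (use step(1-4) assms in \<open>auto simp: min_def max_def\<close>)
  qed
  then show ?thesis using q_nonzero by (simp add: R_def minor_single)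
qed

end

context universal_qmat
begin

interpretation M: qalgebra "rsm :: 'k \<Rightarrow> (int, 'a) rop \<Rightarrow> (int, 'a) rop" q
  by (intro qalgebra.intro kalgebra_rsm qalgebra_axioms.intro q_nonzero)

text \<open>Crossing applied to the centrality of \<open>x\<^sub>a\<^sub>r\<close> for the minor that omits \<open>p\<close>. The correction
  terms involve only the minor omitting \<open>p\<close>, which precedes the one omitting \<open>r\<close> in the tower.\<close>

lemma shifted_entry:
  assumes "finite A" "finite J" "card J = Suc (card A)" "A \<subseteq> {1..m}" "J \<subseteq> {1..n}" "a \<in> A"
    and pr: "p \<in> J" "r \<in> J" "p < r" "\<And>l. l \<in> J \<Longrightarrow> \<not> (p < l \<and> l < r)"
  shows "minor q x A (J - {r}) * x a r = inverse q \<cdot> (x a r * minor q x A (J - {r})) +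
     (x a p * minor q x A (J - {p}) - inverse q \<cdot> (minor q x A (J - {p}) * x a p))"
proof -
  have "minor q x A (J - {p}) * x a r = x a r * minor q x A (J - {p})"
    by (rule central_entry) (use assms in auto)
  then have c: "minor q x A (J - {p}) * minor q x {a} {r} = 1 \<cdot> (minor q x {a} {r} * minor q x A (J - {p}))"
    by (simp add: minor_single)
  have "inverse q \<cdot> (minor q x A (J - {p}) * minor q x {a} {p}) + minor q x A (J - {r}) * minor q x {a} {r}
     = 1 \<cdot> (inverse q \<cdot> (minor q x {a} {r} * minor q x A (J - {r})) + minor q x {a} {p} * minor q x A (J - {p}))"
    by (rule crossing[where p = p and r = r, OF _ _ _ _ _ _ _ _ _ _ _ c]) (use assms in auto)
  then have "inverse q \<cdot> (minor q x A (J - {p}) * x a p) + minor q x A (J - {r}) * x a r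
     = inverse q \<cdot> (x a r * minor q x A (J - {r})) + x a p * minor q x A (J - {p})"
    by (simp add: minor_single)
  then show ?thesis by (simp add: algebra_simps)
qed

text \<open>For the least index the omitted column lies to the left of all the columns that remain, and
  weights apply: one entry column has weight \<open>q\<inverse>\<close>, all others are central. The general case moves
  the omitted column up; the other minor contains both columns involved, so it is fixed by the
  shear.\<close>

lemma maximal_minors_qcommute:
  assumes "finite A" "finite J" "card J = Suc (card A)" "A \<subseteq> {1..m}" "J \<subseteq> {1..n}"
    and pr: "p \<in> J" "r \<in> J" "p < r"
  shows "minor q x A (J - {p}) * minor q x A (J - {r}) =
     inverse q \<cdot> (minor q x A (J - {r}) * minor q x A (J - {p}))"
proof -
  define L where "L = {l\<in>J. l < r}"
  have L: "finite L" "p \<in> L" using assms by (auto simp: L_def)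
  show ?thesis
    using L
  proof (induction rule: up_induct)
    case base
    have minL: "Min L \<in> L" by (rule Min_in) (use L in auto)
    have low: "Min L < j" if "j \<in> J - {Min L}" for j
    proof (cases "j < r")
      case True
      then have "Min L \<le> j" using that L by (intro Min_le) (auto simp: L_def)
      then show ?thesis using that by auto
    qed (use minL in \<open>auto simp: L_def\<close>)
    define v where "v j = (if j = Min L then inverse q else 1)" for j
    have "minor q x A (J - {Min L}) * x i j = (1 * v j) \<cdot> (x i j * minor q x A (J - {Min L}))"
      if "i \<in> A" "j \<in> J - {r}" for i j
    proof (cases "j = Min L")
      case True
      then show ?thesis
        using entry_left[of A "J - {Min L}" i "Min L"] that assms low minL by (simp add: v_def L_def)
    next
      case False
      then show ?thesis
        using central_entry[of A "J - {Min L}" i j] that assms minL by (auto simp add: v_def L_def)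
    qed
    from minor_weights[of A "J - {r}" _ _ "\<lambda>_. 1" v, OF this]
    have "minor q x A (J - {Min L}) * minor q x A (J - {r}) =
       ((\<Prod>i\<in>A. 1) * prod v (J - {r})) \<cdot> (minor q x A (J - {r}) * minor q x A (J - {Min L}))"
      using assms by simp
    moreover have "prod v (J - {r}) = inverse q"
      using minL assms by (auto simp: v_def prod.delta L_def)
    ultimately show ?case by simp
  next
    case (step p s)
    have "insert p (J - {p} - {s}) = J - {s}" using step by (auto simp: L_def)
    moreover have "\<not> (p < l \<and> l < s)" if "l \<in> J" for l using step(2) step(4)[of l] that by (auto simp: L_def)
    ultimately show ?case
      by (intro move_column[where J = "J - {p}" and r = s and p = p, OF _ _ _ _ _ _ _ _ _ _ step(5)])
        (use step(1-3) assms in \<open>auto simp: L_def min_def max_def\<close>)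
  qed
qed

text \<open>With \<open>a\<close> and \<open>d\<close> extremal, the weights of the columns \<open>a\<close> and \<open>d\<close> are \<open>q\<inverse>\<close> and \<open>q\<close> and
  cancel.\<close>

lemma nested_minors_commute:
  assumes "finite A" "finite J" "card J = Suc (Suc (card A))" "A \<subseteq> {1..m}" "J \<subseteq> {1..n}"
    and J: "a \<in> J" "b \<in> J" "c \<in> J" "d \<in> J" and lt: "a < b" "a < c" "b \<noteq> c" "b < d" "c < d"
  shows "minor q x A (J - {a, d}) * minor q x A (J - {b, c}) =
     minor q x A (J - {b, c}) * minor q x A (J - {a, d})"
proof -
  define P where "P a d \<longleftrightarrow> minor q x A (J - {a, d}) * minor q x A (J - {b, c}) =
     1 \<cdot> (minor q x A (J - {b, c}) * minor q x A (J - {a, d}))" for a d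
  define L where "L = {l\<in>J. l < b \<and> l < c}"
  define U where "U = {l\<in>J. b < l \<and> c < l}"
  have L: "finite L" "a \<in> L" using assms by (auto simp: L_def)
  have U: "finite U" "d \<in> U" using assms by (auto simp: U_def)
  have maxU: "Max U \<in> U" by (rule Max_in) (use U in auto)
  have minL: "Min L \<in> L" by (rule Min_in) (use L in auto)
  have "P a (Max U)"
    using L
  proof (induction rule: up_induct)
    case base
    have low: "Min L < j" if "j \<in> J - {Min L}" for j
    proof (cases "j < b \<and> j < c")
      case True
      then have "Min L \<le> j" using that L by (intro Min_le) (auto simp: L_def)
      then show ?thesis using that by auto
    qed (use minL in \<open>auto simp: L_def\<close>)
    have high: "j < Max U" if "j \<in> J - {Max U}" for j
    proof (cases "b < j \<and> c < j")
      case True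
      then have "j \<le> Max U" using that U by (intro Max_ge) (auto simp: U_def)
      then show ?thesis using that by auto
    qed (use maxU in \<open>auto simp: U_def\<close>)
    have mm: "Min L < Max U" "Min L \<in> J" "Max U \<in> J" "Min L \<noteq> b" "Min L \<noteq> c" "Max U \<noteq> b" "Max U \<noteq> c"
      using minL maxU by (auto simp: L_def U_def)
    define v where "v j = (if j = Min L then inverse q else if j = Max U then q else 1)" for j
    have card: "card (J - {Min L, Max U}) = card A" "card (J - {b, c}) = card A"
      using mm assms by (simp_all add: card_Diff_subset)
    have "minor q x A (J - {Min L, Max U}) * x i j = (1 * v j) \<cdot> (x i j * minor q x A (J - {Min L, Max U}))"
      if "i \<in> A" "j \<in> J - {b, c}" for i j
    proof -
      consider "j = Min L" | "j = Max U" "j \<noteq> Min L" | "j \<noteq> Min L" "j \<noteq> Max U" by blast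
      then show ?thesis
      proof cases
        case 1
        then show ?thesis
          using entry_left[of A "J - {Min L, Max U}" i "Min L"] that assms low card by (simp add: v_def)
      next
        case 2
        then show ?thesis
          using entry_right[of A "J - {Min L, Max U}" i "Max U"] that assms high card by (simp add: v_def)
      next
        case 3
        then show ?thesis
          using central_entry[of A "J - {Min L, Max U}" i j] that assms card by (auto simp add: v_def)
      qed
    qed
    from minor_weights[of A "J - {b, c}" _ _ "\<lambda>_. 1" v, OF this]
    have "minor q x A (J - {Min L, Max U}) * minor q x A (J - {b, c}) =
       ((\<Prod>i\<in>A. 1) * prod v (J - {b, c})) \<cdot> (minor q x A (J - {b, c}) * minor q x A (J - {Min L, Max U}))"
      using assms card by simp
    moreover have "prod v (J - {b, c}) = 1"
    proof -
      have "prod v (J - {b, c}) = prod v {Min L, Max U}"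
        by (rule prod.mono_neutral_right) (use mm assms in \<open>auto simp: v_def\<close>)
      then show ?thesis using mm q_nonzero by (simp add: v_def)
    qed
    ultimately show ?case by (simp add: P_def)
  next
    case (step p s)
    have "insert p (J - {p, Max U} - {s}) = J - {s, Max U}" using step maxU by (auto simp: L_def U_def)
    moreover have "\<not> (p < l \<and> l < s)" if "l \<in> J" for l using step(2) step(4)[of l] that by (auto simp: L_def)
    ultimately show ?case unfolding P_def
      by (intro move_column[where J = "J - {p, Max U}" and r = s and p = p, OF _ _ _ _ _ _ _ _ _ _ step(5)[unfolded P_def]])
        (use step(1-3) maxU assms in \<open>auto simp: L_def U_def min_def max_def\<close>)
  qed
  have "P a d"
    using U
  proof (induction rule: down_induct)
    case (step p s)
    have "insert s (J - {a, s} - {p}) = J - {a, p}" using step L by (auto simp: L_def U_def)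
    moreover have "\<not> (p < l \<and> l < s)" if "l \<in> J" for l using step(1) step(4)[of l] that by (auto simp: U_def)
    ultimately show ?case unfolding P_def
      by (intro move_column[where J = "J - {a, s}" and r = p and p = s, OF _ _ _ _ _ _ _ _ _ _ step(5)[unfolded P_def]])
        (use step(1-3) L assms in \<open>auto simp: L_def U_def min_def max_def\<close>)
  qed fact
  then show ?thesis by (simp add: P_def)
qed

text \<open>For neighbouring \<open>c\<close> and \<open>d\<close> this is the crossing of \<open>maximal_minors_qcommute\<close> for the
  minors omitting \<open>a\<close>, \<open>c\<close> and \<open>b\<close>, \<open>c\<close>, combined with \<open>nested_minors_commute\<close>. Shears then move
  \<open>d\<close> upwards; they fix all minors that omit \<open>c\<close>, so the \<open>\<beta>\<close>-coefficient of the relation is the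
  relation for the next \<open>d\<close>.\<close>

lemma crossed_minors:
  assumes "finite A" "finite J" "card J = Suc (Suc (card A))" "A \<subseteq> {1..m}" "J \<subseteq> {1..n}"
    and J: "a \<in> J" "b \<in> J" "c \<in> J" "d \<in> J" and lt: "a < b" "b < c" "c < d"
  shows "minor q x A (J - {a, c}) * minor q x A (J - {b, d}) =
     minor q x A (J - {b, d}) * minor q x A (J - {a, c}) -
       (q - inverse q) \<cdot> (minor q x A (J - {a, d}) * minor q x A (J - {b, c}))"
proof -
  let ?D = "\<lambda>u v. minor q x A (J - {u, v})"
  define U where "U = {l\<in>J. c < l}"
  have U: "finite U" "d \<in> U" using assms by (auto simp: U_def)
  show ?thesis using U
  proof (induction rule: up_induct)
    case base
    have maxU: "Min U \<in> U" by (rule Min_in) (use U in auto)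
    then have cU: "c < Min U" "Min U \<in> J" by (auto simp: U_def)
    have mid: "\<not> (c < l \<and> l < Min U)" if "l \<in> J" for l
    proof -
      have "c < l \<Longrightarrow> Min U \<le> l" using U that by (intro Min_le) (auto simp: U_def)
      then show ?thesis by linarith
    qed
    have "minor q x A (J - {c} - {a}) * minor q x A (J - {c} - {b}) =
      inverse q \<cdot> (minor q x A (J - {c} - {b}) * minor q x A (J - {c} - {a}))"
      by (rule maximal_minors_qcommute) (use assms in auto)
    moreover have "J - {c} - {a} = J - {a, c}" "J - {c} - {b} = J - {b, c}" by auto
    ultimately have cm: "?D a c * ?D b c = inverse q \<cdot> (?D b c * ?D a c)" by simp
    have "inverse q \<cdot> (?D a c * ?D b (Min U)) + ?D a (Min U) * ?D b c =
       inverse q \<cdot> (inverse q \<cdot> (?D b c * ?D a (Min U)) + ?D b (Min U) * ?D a c)"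
      by (rule crossing[where p = c and r = "Min U", OF _ _ _ _ _ _ _ _ _ _ _ cm]) (use assms cU mid in auto)
    then have "q \<cdot> (inverse q \<cdot> (?D a c * ?D b (Min U)) + ?D a (Min U) * ?D b c) =
       q \<cdot> (inverse q \<cdot> (inverse q \<cdot> (?D b c * ?D a (Min U)) + ?D b (Min U) * ?D a c))" by simp
    moreover have "?D a (Min U) * ?D b c = ?D b c * ?D a (Min U)"
      by (rule nested_minors_commute) (use assms cU in auto)
    ultimately show ?case using q_nonzero
      by (simp add: scale_right_distrib scale_left_diff_distrib algebra_simps)
  next
    case (step p s)
    have "p \<noteq> s" "s \<in> {1..n}" using step assms by (auto simp: U_def)
    obtain \<phi> where \<phi>: "alg_hom rsm G \<phi>" "\<And>i j. \<phi> (x i j) = shear p s x i j"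
      using shear_hom[OF \<open>p \<noteq> s\<close> \<open>s \<in> {1..n}\<close>] by blast
    have mid: "\<not> (min p s < l \<and> l < max p s)" if "l \<in> J" for l
      using step(1-3) step(4)[of l] that by (auto simp: U_def)
    note min = shear_hom_minor[OF \<open>p \<noteq> s\<close> _ \<phi>]
    have inv: "\<phi> (?D a c) = dg (?D a c)" "\<phi> (?D b c) = dg (?D b c)"
      using step(1-3) mid assms by (intro min(4); auto simp: U_def)+
    have "insert p (J - {u, p} - {s}) = J - {u, s}" if "u < c" for u
      using that step by (auto simp: U_def)
    moreover have "\<phi> (?D u p) = dg (?D u p) * kp (-1) + dg (minor q x A (insert p (J - {u, p} - {s}))) * bt" if "u < c" for u
      using min(3)[of "J - {u, p}" A] that step(1-3) mid assms by (auto simp: U_def)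
    ultimately have mv: "\<phi> (?D u p) = dg (?D u p) * kp (-1) + dg (?D u s) * bt" if "u < c" for u
      using that by simp
    have "\<phi> (?D a c * ?D b p) = \<phi> (?D b p * ?D a c - (q - inverse q) \<cdot> (?D a p * ?D b c))"
      using step(5) by simp
    then have "\<phi> (?D a c) * \<phi> (?D b p) =
        \<phi> (?D b p) * \<phi> (?D a c) - rsm (q - inverse q) (\<phi> (?D a p) * \<phi> (?D b c))"
      by (simp add: alg_homD[OF \<phi>(1)] hom_diff[OF \<phi>(1) kalgebra_rsm] minor_in_G assms gsub.mult gsub.scale)
    then have "rapp (\<phi> (?D a c) * \<phi> (?D b p)) (single 0 1) 1 =
        rapp (\<phi> (?D b p) * \<phi> (?D a c) - rsm (q - inverse q) (\<phi> (?D a p) * \<phi> (?D b c))) (single 0 1) 1" by simp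
    then show ?case using lt by (simp add: inv mv single_def distrib_left)
  qed
qed

text \<open>The extremal case is \<open>a = Min R\<close>, \<open>r = Max R\<close>, \<open>b = Min C\<close>, \<open>c = Max C\<close>, where row and
  column weights multiply to \<open>1\<close>. The four indices are then moved one after the other. Every move
  changes one of the two minors, while the other contains both indices involved.\<close>

lemma opposite_minors_commute:
  assumes "finite R" "finite C" "card R = card C" "R \<subseteq> {1..m}" "C \<subseteq> {1..n}"
    and R: "a \<in> R" "r \<in> R" "a < r" and C: "b \<in> C" "c \<in> C" "b < c"
  shows "minor q x (R - {r}) (C - {b}) * minor q x (R - {a}) (C - {c}) =
     minor q x (R - {a}) (C - {c}) * minor q x (R - {r}) (C - {b})"
proof -
  interpret T: universal_qmat sm q n m "\<lambda>i j. x j i" by (rule transpose)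
  define P where "P a r b c \<longleftrightarrow> minor q x (R - {r}) (C - {b}) * minor q x (R - {a}) (C - {c}) =
     1 \<cdot> (minor q x (R - {a}) (C - {c}) * minor q x (R - {r}) (C - {b}))" for a r b c
  have P': "P a r b c" if "minor q x (R - {a}) (C - {c}) * minor q x (R - {r}) (C - {b}) =
     1 \<cdot> (minor q x (R - {r}) (C - {b}) * minor q x (R - {a}) (C - {c}))" for a r b c
    using that by (simp add: P_def)
  have P'': "minor q x (R - {a}) (C - {c}) * minor q x (R - {r}) (C - {b}) =
     1 \<cdot> (minor q x (R - {r}) (C - {b}) * minor q x (R - {a}) (C - {c}))" if "P a r b c" for a r b c
    using that by (simp add: P_def)
  have ne: "R \<noteq> {}" "C \<noteq> {}" using R C by auto
  note mx = Max_in[OF assms(1) ne(1)] Min_in[OF assms(1) ne(1)] Max_in[OF assms(2) ne(2)] Min_in[OF assms(2) ne(2)]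
  have le: "Min R \<le> a" "r \<le> Max R" "Min C \<le> b" "c \<le> Max C" using assms by auto
  have lts: "Min C < Max C" "b < Max C" "a < Max R" "Min R < Max R" "Min C < c" "Min R < r"
    using le R C by linarith+
  have ltR: "Min R < i" if "i \<in> R - {Min R}" for i using that assms(1) by (auto simp: order.not_eq_order_implies_strict)
  have ltC: "j < Max C" if "j \<in> C - {Max C}" for j using that assms(2) by (auto simp: order.not_eq_order_implies_strict)
  have base: "P (Min R) (Max R) (Min C) (Max C)"
  proof -
    define u where "u i = (if i = Min R then inverse q else 1)" for i
    define v where "v j = (if j = Max C then q else 1)" for j
    let ?z = "minor q x (R - {Min R}) (C - {Max C})"
    have cz: "card (R - {Min R}) = card (C - {Max C})" using mx assms by simp
    have "?z * x i j = (u i * v j) \<cdot> (x i j * ?z)" if ij: "i \<in> R - {Max R}" "j \<in> C - {Min C}" for i j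
    proof -
      consider "i \<noteq> Min R" "j \<noteq> Max C" | "i = Min R" "j \<noteq> Max C" | "i \<noteq> Min R" "j = Max C"
        | "i = Min R" "j = Max C" by blast
      then show ?thesis
      proof cases
        case 1
        then show ?thesis
          using central_entry[of "R - {Min R}" "C - {Max C}" i j] ij assms cz by (auto simp: u_def v_def)
      next
        case 2
        have "minor q (\<lambda>i j. x j i) (C - {Max C}) (R - {Min R}) * x i j =
           inverse q \<cdot> (x i j * minor q (\<lambda>i j. x j i) (C - {Max C}) (R - {Min R}))"
          by (rule T.entry_left) (use 2 ij assms cz ltR in auto)
        then show ?thesis
          using 2 minor_transpose[of "R - {Min R}" "C - {Max C}" q x] cz assms qmat_x by (simp add: u_def v_def)
      next
        case 3
        then show ?thesis
          using entry_right[of "R - {Min R}" "C - {Max C}" i "Max C"] ij assms cz ltC by (auto simp: u_def v_def)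
      next
        case 4
        have "x i j * x k l = (1 * 1) \<cdot> (x k l * x i j)" if "k \<in> R - {Min R}" "l \<in> C - {Max C}" for k l
          using qmat_anti[OF qmat_x ltR[OF that(1)] ltC[OF that(2)]] 4 by simp
        from minor_weights[of "R - {Min R}" "C - {Max C}" _ _ "\<lambda>_. 1" "\<lambda>_. 1", OF this]
        show ?thesis using 4 cz assms q_nonzero by (simp add: u_def v_def)
      qed
    qed
    from minor_weights[of "R - {Max R}" "C - {Min C}" _ _ u v, OF this]
    have "?z * minor q x (R - {Max R}) (C - {Min C}) =
       (prod u (R - {Max R}) * prod v (C - {Min C})) \<cdot> (minor q x (R - {Max R}) (C - {Min C}) * ?z)"
      using assms mx by simp
    moreover have "Min R \<noteq> Max R" "Max C \<noteq> Min C" using le R C by linarith+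
    then have "prod u (R - {Max R}) = inverse q" "prod v (C - {Min C}) = q"
      using mx assms by (auto simp: u_def v_def prod.delta)
    ultimately show ?thesis using q_nonzero by (simp add: P_def)
  qed
  have "b \<in> C - {Max C}" using C le by auto
  with finite_Diff[OF assms(2)] have "P (Min R) (Max R) b (Max C)"
  proof (induction rule: up_induct)
    case base
    have "Min (C - {Max C}) = Min C" by (rule Min_eqI) (use mx assms le lts in auto)
    with \<open>P (Min R) (Max R) (Min C) (Max C)\<close> show ?case by simp
  next
    case (step p s)
    have i: "insert p (C - {p} - {s}) = C - {s}" using step by auto
    have mid: "\<not> (p < l \<and> l < s)" if "l \<in> C" for l using step(2) step(4)[of l] ltC[of s] that by auto
    show ?case unfolding P_def
      by (rule move_column[where J = "C - {p}" and r = s and p = p, OF _ _ _ _ _ _ _ _ _ _ step(5)[unfolded P_def] i[symmetric]])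
        (use step(1-3) mid assms lts ltC in \<open>auto simp: min_def max_def\<close>)
  qed
  note S1 = this
  have "finite {l\<in>C. b < l}" "c \<in> {l\<in>C. b < l}" using assms by auto
  then have S2: "P (Min R) (Max R) b c"
  proof (induction rule: down_induct)
    case base
    have "Max {l\<in>C. b < l} = Max C" by (rule Max_eqI) (use mx assms le lts in auto)
    with S1 show ?case by simp
  next
    case (step p s)
    have i: "insert s (C - {s} - {p}) = C - {p}" using step by auto
    have mid: "\<not> (p < l \<and> l < s)" if "l \<in> C" for l using step(1) step(4)[of l] that by auto
    show ?case
      by (rule P', rule move_column[where J = "C - {s}" and r = p and p = s, OF _ _ _ _ _ _ _ _ _ _ P''[OF step(5)] i[symmetric]])
        (use step(1-3) mid assms lts in \<open>auto simp: min_def max_def\<close>)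
  qed
  have cards: "card (R - {i}) = card (C - {j})" if "i \<in> R" "j \<in> C" for i j
    using that assms by simp
  have "finite (R - {Max R})" "a \<in> R - {Max R}" using assms lts by auto
  then have S3: "P a (Max R) b c"
  proof (induction rule: up_induct)
    case base
    have "Min (R - {Max R}) = Min R" by (rule Min_eqI) (use mx assms le lts in auto)
    with S2 show ?case by simp
  next
    case (step p s)
    have i: "insert p (R - {p} - {s}) = R - {s}" using step by auto
    have "s < Max R" using step(2) assms by (auto simp: order.not_eq_order_implies_strict)
    then have mid: "\<not> (p < l \<and> l < s)" if "l \<in> R" for l using step(2) step(4)[of l] that by auto
    show ?case
      by (rule P', rule move_row[where A = "R - {p}" and r = s and p = p, OF _ _ _ _ cards cards _ _ _ _ _ _ P''[OF step(5)] i[symmetric]])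
        (use step(1-3) mid assms mx in \<open>auto simp: min_def max_def\<close>)
  qed
  have "finite {i\<in>R. a < i}" "r \<in> {i\<in>R. a < i}" using assms by auto
  then have "P a r b c"
  proof (induction rule: down_induct)
    case base
    have "Max {i\<in>R. a < i} = Max R" by (rule Max_eqI) (use mx assms le lts in auto)
    with S3 show ?case by simp
  next
    case (step p s)
    have i: "insert s (R - {s} - {p}) = R - {p}" using step by auto
    have mid: "\<not> (p < l \<and> l < s)" if "l \<in> R" for l using step(1) step(4)[of l] that by auto
    show ?case unfolding P_def
      by (rule move_row[where A = "R - {s}" and r = p and p = s, OF _ _ _ _ cards cards _ _ _ _ _ _ step(5)[unfolded P_def] i[symmetric]])
        (use step(1-3) mid assms in \<open>auto simp: min_def max_def\<close>)
  qed
  then show ?thesis by (simp add: P_def)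
qed

end

section \<open>Elements that are free over a subalgebra\<close>

context kalgebra
begin

definition left_free :: "'a set \<Rightarrow> 'a \<Rightarrow> bool" where
  "left_free R y \<longleftrightarrow> (\<forall>p f. (\<forall>i\<le>p. f i \<in> R) \<longrightarrow> (\<Sum>i\<le>p::nat. f i * y ^ i) = 0 \<longrightarrow> (\<forall>i\<le>p. f i = 0))"

lemma left_freeI:
  assumes "\<And>p f. (\<And>i. i \<le> p \<Longrightarrow> f i \<in> R) \<Longrightarrow> (\<Sum>i\<le>p::nat. f i * y ^ i) = 0 \<Longrightarrow> f p = 0"
  shows "left_free R y"
  unfolding left_free_def
proof (intro allI impI)
  fix p f i
  assume "\<forall>i\<le>p. f i \<in> R" "(\<Sum>i\<le>p::nat. f i * y ^ i) = 0" "i \<le> p"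
  then show "f i = 0"
  proof (induction p)
    case 0
    then show ?case using assms[of 0 f] by simp
  next
    case (Suc p)
    have "f (Suc p) = 0" using assms[of "Suc p" f] Suc.prems by blast
    with Suc show ?case by (auto simp: le_Suc_eq)
  qed
qed

lemma left_freeD:
  "left_free R y \<Longrightarrow> (\<And>i. i \<le> p \<Longrightarrow> f i \<in> R) \<Longrightarrow> (\<Sum>i\<le>p::nat. f i * y ^ i) = 0 \<Longrightarrow> i \<le> p \<Longrightarrow> f i = 0"
  unfolding left_free_def by blast

lemma left_free_mono: "left_free R y \<Longrightarrow> R' \<subseteq> R \<Longrightarrow> left_free R' y"
  unfolding left_free_def by blast

text \<open>Matrix entries of an operator.\<close>

definition cmp :: "('i, 'a) rop \<Rightarrow> 'i \<Rightarrow> 'i \<Rightarrow> 'a" where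
  "cmp T k l = rapp T (single l 1) k"

lemma rapp_expand:
  assumes "finite S" "\<And>l. l \<notin> S \<Longrightarrow> h l = 0"
  shows "rapp T h k = (\<Sum>l\<in>S. cmp T k l * h l)"
  using assms
proof (induction S arbitrary: h rule: finite_induct)
  case empty
  then have "h = (\<lambda>i. h i * 0)" by auto
  then have "rapp T h k = rapp T (\<lambda>i. h i * 0) k" by simp
  also have "\<dots> = 0" by (simp only: rapp_mult_right) simp
  finally show ?case by simp
next
  case (insert l S)
  define g where "g = (\<lambda>i. if i = l then 0 else h i)"
  have "h = (\<lambda>i. single l 1 i * h l + g i)" by (auto simp: single_def g_def)
  then have "rapp T h k = rapp T (\<lambda>i. single l 1 i * h l + g i) k" by simp
  also have "\<dots> = cmp T k l * h l + rapp T g k"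
    by (simp only: rapp_add_right rapp_mult_right cmp_def)
  also have "rapp T g k = (\<Sum>l\<in>S. cmp T k l * g l)"
    by (rule insert.IH) (use insert.prems in \<open>auto simp: g_def\<close>)
  also have "\<dots> = (\<Sum>l\<in>S. cmp T k l * h l)"
    by (rule sum.cong) (use insert.hyps in \<open>auto simp: g_def\<close>)
  finally show ?case using insert.hyps by simp
qed

lemma cmp_mult:
  assumes "finite {n. cmp T n l \<noteq> 0}"
  shows "cmp (S * T) k l = (\<Sum>n\<in>{n. cmp T n l \<noteq> 0}. cmp S k n * cmp T n l)"
  unfolding cmp_def[of "S * T"] rapp_simps
  by (subst rapp_expand[OF assms]) (auto simp: cmp_def)

lemma cmp_simps [simp]:
  "cmp (S + T) k l = cmp S k l + cmp T k l"
  "cmp (rsm c T) k l = c \<cdot> cmp T k l"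
  "cmp 1 k l = (if k = l then 1 else 0)"
  by (simp_all add: cmp_def single_def)

text \<open>Lower triangular operators with entries in \<open>R\<close>. The entry on the diagonal is only controlled
  on level \<open>0\<close>, since the other levels are twisted by powers of \<open>q\<close>.\<close>

definition lower_comps :: "'a set \<Rightarrow> (int, 'a) rop \<Rightarrow> 'a \<Rightarrow> bool" where
  "lower_comps R T r \<longleftrightarrow> (\<forall>k l. cmp T k l \<in> R) \<and> (\<forall>k l. k < l \<longrightarrow> cmp T k l = 0) \<and>
     (\<forall>l. finite {k. cmp T k l \<noteq> 0}) \<and> cmp T 0 0 = r"

text \<open>Lower triangularity is inherited by products, and the entry on level \<open>0\<close> is multiplicative
  for triangular operators. It therefore suffices to know it for generators.\<close>

lemma lower_comps_gsub:
  assumes "alg_hom rsm (gsub E) \<phi>" "Y \<subseteq> gsub E" "\<And>z. z \<in> Y \<Longrightarrow> lower_comps (gsub Y) (\<phi> z) z"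
    and "r \<in> gsub Y"
  shows "lower_comps (gsub Y) (\<phi> r) r"
  using assms(4)
proof induction
  case (gen r)
  then show ?case by (rule assms(3))
next
  case one
  show ?case by (auto simp: lower_comps_def alg_homD[OF assms(1)] gsub_zero intro: gsub.one)
next
  case (add a b)
  have G: "a \<in> gsub E" "b \<in> gsub E" using add gsub_least assms(2) by blast+
  have "finite {k. cmp (\<phi> a) k l + cmp (\<phi> b) k l \<noteq> 0}" for l
    by (rule finite_subset[of _ "{k. cmp (\<phi> a) k l \<noteq> 0} \<union> {k. cmp (\<phi> b) k l \<noteq> 0}"])
       (use add.IH in \<open>auto simp: lower_comps_def\<close>)
  then show ?case using add.IH by (auto simp: lower_comps_def alg_homD[OF assms(1)] G intro: gsub.add)
next
  case (scale a c)
  have G: "a \<in> gsub E" using scale gsub_least assms(2) by blast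
  have "finite {k. c \<cdot> cmp (\<phi> a) k l \<noteq> 0}" for l
    by (rule finite_subset[of _ "{k. cmp (\<phi> a) k l \<noteq> 0}"])
       (use scale.IH in \<open>auto simp: lower_comps_def\<close>)
  then show ?case using scale.IH
    by (auto simp: lower_comps_def alg_homD[OF assms(1)] G simp del: scale_eq_0_iff intro: gsub.scale)
next
  case (mult a b)
  have G: "a \<in> gsub E" "b \<in> gsub E" using mult gsub_least assms(2) by blast+
  let ?S = "\<lambda>l. {n. cmp (\<phi> b) n l \<noteq> 0}"
  have c: "cmp (\<phi> (a * b)) k l = (\<Sum>n\<in>?S l. cmp (\<phi> a) k n * cmp (\<phi> b) n l)" for k l
    using mult.IH cmp_mult[of "\<phi> b" l "\<phi> a" k] by (simp add: alg_homD[OF assms(1)] G lower_comps_def)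
  have "cmp (\<phi> (a * b)) k l \<in> gsub Y" for k l
    unfolding c using mult.IH by (intro gsub_sum gsub.mult) (auto simp: lower_comps_def)
  moreover have "cmp (\<phi> (a * b)) k l = 0" if "k < l" for k l
    unfolding c
  proof (rule sum.neutral, rule ballI)
    fix n assume "n \<in> ?S l"
    then have "l \<le> n" using mult.IH(2) unfolding lower_comps_def by (metis (mono_tags) mem_Collect_eq not_le)
    then have "cmp (\<phi> a) k n = 0" using mult.IH(1) that unfolding lower_comps_def by (meson less_le_trans)
    then show "cmp (\<phi> a) k n * cmp (\<phi> b) n l = 0" by simp
  qed
  moreover have "finite {k. cmp (\<phi> (a * b)) k l \<noteq> 0}" for l
  proof (rule finite_subset)
    show "{k. cmp (\<phi> (a * b)) k l \<noteq> 0} \<subseteq> (\<Union>n\<in>?S l. {k. cmp (\<phi> a) k n \<noteq> 0})"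
    proof
      fix k assume "k \<in> {k. cmp (\<phi> (a * b)) k l \<noteq> 0}"
      then have "(\<Sum>n\<in>?S l. cmp (\<phi> a) k n * cmp (\<phi> b) n l) \<noteq> 0" using c by simp
      then obtain n where "n \<in> ?S l" "cmp (\<phi> a) k n * cmp (\<phi> b) n l \<noteq> 0"
        by (meson sum.neutral)
      moreover from this have "cmp (\<phi> a) k n \<noteq> 0" by auto
      ultimately show "k \<in> (\<Union>n\<in>?S l. {k. cmp (\<phi> a) k n \<noteq> 0})" by blast
    qed
    show "finite (\<Union>n\<in>?S l. {k. cmp (\<phi> a) k n \<noteq> 0})"
      using mult.IH unfolding lower_comps_def by blast
  qed
  moreover have "cmp (\<phi> (a * b)) 0 0 = a * b"
  proof -
    have fin: "finite (?S 0)" using mult.IH by (auto simp: lower_comps_def)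
    have "cmp (\<phi> a) 0 n * cmp (\<phi> b) n 0 = (if n = 0 then a * b else 0)" for n
    proof -
      consider "n < 0" | "n = 0" | "0 < n" by linarith
      then show ?thesis
        using mult.IH unfolding lower_comps_def by cases auto
    qed
    then have "cmp (\<phi> (a * b)) 0 0 = (\<Sum>n\<in>?S 0. if n = 0 then a * b else 0)" unfolding c by simp
    also have "\<dots> = (if 0 \<in> ?S 0 then a * b else 0)" using fin by (simp add: sum.delta)
    also have "\<dots> = a * b" using mult.IH by (auto simp: lower_comps_def)
    finally show ?thesis .
  qed
  ultimately show ?case unfolding lower_comps_def by blast
qed

definition diag_comps :: "(int, 'a) rop \<Rightarrow> 'a \<Rightarrow> bool" where
  "diag_comps T r \<longleftrightarrow> (\<exists>u. T = dgf u \<and> u 0 = r)"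

lemma diag_comps_gsub:
  assumes "alg_hom rsm (gsub E) \<phi>" "Y \<subseteq> gsub E" "\<And>z. z \<in> Y \<Longrightarrow> diag_comps (\<phi> z) z"
    and "r \<in> gsub Y"
  shows "diag_comps (\<phi> r) r"
  using assms(4)
proof induction
  case (gen r)
  then show ?case by (rule assms(3))
next
  case one
  show ?case unfolding diag_comps_def alg_homD(1)[OF assms(1)] by (rule exI[of _ "\<lambda>_. 1"]) simp
next
  case (add a b)
  have "a \<in> gsub E" "b \<in> gsub E" using add gsub_least assms(2) by blast+
  then show ?case using add.IH by (auto simp: diag_comps_def alg_homD[OF assms(1)] dgf_add)
next
  case (scale a c)
  have "a \<in> gsub E" using scale gsub_least assms(2) by blast
  then show ?case using scale.IH
    by (auto simp: diag_comps_def alg_homD[OF assms(1)] rsm_def dgf_mult)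
next
  case (mult a b)
  have "a \<in> gsub E" "b \<in> gsub E" using mult gsub_least assms(2) by blast+
  then show ?case using mult.IH by (auto simp: diag_comps_def alg_homD[OF assms(1)] dgf_mult)
qed

end

context qalgebra
begin

interpretation M: qalgebra "rsm :: 'k \<Rightarrow> (int, 'a) rop \<Rightarrow> (int, 'a) rop" q
  by (intro qalgebra.intro kalgebra_rsm qalgebra_axioms.intro q_nonzero)

lemma cmp_shift: "cmp (dg a * kp e + dg b * bt) k l =
    (if k = l then (q powi (e * k)) \<cdot> a else if k = l + 1 then b else 0)"
  by (simp add: cmp_def single_def)

lemma lower_comps_shift:
  assumes "a \<in> R" "b \<in> R" "0 \<in> R" "\<And>c. c \<cdot> a \<in> R"
  shows "lower_comps R (dg a * kp e + dg b * bt) a"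
proof -
  have "{k. cmp (dg a * kp e + dg b * bt) k l \<noteq> 0} \<subseteq> {l, l + 1}" for l
    by (auto simp: cmp_shift simp del: cmp_simps split: if_splits)
  then have "finite {k. cmp (dg a * kp e + dg b * bt) k l \<noteq> 0}" for l
    by (rule finite_subset) simp
  then show ?thesis using assms by (auto simp: lower_comps_def cmp_shift simp del: cmp_simps)
qed

text \<open>Starting on level \<open>-p\<close>, the \<open>i\<close>-th power of \<open>y k\<^sup>e + y' \<beta>\<close> reaches at most the level \<open>i - p\<close>,
  and it reaches this level only by shifting each time.\<close>

lemma top_level_power:
  fixes p :: int
  shows "rapp ((dg y * kp e + dg y' * bt) ^ i) (single (- p) 1) (int i - p) = y' ^ i \<and>
     (\<forall>k > int i - p. rapp ((dg y * kp e + dg y' * bt) ^ i) (single (- p) 1) k = 0)"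
proof (induction i)
  case 0
  then show ?case by (simp add: single_def)
next
  case (Suc i)
  then show ?case by (simp add: algebra_simps)
qed

text \<open>Apply \<open>\<phi>\<close> to a relation \<open>\<Sum> f\<^sub>i y\<^sup>i = 0\<close> of degree \<open>p\<close>, start on level \<open>-p\<close> and look at
  level \<open>0\<close>. As the coefficients act diagonally, only \<open>f\<^sub>p y'\<^sup>p\<close> survives.\<close>

lemma free_of_regular_shift:
  assumes hom: "alg_hom rsm (gsub E) \<phi>" and Y: "Y \<subseteq> gsub E" "y \<in> gsub E" "y' \<in> gsub E"
    and diag: "\<And>z. z \<in> Y \<Longrightarrow> diag_comps (\<phi> z) z"
    and y: "\<phi> y = dg y * kp e + dg y' * bt"
    and regular: "\<And>r. r \<in> gsub E \<Longrightarrow> r * y' = 0 \<Longrightarrow> r = 0"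
  shows "left_free (gsub Y) y"
proof (rule left_freeI)
  fix p f assume f: "\<And>i. i \<le> p \<Longrightarrow> f i \<in> gsub Y" and 0: "(\<Sum>i\<le>p::nat. f i * y ^ i) = 0"
  have fE: "f i \<in> gsub E" if "i \<le> p" for i using f[OF that] Y gsub_least by blast
  have "\<phi> (\<Sum>i\<le>p. f i * y ^ i) = (\<Sum>i\<le>p. \<phi> (f i * y ^ i))"
    by (rule hom_sum[OF hom kalgebra_rsm]) (use fE Y in \<open>auto intro: gsub.mult gsub_power\<close>)
  then have "(\<Sum>i\<le>p. \<phi> (f i) * \<phi> y ^ i) = 0"
    by (simp add: 0 hom_zero[OF hom kalgebra_rsm] alg_homD(3)[OF hom] fE Y gsub_power hom_power[OF hom])
  then have "rapp (\<Sum>i\<le>p. \<phi> (f i) * \<phi> y ^ i) (single (- int p) 1) 0 = 0" by simp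
  moreover have "rapp (\<Sum>i\<in>I. g i) h k = (\<Sum>i\<in>I. rapp (g i) h k)" for I h k and g :: "nat \<Rightarrow> (int, 'a) rop"
    by (induction I rule: infinite_finite_induct) auto
  ultimately have "(\<Sum>i\<le>p. rapp (\<phi> (f i)) (rapp (\<phi> y ^ i) (single (- int p) 1)) 0) = 0" by simp
  moreover have "rapp (\<phi> (f i)) (rapp (\<phi> y ^ i) (single (- int p) 1)) 0 = (if i = p then f p * y' ^ p else 0)"
    if ip: "i \<le> p" for i
  proof -
    obtain u where u: "\<phi> (f i) = dgf u" "u 0 = f i"
      using diag_comps_gsub[OF hom Y(1), of "f i"] diag f[OF ip] by (auto simp: diag_comps_def)
    show ?thesis
      using top_level_power[of y e y' i "int p"] that unfolding y by (auto simp: u)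
  qed
  ultimately have "f p * y' ^ p = 0" by (simp add: sum.delta)
  moreover have "r * y' ^ k = 0 \<Longrightarrow> r = 0" if "r \<in> gsub E" for r k
    using that
  proof (induction k arbitrary: r)
    case (Suc k)
    then have "(r * y') * y' ^ k = 0" by (simp add: mult.assoc)
    then have "r * y' = 0" using Suc.IH[of "r * y'"] Suc.prems Y gsub.mult by blast
    then show ?case using regular Suc.prems by blast
  qed simp
  ultimately show "f p = 0" using fE by blast
qed

text \<open>Normal ordering of the powers of \<open>y k\<^sup>e + y' \<beta>\<close> when \<open>y'\<close> and \<open>y\<close> commute up to a scalar. The
  scalars \<open>s\<close> are a version of the \<open>q\<close>-binomial coefficients, of which only the last one has to be
  known.\<close>

lemma shift_power:
  assumes yy: "y' * y = c \<cdot> (y * y')"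
  shows "\<exists>s. s i = 1 \<and> (\<forall>l. rapp ((dg y * kp e + dg y' * bt) ^ i) (single (- p) 1) (int l - p) =
       (if l \<le> i then s l \<cdot> (y ^ (i - l) * y' ^ l) else 0)) \<and>
     (\<forall>k < - p. rapp ((dg y * kp e + dg y' * bt) ^ i) (single (- p) 1) k = 0)"
proof (induction i)
  case 0
  show ?case by (rule exI[of _ "\<lambda>_. 1"]) (auto simp: single_def)
next
  case (Suc i)
  let ?h = "rapp ((dg y * kp e + dg y' * bt) ^ i) (single (- p) 1)"
  obtain s where s: "s i = 1" "\<And>l. ?h (int l - p) = (if l \<le> i then s l \<cdot> (y ^ (i - l) * y' ^ l) else 0)"
    "\<And>k. k < - p \<Longrightarrow> ?h k = 0" using Suc.IH by auto
  have pw: "y' * (y ^ a * z) = c ^ a \<cdot> (y ^ a * (y' * z))" for a z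
  proof (induction a arbitrary: z)
    case (Suc a)
    have "y' * (y ^ Suc a * z) = (y' * y) * (y ^ a * z)" by (simp add: mult.assoc)
    also have "\<dots> = c \<cdot> (y * (y' * (y ^ a * z)))" by (simp add: yy mult.assoc)
    finally show ?case by (simp add: Suc.IH mult.assoc)
  qed simp
  define t where "t l = (if l = 0 then q powi (e * - p) * s 0
     else (if l \<le> i then q powi (e * (int l - p)) * s l else 0) + c ^ (Suc i - l) * s (l - 1))" for l
  have step: "rapp ((dg y * kp e + dg y' * bt) ^ Suc i) (single (- p) 1) k =
     y * (q powi (e * k) \<cdot> ?h k) + y' * ?h (k - 1)" for k
    by simp
  show ?case
  proof (intro exI[of _ t] conjI allI impI)
    show "t (Suc i) = 1" using s(1) by (simp add: t_def)
    fix k :: int assume "k < - p"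
    then show "rapp ((dg y * kp e + dg y' * bt) ^ Suc i) (single (- p) 1) k = 0"
      unfolding step using s(3)[of k] s(3)[of "k - 1"] by simp
  next
    fix l
    show "rapp ((dg y * kp e + dg y' * bt) ^ Suc i) (single (- p) 1) (int l - p) =
       (if l \<le> Suc i then t l \<cdot> (y ^ (Suc i - l) * y' ^ l) else 0)"
    proof (cases l)
      case 0
      then show ?thesis unfolding step using s(2)[of 0] s(3)[of "- p - 1"] by (simp add: t_def)
    next
      case (Suc k)
      have eq: "int l - p - 1 = int k - p" using Suc by simp
      have h1: "?h (int l - p) = (if l \<le> i then s l \<cdot> (y ^ (i - l) * y' ^ l) else 0)"
        and h2: "?h (int k - p) = (if k \<le> i then s k \<cdot> (y ^ (i - k) * y' ^ k) else 0)"
        by (rule s(2))+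
      have "y ^ (Suc i - l) = y * y ^ (i - l)" if "l \<le> i" using that by (simp add: Suc_diff_le)
      then show ?thesis unfolding step eq h1 h2 using Suc pw
        by (auto simp: t_def scale_left_distrib mult.assoc Suc_diff_le mult_ac)
    qed
  qed
qed

text \<open>As in \<open>free_of_regular_shift\<close>, but now the coefficients may shift as well, so all
  intermediate levels contribute to level \<open>0\<close>. Collecting powers of \<open>y'\<close> gives a relation over the
  algebra generated by \<open>Y\<close> and \<open>y\<close>. Its top coefficient is \<open>f\<^sub>p\<close>, because only \<open>y\<^sup>p\<close> shifts \<open>p\<close>
  times, and the diagonal entry of \<open>\<phi>(f\<^sub>p)\<close> on level \<open>0\<close> is \<open>f\<^sub>p\<close>.\<close>

lemma free_of_free_shift:
  assumes hom: "alg_hom rsm (gsub E) \<phi>" and Y: "Y \<subseteq> gsub E" "y \<in> gsub E"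
    and low: "\<And>z. z \<in> Y \<Longrightarrow> lower_comps (gsub Y) (\<phi> z) z"
    and y: "\<phi> y = dg y * kp e + dg y' * bt" and yy: "y' * y = c \<cdot> (y * y')"
    and free: "left_free (gsub (insert y Y)) y'"
  shows "left_free (gsub Y) y"
proof (rule left_freeI)
  fix p f assume f: "\<And>i. i \<le> p \<Longrightarrow> f i \<in> gsub Y" and 0: "(\<Sum>i\<le>p::nat. f i * y ^ i) = 0"
  have fE: "f i \<in> gsub E" if "i \<le> p" for i using f[OF that] Y gsub_least by blast
  have "\<phi> (\<Sum>i\<le>p. f i * y ^ i) = (\<Sum>i\<le>p. \<phi> (f i * y ^ i))"
    by (rule hom_sum[OF hom kalgebra_rsm]) (use fE Y in \<open>auto intro: gsub.mult gsub_power\<close>)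
  then have "(\<Sum>i\<le>p. \<phi> (f i) * \<phi> y ^ i) = 0"
    by (simp add: 0 hom_zero[OF hom kalgebra_rsm] alg_homD(3)[OF hom] fE Y gsub_power hom_power[OF hom])
  then have "rapp (\<Sum>i\<le>p. \<phi> (f i) * \<phi> y ^ i) (single (- int p) 1) 0 = 0" by simp
  moreover have "rapp (\<Sum>i\<in>I. g i) h k = (\<Sum>i\<in>I. rapp (g i) h k)" for I h k and g :: "nat \<Rightarrow> (int, 'a) rop"
    by (induction I rule: infinite_finite_induct) auto
  ultimately have sum0: "(\<Sum>i\<le>p. rapp (\<phi> (f i)) (rapp (\<phi> y ^ i) (single (- int p) 1)) 0) = 0" by simp
  have "\<forall>i. \<exists>s. s i = 1 \<and> (\<forall>l. rapp ((dg y * kp e + dg y' * bt) ^ i) (single (- int p) 1) (int l - int p) =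
       (if l \<le> i then s l \<cdot> (y ^ (i - l) * y' ^ l) else 0)) \<and>
     (\<forall>k < - int p. rapp ((dg y * kp e + dg y' * bt) ^ i) (single (- int p) 1) k = 0)"
    using shift_power[OF yy, of _ e "int p"] by blast
  then obtain s where s: "\<And>i. s i i = 1"
      "\<And>i l. rapp (\<phi> y ^ i) (single (- int p) 1) (int l - int p) =
          (if l \<le> i then s i l \<cdot> (y ^ (i - l) * y' ^ l) else 0)"
      "\<And>i k. k < - int p \<Longrightarrow> rapp (\<phi> y ^ i) (single (- int p) 1) k = 0"
    unfolding y by metis
  have lcf: "lower_comps (gsub Y) (\<phi> (f i)) (f i)" if "i \<le> p" for i
    by (rule lower_comps_gsub[OF hom Y(1)]) (use low f[OF that] in auto)
  define C where "C i l = cmp (\<phi> (f i)) 0 (int l - int p)" for i l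
  have "rapp (\<phi> (f i)) (rapp (\<phi> y ^ i) (single (- int p) 1)) 0 =
      (\<Sum>l\<le>p. if l \<le> i then s i l \<cdot> (C i l * y ^ (i - l)) * y' ^ l else 0)" if "i \<le> p" for i
  proof -
    let ?h = "rapp (\<phi> y ^ i) (single (- int p) 1)"
    have supp: "?h k = 0" if k: "k \<notin> (\<lambda>l. int l - int p) ` {..p}" for k
    proof (cases "k < - int p")
      case True
      then show ?thesis by (rule s(3))
    next
      case False
      define l where "l = nat (k + int p)"
      have kl: "k = int l - int p" using False by (simp add: l_def)
      then have "\<not> l \<le> i" using k \<open>i \<le> p\<close> by auto
      then show ?thesis unfolding kl s(2) by simp
    qed
    have "rapp (\<phi> (f i)) ?h 0 = (\<Sum>k\<in>(\<lambda>l. int l - int p) ` {..p}. cmp (\<phi> (f i)) 0 k * ?h k)"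
      by (rule rapp_expand) (use supp in auto)
    also have "\<dots> = (\<Sum>l\<le>p. C i l * ?h (int l - int p))"
      by (subst sum.reindex) (auto simp: inj_on_def C_def)
    also have "\<dots> = (\<Sum>l\<le>p. if l \<le> i then s i l \<cdot> (C i l * y ^ (i - l)) * y' ^ l else 0)"
      unfolding s(2) by (intro sum.cong refl) (simp add: mult.assoc)
    finally show ?thesis .
  qed
  with sum0 have "(\<Sum>i\<le>p. \<Sum>l\<le>p. if l \<le> i then s i l \<cdot> (C i l * y ^ (i - l)) * y' ^ l else 0) = 0"
    by simp
  then have "(\<Sum>l\<le>p. \<Sum>i\<le>p. if l \<le> i then s i l \<cdot> (C i l * y ^ (i - l)) * y' ^ l else 0) = 0"
    by (subst sum.swap)
  moreover define g where "g l = (\<Sum>i\<le>p. if l \<le> i then s i l \<cdot> (C i l * y ^ (i - l)) else 0)" for l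
  have "(\<Sum>i\<le>p. if l \<le> i then s i l \<cdot> (C i l * y ^ (i - l)) * y' ^ l else 0) = g l * y' ^ l" for l
    unfolding g_def sum_distrib_right by (intro sum.cong refl) simp
  ultimately have "(\<Sum>l\<le>p. g l * y' ^ l) = 0" by simp
  moreover have "g l \<in> gsub (insert y Y)" for l
  proof -
    have "C i l \<in> gsub (insert y Y)" if "i \<le> p" for i
      using lcf[OF that] gsub_mono[of Y "insert y Y"]
      unfolding lower_comps_def C_def by blast
    then show ?thesis unfolding g_def
      by (intro gsub_sum) (auto intro: gsub.scale gsub.mult gsub_power gsub.gen gsub_zero)
  qed
  ultimately have "g p = 0" using left_freeD[OF free, of p g p] by blast
  moreover have "g p = (\<Sum>i\<le>p. if i = p then f p else 0)"
    unfolding g_def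
  proof (intro sum.cong refl)
    fix i assume i: "i \<in> {..p}"
    show "(if p \<le> i then s i p \<cdot> (C i p * y ^ (i - p)) else 0) = (if i = p then f p else 0)"
      using i s(1)[of p] lcf[of p] by (auto simp: C_def lower_comps_def)
  qed
  ultimately show "f p = 0" by simp
qed

end

context universal_qmat
begin

interpretation M: qalgebra "rsm :: 'k \<Rightarrow> (int, 'a) rop \<Rightarrow> (int, 'a) rop" q
  by (intro qalgebra.intro kalgebra_rsm qalgebra_axioms.intro q_nonzero)

text \<open>The entries preceding \<open>(i, j)\<close> in row-major order.\<close>

definition before :: "nat \<Rightarrow> nat \<Rightarrow> 'a set" where
  "before i j = {x k l | k l. k < i \<or> k = i \<and> l < j}"

text \<open>For the last column the shift is a translation: rows below \<open>i\<close> are removed, \<open>x\<^sub>i\<^sub>n\<close> becomes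
  \<open>x\<^sub>i\<^sub>n k\<^sup>2 + \<beta>\<close>, and the other entries of row \<open>i\<close> and of column \<open>n\<close> are multiplied by \<open>k\<close>. In the
  remaining part \<open>x\<^sub>i\<^sub>n\<close> is in the lower right corner, where the diagonal relations contain it only
  inside the commutator. So \<open>y' = 1\<close>.\<close>

lemma corner_free:
  assumes "1 \<le> i" "i \<le> m" "1 \<le> n"
  shows "left_free (gsub (before i n)) (x i n)"
proof -
  \<comment> \<open>the exponent of \<open>k\<close> in the image of an entry: one for row \<open>i\<close>, one for column \<open>n\<close>\<close>
  define w where "w k l = (if k = i then 1 else 0) + (if l = n then 1 else 0 :: int)" for k l
  define y where "y k l = (if k \<le> i then dg (x k l) * kp (w k l) + (if k = i \<and> l = n then bt else 0) else 0)" for k l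
  have big: "x k l = 0" if "l > n" for k l using that x_outside by auto
  have dk: "dg a * kp u * (dg b * kp v) = dg (a * b) * kp (u + v)" for a b u v
  proof -
    have "dg a * kp u * (dg b * kp v) = dg a * (kp u * dg b) * kp v" by (simp add: mult.assoc)
    then show ?thesis by (simp add: kp_dg mult.assoc kp_mult dgf_mult[symmetric])
  qed
  have bd: "bt * (dg a * kp v) = rsm (q powi (- v)) (dg a * kp v * bt)" for a v
    by (simp add: mult.assoc[symmetric] bt_dg) (simp add: mult.assoc bt_kp)
  have "M.qmat q y"
    unfolding M.qmat_def
  proof (intro conjI allI impI; (elim conjE)?)
    fix k j l :: nat assume "j < l"
    then show "y k j * y k l = rsm q (y k l * y k j)"
      using qmat_row[OF qmat_x, of j l k] big[of l k] big[of j k]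
      by (auto simp: y_def dk distrib_left distrib_right bd w_def dg_scale add.commute power_int_minus
          M.scale_right_distrib q_nonzero)
  next
    fix k l j :: nat assume "k < l"
    then show "y k j * y l j = rsm q (y l j * y k j)"
      using qmat_col[OF qmat_x, of k l j] 
      by (auto simp: y_def dk distrib_left distrib_right bd w_def dg_scale add.commute power_int_minus
          M.scale_right_distrib q_nonzero)
  next
    fix k l j r :: nat assume "k < l" "j < r"
    then show "y k r * y l j = y l j * y k r"
      using qmat_anti[OF qmat_x, of k l j r] big[of r]
      by (auto simp: y_def dk w_def add.commute)
  next
    fix k l j r :: nat assume kl: "k < l" "j < r"
    have F: "dg (x k j * x l r) = dg (x l r * x k j) + rsm (q - inverse q) (dg (x k r * x l j))"
      using qmat_diag[OF qmat_x kl] by (simp add: dg_scale[symmetric] dgf_add)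
    show "y k j * y l r = y l r * y k j + rsm (q - inverse q) (y k r * y l j)"
    proof (cases "l \<le> i \<and> r \<le> n")
      case True
      then have "k < i" "j < n" using kl by auto
      then have ykj: "y k j = dg (x k j) * kp 0" by (simp add: y_def w_def)
      have "y k r = dg (x k r) * kp (w k r)" "y l j = dg (x l j) * kp (w l j)"
        "y l r = dg (x l r) * kp (w l r) + (if l = i \<and> r = n then bt else 0)"
        using True \<open>k < i\<close> \<open>j < n\<close> by (auto simp: y_def)
      moreover have "w k r + w l j = w l r" using \<open>k < i\<close> \<open>j < n\<close> by (simp add: w_def)
      moreover have "bt * (dg (x k j) * kp 0) = dg (x k j) * kp 0 * bt" using bd[of "x k j" 0] by simp
      ultimately show ?thesis unfolding ykj
        by (simp add: distrib_left distrib_right dk F del: kp_0)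
    next
      case False
      then have "y l r = 0" "y k r = 0 \<or> y l j = 0"
        using big[of r] by (auto simp: y_def)
      then show ?thesis by auto
    qed
  qed
  moreover have "y k l = 0" if "k \<notin> {1..m} \<or> l \<notin> {1..n}" for k l
    using that assms x_outside[of k l] by (auto simp: y_def)
  ultimately obtain \<phi> where \<phi>: "alg_hom rsm G \<phi>" "\<And>k l. \<phi> (x k l) = y k l"
    using hom_rop by blast
  show ?thesis
  proof (rule free_of_regular_shift[OF \<phi>(1)])
    show "before i n \<subseteq> G" "x i n \<in> G" "1 \<in> G" by (auto simp: before_def x_in_G intro: gsub.one)
    show "\<phi> (x i n) = dg (x i n) * kp 2 + dg 1 * bt" by (simp add: \<phi> y_def w_def)
    fix z assume "z \<in> before i n"
    then obtain k l where z: "z = x k l" "k < i \<or> k = i \<and> l < n" by (auto simp: before_def)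
    then show "diag_comps (\<phi> z) z"
      unfolding diag_comps_def \<phi> z(1)
      by (intro exI[of _ "\<lambda>a. x k l * (q powi (w k l * a) \<cdot> 1)"]) (auto simp: y_def kp_def dgf_mult)
  qed simp
qed

text \<open>Downward induction on the column. The shear that adds column \<open>j + 1\<close> to column \<open>j\<close> maps
  \<open>x\<^sub>i\<^sub>j\<close> to \<open>x\<^sub>i\<^sub>j k + x\<^sub>i\<^sub>,\<^sub>j\<^sub>+\<^sub>1 \<beta>\<close>.\<close>

lemma entry_free:
  assumes "1 \<le> i" "i \<le> m" "1 \<le> j" "j \<le> n"
  shows "left_free (gsub (before i j)) (x i j)"
  using assms(4,3)
proof (induction rule: inc_induct)
  case base
  show ?case using corner_free assms by simp
next
  case (step j)
  obtain \<phi> where \<phi>: "alg_hom rsm G \<phi>" "\<And>i l. \<phi> (x i l) = shear (Suc j) j x i l"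
    using shear_hom[of "Suc j" j] step by auto
  show ?case
  proof (rule free_of_free_shift[OF \<phi>(1)])
    show "before i j \<subseteq> G" "x i j \<in> G" by (auto simp: before_def x_in_G)
    show "\<phi> (x i j) = dg (x i j) * kp 1 + dg (x i (Suc j)) * bt" by (simp add: \<phi> shear_def)
    show "x i (Suc j) * x i j = inverse q \<cdot> (x i j * x i (Suc j))"
      using qmat_row[OF qmat_x, of j "Suc j" i] q_nonzero by simp
    have "insert (x i j) (before i j) = before i (Suc j)" by (auto simp: before_def less_Suc_eq)
    then show "left_free (gsub (insert (x i j) (before i j))) (x i (Suc j))"
      using step by simp
    fix z assume "z \<in> before i j"
    then obtain k l where z: "z = x k l" "k < i \<or> k = i \<and> l < j" by (auto simp: before_def)
    have S: "x k l \<in> gsub (before i j)" if "k < i \<or> k = i \<and> l < j" for k l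
      using that by (auto simp: before_def intro!: gsub.gen)
    have "\<exists>e b. \<phi> z = dg z * kp e + dg b * bt \<and> b \<in> gsub (before i j)"
    proof -
      consider "l = j" | "l = Suc j" | "l \<noteq> j" "l \<noteq> Suc j" by blast
      then show ?thesis
      proof cases
        case 1
        then show ?thesis using z S[of k "Suc j"]
          by (intro exI[of _ 1] exI[of _ "x k (Suc j)"]) (auto simp: \<phi> shear_def)
      next
        case 2
        then show ?thesis using z
          by (intro exI[of _ "-1"] exI[of _ 0]) (auto simp: \<phi> shear_def gsub_zero)
      next
        case 3
        then show ?thesis using z
          by (intro exI[of _ 0] exI[of _ 0]) (auto simp: \<phi> shear_def gsub_zero)
      qed
    qed
    then show "lower_comps (gsub (before i j)) (\<phi> z) z"
      using lower_comps_shift[of z "gsub (before i j)"] S[OF z(2)] z(1) gsub_zero gsub.scale by metis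
  qed
qed

end

section \<open>Towers of Ore extensions inside an algebra\<close>

context kalgebra
begin

text \<open>Only generators \<open>g\<close> are tested, and the twist multiplies each of them by a scalar. This
  makes it possible to verify the condition by explicit commutation relations.\<close>

definition skew_over :: "'a set \<Rightarrow> 'a \<Rightarrow> bool" where
  "skew_over X y \<longleftrightarrow> (\<forall>g\<in>X. \<exists>c d. c \<noteq> 0 \<and> d \<in> gsub X \<and> y * g = c \<cdot> (g * y) + d)"

inductive tower :: "'a list \<Rightarrow> bool" where
  Nil: "tower []"
| Cons: "tower gs \<Longrightarrow> skew_over (set gs) y \<Longrightarrow> left_free (gsub (set gs)) y \<Longrightarrow> tower (y # gs)"

end

text \<open>One step of a tower: from the relations on generators the twist and the skew derivation are
  constructed on all of \<open>R\<close>.\<close>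

locale ore_step = kalgebra sm
  for sm :: "'k::field \<Rightarrow> 'a::ring_1 \<Rightarrow> 'a" (infixr \<open>\<cdot>\<close> 75) +
  fixes X :: "'a set" and y :: 'a
  assumes skew: "skew_over X y" and free: "left_free (gsub X) y"
begin

abbreviation R where "R \<equiv> gsub X"

text \<open>The elements \<open>a\<close> admitting \<open>y a = a' y + d\<close> form a subalgebra.\<close>

lemma skew_normal: "a \<in> R \<Longrightarrow> \<exists>a'\<in>R. y * a - a' * y \<in> R"
proof (induction rule: gsub.induct)
  case (gen g)
  then obtain c d where "d \<in> R" "y * g = c \<cdot> (g * y) + d" using skew unfolding skew_over_def by blast
  then show ?case using gsub.gen[OF gen] by (intro bexI[of _ "c \<cdot> g"]) (auto intro: gsub.scale)
next
  case one
  show ?case by (intro bexI[of _ 1]) (auto intro: gsub.one gsub_zero)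
next
  case (add a b)
  then obtain a' b' where "a' \<in> R" "y * a - a' * y \<in> R" "b' \<in> R" "y * b - b' * y \<in> R" by auto
  then show ?case using gsub.add[of "y * a - a' * y" X "y * b - b' * y"]
    by (intro bexI[of _ "a' + b'"]) (auto intro: gsub.add simp: algebra_simps)
next
  case (scale a c)
  then obtain a' where "a' \<in> R" "y * a - a' * y \<in> R" by auto
  then show ?case using gsub.scale[of "y * a - a' * y" X c]
    by (intro bexI[of _ "c \<cdot> a'"]) (auto intro: gsub.scale simp: scale_right_diff_distrib)
next
  case (mult a b)
  then obtain a' b' where *: "a' \<in> R" "y * a - a' * y \<in> R" "b' \<in> R" "y * b - b' * y \<in> R" by auto
  have "y * (a * b) - (a' * b') * y = (y * a - a' * y) * b + a' * (y * b - b' * y)"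
    by (simp add: algebra_simps)
  also have "\<dots> \<in> R" using * mult by (intro gsub.add gsub.mult)
  finally show ?case using * by (intro bexI[of _ "a' * b'"]) (auto intro: gsub.mult)
qed

lemma unique2:
  assumes "a \<in> R" "b \<in> R" "a * y = b" shows "a = 0"
proof -
  have "(\<Sum>i\<le>Suc 0. (if i = 0 then - b else a) * y ^ i) = 0" using assms by simp
  from left_freeD[OF free _ this, of 1] show ?thesis using assms gsub_minus by auto
qed

text \<open>The choice is unique because \<open>1\<close> and \<open>y\<close> are left independent over \<open>R\<close>. Uniqueness also
  yields that \<open>sg\<close> is a homomorphism.\<close>

definition sg :: "'a \<Rightarrow> 'a" where
  "sg a = (SOME a'. a' \<in> R \<and> y * a - a' * y \<in> R)"

definition dl :: "'a \<Rightarrow> 'a" where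
  "dl a = y * a - sg a * y"

lemma sg_in: "a \<in> R \<Longrightarrow> sg a \<in> R" and dl_in: "a \<in> R \<Longrightarrow> dl a \<in> R"
  using someI_ex[OF bexE[OF skew_normal[of a], THEN exI]] 
  unfolding sg_def dl_def
  by (metis (mono_tags, lifting) skew_normal someI_ex)+

lemma y_mult: "y * a = sg a * y + dl a"
  by (simp add: dl_def)

lemma sg_unique:
  assumes "a \<in> R" "a' \<in> R" "y * a - a' * y \<in> R" shows "sg a = a'"
proof -
  have "(a' - sg a) * y = dl a - (y * a - a' * y)" by (simp add: dl_def algebra_simps)
  moreover have "dl a - (y * a - a' * y) \<in> R" "a' - sg a \<in> R"
    using assms sg_in dl_in by (auto intro: gsub_diff)
  ultimately have "a' - sg a = 0" using unique2 by blast
  then show ?thesis by simp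
qed

lemma sg_one: "sg 1 = 1"
  by (rule sg_unique) (auto intro: gsub.one gsub_zero)

lemma sg_add:
  assumes "a \<in> R" "b \<in> R" shows "sg (a + b) = sg a + sg b"
proof (rule sg_unique)
  have "y * (a + b) - (sg a + sg b) * y = dl a + dl b" by (simp add: dl_def algebra_simps)
  then show "y * (a + b) - (sg a + sg b) * y \<in> R" using assms by (simp add: gsub.add dl_in)
qed (use assms in \<open>auto intro: gsub.add sg_in\<close>)

lemma sg_scale:
  assumes "a \<in> R" shows "sg (c \<cdot> a) = c \<cdot> sg a"
proof (rule sg_unique)
  have "y * (c \<cdot> a) - (c \<cdot> sg a) * y = c \<cdot> dl a" by (simp add: dl_def scale_right_diff_distrib)
  then show "y * (c \<cdot> a) - (c \<cdot> sg a) * y \<in> R" using assms by (simp add: gsub.scale dl_in del: sm_mult_left sm_mult_right)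
qed (use assms in \<open>auto intro: gsub.scale sg_in\<close>)

lemma sg_mult:
  assumes "a \<in> R" "b \<in> R" shows "sg (a * b) = sg a * sg b"
proof (rule sg_unique)
  have "y * (a * b) - sg a * sg b * y = dl a * b + sg a * dl b"
    by (simp add: dl_def algebra_simps)
  also have "\<dots> \<in> R" using assms by (intro gsub.add gsub.mult sg_in dl_in)
  finally show "y * (a * b) - sg a * sg b * y \<in> R" .
qed (use assms in \<open>auto intro: gsub.mult sg_in\<close>)

lemma sg_gen: "g \<in> X \<Longrightarrow> \<exists>c. c \<noteq> 0 \<and> sg g = c \<cdot> g"
proof -
  assume g: "g \<in> X"
  then obtain c d where "c \<noteq> 0" "d \<in> R" "y * g = c \<cdot> (g * y) + d" using skew by (auto simp: skew_over_def)
  then show ?thesis using gsub.gen[OF g]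
    by (intro exI[of _ c] conjI sg_unique) (auto intro: gsub.scale)
qed

lemma sg_hom: "alg_hom sm R sg"
  by (simp add: alg_hom_def sg_one sg_add sg_mult sg_scale)

lemma sg_surj: "a \<in> R \<Longrightarrow> \<exists>b\<in>R. sg b = a"
proof (induction rule: gsub.induct)
  case (gen g)
  then obtain c where "c \<noteq> 0" "sg g = c \<cdot> g" using sg_gen by blast
  then show ?case using gsub.gen[OF gen]
    by (intro bexI[of _ "inverse c \<cdot> g"]) (auto simp: sg_scale intro: gsub.scale)
qed (metis gsub.intros sg_one sg_add sg_mult sg_scale)+

lemma sg_pow_in: "a \<in> R \<Longrightarrow> (sg ^^ i) a \<in> R"
  by (induction i) (auto intro: sg_in)

subsection \<open>Leading terms\<close>

text \<open>The left \<open>R\<close>-module spanned by the powers of \<open>y\<close> below the \<open>k\<close>-th, a filtration by degree.\<close>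

inductive_set low :: "nat \<Rightarrow> 'a set" for k where
  zero: "0 \<in> low k"
| "term": "r \<in> R \<Longrightarrow> i < k \<Longrightarrow> r * y ^ i \<in> low k"
| add: "u \<in> low k \<Longrightarrow> v \<in> low k \<Longrightarrow> u + v \<in> low k"

lemma low_mono: "u \<in> low k \<Longrightarrow> k \<le> l \<Longrightarrow> u \<in> low l"
  by (induction rule: low.induct) (auto intro: low.intros)

lemma low_left: "u \<in> low k \<Longrightarrow> r \<in> R \<Longrightarrow> r * u \<in> low k"
  by (induction rule: low.induct)
     (auto simp: distrib_left mult.assoc[symmetric] intro: low.intros gsub.mult)

lemma low_scale: "u \<in> low k \<Longrightarrow> c \<cdot> u \<in> low k"
  using low_left[of u k "c \<cdot> 1"] by (auto intro: gsub.intros)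

lemma low_minus: "u \<in> low k \<Longrightarrow> - u \<in> low k"
  using low_scale[of u k "-1"] by simp

lemma low_y: "u \<in> low k \<Longrightarrow> y * u \<in> low (Suc k)"
proof (induction rule: low.induct)
  case ("term" r i)
  have "y * (r * y ^ i) = sg r * y ^ Suc i + dl r * y ^ i"
    by (simp add: mult.assoc[symmetric] y_mult[of r] distrib_right)
  then show ?case using "term" by (auto intro!: low.add low.term sg_in dl_in simp del: power_Suc)
qed (auto simp: distrib_left intro: low.intros)

lemma low_y_right: "u \<in> low k \<Longrightarrow> u * y ^ j \<in> low (k + j)"
  by (induction rule: low.induct)
     (auto simp: distrib_right mult.assoc power_add[symmetric] intro: low.intros)

lemma low_ypow: "u \<in> low k \<Longrightarrow> y ^ j * u \<in> low (k + j)"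
  by (induction j) (auto simp: mult.assoc dest: low_y)

lemma pow_skew: "r \<in> R \<Longrightarrow> y ^ i * r - (sg ^^ i) r * y ^ i \<in> low i"
proof (induction i)
  case 0
  then show ?case by (simp add: low.zero)
next
  case (Suc i)
  let ?s = "(sg ^^ i) r"
  have "y ^ Suc i * r - (sg ^^ Suc i) r * y ^ Suc i = y * (y ^ i * r - ?s * y ^ i) + dl ?s * y ^ i"
    by (simp add: dl_def algebra_simps)
  also have "\<dots> \<in> low (Suc i)"
    using Suc by (intro low.add low_y low.term dl_in sg_pow_in) auto
  finally show ?case .
qed

lemma low_mult:
  assumes "u \<in> low p" "v \<in> low (Suc t)" shows "u * v \<in> low (p + t)"
  using assms(1)
proof induction
  case ("term" r i)
  have "y ^ i * v \<in> low (Suc t + i)" by (rule low_ypow[OF assms(2)])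
  then have "r * (y ^ i * v) \<in> low (Suc t + i)" using "term" low_left by blast
  then show ?case using "term" by (auto simp: mult.assoc intro: low_mono)
qed (auto simp: distrib_right intro: low.intros)

lemma gsub_insert_low:
  assumes "a \<in> gsub (insert y X)" shows "\<exists>k. a \<in> low k"
proof -
  have "\<forall>u. (\<exists>k. u \<in> low k) \<longrightarrow> (\<exists>k. a * u \<in> low k)"
    using assms
  proof induction
    case (gen g)
    then show ?case using low_y low_left gsub.gen by blast
  next
    case (add a b)
    show ?case
    proof (intro allI impI)
      fix u assume "\<exists>k. u \<in> low k"
      then obtain k l where "a * u \<in> low k" "b * u \<in> low l" using add by blast
      then have "a * u \<in> low (max k l)" "b * u \<in> low (max k l)" by (auto intro: low_mono)
      then show "\<exists>k. (a + b) * u \<in> low k" by (auto simp: distrib_right intro: low.add)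
    qed
  next
    case (scale a c)
    then show ?case using low_scale by (metis sm_mult_left)
  qed (auto simp: mult.assoc)
  moreover have "1 \<in> low 1" using low.term[of 1 0 1] by (simp add: gsub.one)
  ultimately show ?thesis using mult_1_right by metis
qed

lemma low_sum: "u \<in> low k \<Longrightarrow> \<exists>f. (\<forall>i. f i \<in> R) \<and> u = (\<Sum>i<k. f i * y ^ i)"
proof (induction rule: low.induct)
  case zero
  show ?case by (rule exI[of _ "\<lambda>_. 0"]) (auto intro: gsub_zero)
next
  case ("term" r i)
  have "(\<Sum>j<k. (if j = i then r else 0) * y ^ j) = (\<Sum>j<k. if j = i then r * y ^ i else 0)"
    by (intro sum.cong) auto
  then show ?case using "term" by (intro exI[of _ "\<lambda>j. if j = i then r else 0"]) (auto intro: gsub_zero)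
next
  case (add u v)
  then obtain f g where "\<forall>i. f i \<in> R" "u = (\<Sum>i<k. f i * y ^ i)" "\<forall>i. g i \<in> R" "v = (\<Sum>i<k. g i * y ^ i)"
    by blast
  then show ?case
    by (intro exI[of _ "\<lambda>i. f i + g i"]) (auto simp: distrib_right sum.distrib intro: gsub.add)
qed

lemma leading_term:
  assumes "u \<in> low k" "u \<noteq> 0"
  shows "\<exists>p r. r \<in> R \<and> r \<noteq> 0 \<and> u - r * y ^ p \<in> low p"
proof -
  obtain f where f: "\<And>i. f i \<in> R" "u = (\<Sum>i<k. f i * y ^ i)" using low_sum[OF assms(1)] by blast
  have "(\<Sum>i<k. f i * y ^ i) \<noteq> 0 \<Longrightarrow> \<exists>p. f p \<noteq> 0 \<and> (\<Sum>i<k. f i * y ^ i) - f p * y ^ p \<in> low p" for k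
  proof (induction k)
    case (Suc k)
    show ?case
    proof (cases "f k = 0")
      case True
      then show ?thesis using Suc by simp
    next
      case False
      have "(\<Sum>i<l. f i * y ^ i) \<in> low k" if "l \<le> k" for l
        using that by (induction l) (auto intro!: low.add low.term low.zero f(1))
      then show ?thesis using False by (intro exI[of _ k]) simp
    qed
  qed simp
  then show ?thesis using assms(2) f by blast
qed

lemma low_top:
  assumes "r \<in> R" "r * y ^ p \<in> low p" shows "r = 0"
proof -
  obtain f where f: "\<And>i. f i \<in> R" "r * y ^ p = (\<Sum>i<p. f i * y ^ i)" using low_sum[OF assms(2)] by blast
  have "(\<Sum>i\<le>p. (if i = p then - r else f i) * y ^ i) = 0"
    using f(2) by (simp add: lessThan_Suc_atMost[symmetric])
  from left_freeD[OF free _ this, of p] show ?thesis using f(1) assms(1) gsub_minus by auto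
qed

text \<open>The leading coefficient of a product of polynomials in \<open>y\<close> with leading terms \<open>r y\<^sup>p\<close> and
  \<open>s y\<^sup>t\<close> is \<open>r \<sigma>\<^sup>p(s)\<close>, which is nonzero.\<close>

lemma domain_step:
  assumes dom: "\<And>a b. a \<in> R \<Longrightarrow> b \<in> R \<Longrightarrow> a * b = 0 \<Longrightarrow> a = 0 \<or> b = 0"
    and inj: "\<And>a. a \<in> R \<Longrightarrow> sg a = 0 \<Longrightarrow> a = 0"
    and ab: "a \<in> gsub (insert y X)" "b \<in> gsub (insert y X)" "a * b = 0"
  shows "a = 0 \<or> b = 0"
proof (rule ccontr)
  assume "\<not> (a = 0 \<or> b = 0)"
  then obtain p r t s where r: "r \<in> R" "r \<noteq> 0" "a - r * y ^ p \<in> low p"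
    and s: "s \<in> R" "s \<noteq> 0" "b - s * y ^ t \<in> low t"
    using leading_term gsub_insert_low ab by metis
  define u v where "u = a - r * y ^ p" and "v = b - s * y ^ t"
  have uv: "u \<in> low p" "v \<in> low t" using r s by (auto simp: u_def v_def)
  have "b = s * y ^ t + v" by (simp add: v_def)
  moreover have "v \<in> low (Suc t)" using uv(2) by (rule low_mono) simp
  ultimately have bl: "b \<in> low (Suc t)" using s by (simp add: low.add low.term)
  define e where "e = y ^ p * s - (sg ^^ p) s * y ^ p"
  have e: "e \<in> low p" using pow_skew s by (simp add: e_def)
  have "a * b = u * b + r * (y ^ p * v) + r * (e * y ^ t) + r * (sg ^^ p) s * y ^ (p + t)"
    by (simp add: u_def v_def e_def algebra_simps power_add)
  moreover have "u * b + r * (y ^ p * v) + r * (e * y ^ t) \<in> low (p + t)"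
    using low_mult[OF uv(1) bl] low_left[OF low_ypow[OF uv(2)] r(1), of p] low_left[OF low_y_right[OF e] r(1), of t]
    by (auto intro: low.add simp: add.commute)
  ultimately have "r * (sg ^^ p) s * y ^ (p + t) \<in> low (p + t)"
    using low_minus ab(3) by (metis eq_neg_iff_add_eq_0 add.commute)
  then have "r * (sg ^^ p) s = 0" by (intro low_top) (use r s sg_pow_in in \<open>auto intro: gsub.mult\<close>)
  then have "(sg ^^ p) s = 0" using dom r s sg_pow_in by blast
  moreover have "(sg ^^ i) s \<noteq> 0" for i
    by (induction i) (use s inj sg_pow_in in auto)
  ultimately show False by blast
qed

end

context kalgebra
begin

lemma gsub_empty: "a \<in> gsub {} \<Longrightarrow> \<exists>c. a = c \<cdot> 1"
proof (induction rule: gsub.induct)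
  case one
  show ?case by (rule exI[of _ 1]) simp
qed (auto simp: scale_left_distrib[symmetric])

text \<open>An endomorphism that scales all generators by nonzero scalars multiplies the \<open>i\<close>-th
  coefficient in the normal form over \<open>y\<close> by \<open>c\<^sup>i\<close>, after acting on it; injectivity passes up the
  tower. This is applied to the twists.\<close>

lemma tower_hom_inj:
  assumes "tower gs"
  shows "alg_hom sm (gsub (set gs)) \<tau> \<Longrightarrow> (\<And>g. g \<in> set gs \<Longrightarrow> \<exists>c. c \<noteq> 0 \<and> \<tau> g = c \<cdot> g) \<Longrightarrow>
     a \<in> gsub (set gs) \<Longrightarrow> \<tau> a = 0 \<Longrightarrow> a = 0"
  using assms
proof (induction arbitrary: a rule: tower.induct)
  case Nil
  then obtain c where "a = c \<cdot> 1" using gsub_empty by auto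
  then show ?case using Nil alg_homD(1,4)[OF Nil(1)] by (auto simp: gsub.one)
next
  case (Cons gs y)
  interpret ore_step sm "set gs" y by unfold_locales (use Cons in auto)
  have sub: "R \<subseteq> gsub (insert y (set gs))" by (rule gsub_mono) auto
  have \<tau>: "alg_hom sm (gsub (insert y (set gs))) \<tau>" using Cons.prems by simp
  then have \<tau>R: "alg_hom sm R \<tau>" using sub unfolding alg_hom_def by blast
  have \<tau>_in: "\<tau> r \<in> R" if "r \<in> R" for r
    using that
  proof induction
    case (gen g)
    then show ?case using Cons.prems(2)[of g] gsub.gen[OF gen] by (auto intro: gsub.scale)
  qed (auto simp: alg_homD[OF \<tau>R] intro: gsub.intros)
  obtain c where c: "c \<noteq> 0" "\<tau> y = c \<cdot> y" using Cons.prems(2)[of y] by auto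
  obtain k where "a \<in> low k" using gsub_insert_low Cons.prems by auto
  then obtain f where f: "\<And>i. f i \<in> R" "a = (\<Sum>i<k. f i * y ^ i)" using low_sum by blast
  have fE: "f i \<in> gsub (insert y (set gs))" for i using f sub by blast
  have yE: "y \<in> gsub (insert y (set gs))" by (rule gsub.gen) simp
  have cy: "(c \<cdot> y) ^ i = c ^ i \<cdot> y ^ i" for i by (induction i) auto
  have "\<tau> a = (\<Sum>i<k. \<tau> (f i * y ^ i))"
    unfolding f(2) by (rule hom_sum[OF \<tau> kalgebra_axioms]) (intro gsub.mult gsub_power fE yE)
  also have "\<dots> = (\<Sum>i<k. (c ^ i \<cdot> \<tau> (f i)) * y ^ i)"
    by (intro sum.cong refl) (simp add: alg_homD[OF \<tau>] hom_power[OF \<tau>] fE yE gsub_power c cy)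
  finally have 0: "(\<Sum>i<k. (c ^ i \<cdot> \<tau> (f i)) * y ^ i) = 0" using Cons.prems by simp
  have "f i = 0" if "i < k" for i
  proof -
    have "(\<Sum>i\<le>k - 1. (c ^ i \<cdot> \<tau> (f i)) * y ^ i) = 0"
      using 0 that by (cases k) (auto simp: lessThan_Suc_atMost)
    then have "c ^ i \<cdot> \<tau> (f i) = 0"
      by (rule left_freeD[OF free, rotated]) (use that f \<tau>_in in \<open>auto intro: gsub.scale\<close>)
    then have "\<tau> (f i) = 0" using c by simp
    then show ?thesis using Cons.IH[OF \<tau>R _ f(1)] Cons.prems(2) by auto
  qed
  then show ?case using f(2) by simp
qed

lemma tower_domain:
  assumes "tower gs"
  shows "a \<in> gsub (set gs) \<Longrightarrow> b \<in> gsub (set gs) \<Longrightarrow> a * b = 0 \<Longrightarrow> a = 0 \<or> b = 0"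
  using assms
proof (induction arbitrary: a b rule: tower.induct)
  case Nil
  then obtain c d where "a = c \<cdot> 1" "b = d \<cdot> 1" using gsub_empty by (metis empty_set)
  then show ?case using Nil by auto
next
  case (Cons gs y)
  interpret ore_step sm "set gs" y by unfold_locales (use Cons in auto)
  show ?case
    by (rule domain_step) (use Cons tower_hom_inj[OF Cons(1) sg_hom sg_gen] in auto)
qed

text \<open>The passage from subsets of a ring type to the record-based algebras.\<close>

definition alg_rec :: "'a set \<Rightarrow> ('k, 'a) module" where
  "alg_rec C = \<lparr>carrier = C, monoid.mult = (*), one = 1, zero = 0, add = (+), smult = sm\<rparr>"

lemma alg_rec_simps [simp]:
  "carrier (alg_rec C) = C" "x \<otimes>\<^bsub>alg_rec C\<^esub> z = x * z" "\<one>\<^bsub>alg_rec C\<^esub> = 1" "\<zero>\<^bsub>alg_rec C\<^esub> = 0"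
  "x \<oplus>\<^bsub>alg_rec C\<^esub> z = x + z" "c \<odot>\<^bsub>alg_rec C\<^esub> x = c \<cdot> x" "alg_rec C\<lparr>carrier := D\<rparr> = alg_rec D"
  by (simp_all add: alg_rec_def)

lemma assoc_algebra_alg_rec: "assoc_algebra (alg_rec (gsub X))"
proof -
  have "ring (alg_rec (gsub X))"
  proof (rule ringI)
    show "abelian_group (alg_rec (gsub X))"
    proof (rule abelian_groupI)
      fix a assume "a \<in> carrier (alg_rec (gsub X))"
      then show "\<exists>b\<in>carrier (alg_rec (gsub X)). b \<oplus>\<^bsub>alg_rec (gsub X)\<^esub> a = \<zero>\<^bsub>alg_rec (gsub X)\<^esub>"
        by (intro bexI[of _ "- a"]) (auto intro: gsub_minus)
    qed (auto intro: gsub.add gsub_zero simp: add_ac)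
    show "monoid (alg_rec (gsub X))"
      by (rule monoidI) (auto intro: gsub.mult gsub.one simp: mult.assoc)
  qed (auto simp: algebra_simps)
  then show ?thesis
    by (intro assoc_algebra.intro assoc_algebra_axioms.intro)
       (auto intro: gsub.scale simp: scale_left_distrib scale_right_distrib)
qed

lemma alg_rec_pow: "x [^]\<^bsub>alg_rec C\<^esub> (i::nat) = x ^ i"
  by (induction i) (auto simp: nat_pow_def power_commutes)

lemma alg_rec_finsum:
  assumes "finite I" "\<And>i. i \<in> I \<Longrightarrow> f i \<in> gsub X"
  shows "(\<Oplus>\<^bsub>alg_rec (gsub X)\<^esub>i\<in>I. f i) = (\<Sum>i\<in>I. f i)"
proof -
  interpret A: assoc_algebra "alg_rec (gsub X)" by (rule assoc_algebra_alg_rec)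
  show ?thesis using assms
  proof (induction rule: finite_induct)
    case (insert i I)
    then show ?case by (subst A.finsum_insert) auto
  qed simp
qed

lemma alg_rec_minus:
  assumes "a \<in> gsub X" shows "\<ominus>\<^bsub>alg_rec (gsub X)\<^esub> a = - a"
proof -
  interpret A: assoc_algebra "alg_rec (gsub X)" by (rule assoc_algebra_alg_rec)
  show ?thesis by (rule A.minus_equality) (use assms in \<open>auto intro: gsub_minus\<close>)
qed

lemma tower_iterated_ore: "tower gs \<Longrightarrow> iterated_ore_extension (alg_rec (gsub (set gs)))"
proof (induction rule: tower.induct)
  case Nil
  have "bij_betw (\<lambda>c. c \<cdot> 1) UNIV (gsub {})"
    by (rule bij_betwI') (use gsub_empty in \<open>auto intro: gsub.scale gsub.one\<close>)
  then show ?case by (intro iterated_ore_extension.base assoc_algebra_alg_rec) simp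
next
  case (Cons gs y)
  interpret ore_step sm "set gs" y by unfold_locales (use Cons in auto)
  let ?S = "alg_rec (gsub (set (y # gs)))"
  interpret A: assoc_algebra ?S by (rule assoc_algebra_alg_rec)
  have sub: "R \<subseteq> gsub (insert y (set gs))" by (rule gsub_mono) auto
  have yS: "y \<in> gsub (insert y (set gs))" by (rule gsub.gen) simp
  have inj: "a = 0" if "a \<in> R" "sg a = 0" for a
    using tower_hom_inj[OF Cons(1) sg_hom sg_gen] that by blast
  show ?case
  proof (rule iterated_ore_extension.step)
    show "iterated_ore_extension (?S\<lparr>carrier := R\<rparr>)" using Cons.IH by simp
    show "ore_extension ?S R y sg dl"
      unfolding ore_extension_def
    proof (intro conjI)
      show "assoc_algebra ?S" by (rule assoc_algebra_alg_rec)
      show "unital_subalgebra ?S R"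
        unfolding unital_subalgebra_def
      proof (intro conjI allI ballI)
        show "subring R ?S"
        proof (rule A.subringI)
          fix h assume "h \<in> R"
          then show "\<ominus>\<^bsub>?S\<^esub> h \<in> R"
            using subsetD[OF sub, of h] alg_rec_minus[of h "set (y # gs)"] by (simp add: gsub_minus)
        qed (use sub in \<open>auto intro: gsub.intros\<close>)
      qed (auto intro: gsub.scale)
      show "y \<in> carrier ?S" using yS by simp
      show "algebra_automorphism (?S\<lparr>carrier := R\<rparr>) sg"
        unfolding algebra_automorphism_def
      proof (intro conjI)
        have "bij_betw sg R R"
        proof (rule bij_betwI')
          fix a b assume ab: "a \<in> R" "b \<in> R"
          have "sg (a - b) = sg a - sg b"
            using sg_add[of a "- b"] sg_scale[of b "-1"] ab gsub_minus[of b] by simp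
          then show "(sg a = sg b) = (a = b)" using inj[of "a - b"] ab gsub_diff by auto
        next
          fix a assume "a \<in> R" then show "sg a \<in> R" by (rule sg_in)
        next
          fix a assume "a \<in> R" then show "\<exists>b\<in>R. a = sg b" using sg_surj by metis
        qed
        then show "sg \<in> ring_iso (?S\<lparr>carrier := R\<rparr>) (?S\<lparr>carrier := R\<rparr>)"
          by (auto simp: ring_iso_def ring_hom_def sg_in sg_mult sg_add sg_one)
      qed (auto simp: sg_scale)
      show "skew_derivation (?S\<lparr>carrier := R\<rparr>) sg dl"
        unfolding skew_derivation_def
        by (intro conjI)
           (use dl_in in \<open>auto simp: sg_add sg_mult sg_scale dl_def algebra_simps scale_right_diff_distrib\<close>)
      show "\<forall>a\<in>R. y \<otimes>\<^bsub>?S\<^esub> a = sg a \<otimes>\<^bsub>?S\<^esub> y \<oplus>\<^bsub>?S\<^esub> dl a" by (simp add: dl_def)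
      let ?F = "{f :: nat \<Rightarrow> 'a. (\<forall>i. f i \<in> R) \<and> finite {i. f i \<noteq> 0}}"
      have sum: "(\<Oplus>\<^bsub>?S\<^esub>i\<in>{i. f i \<noteq> 0}. f i * y ^ i) = (\<Sum>i\<le>p. f i * y ^ i)"
        if "f \<in> ?F" "{i. f i \<noteq> 0} \<subseteq> {..p}" for f p
      proof -
        have "(\<Oplus>\<^bsub>?S\<^esub>i\<in>{i. f i \<noteq> 0}. f i * y ^ i) = (\<Sum>i\<in>{i. f i \<noteq> 0}. f i * y ^ i)"
          using that sub yS by (intro alg_rec_finsum) (auto intro!: gsub.mult gsub_power)
        also have "\<dots> = (\<Sum>i\<le>p. f i * y ^ i)"
          by (rule sum.mono_neutral_left) (use that in auto)
        finally show ?thesis .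
      qed
      have bound: "\<exists>p. {i. f i \<noteq> 0} \<subseteq> {..p}" if "f \<in> ?F" for f
        using that finite_nat_set_iff_bounded_le[of "{i. f i \<noteq> 0}"] by auto
      have "bij_betw (\<lambda>f. \<Oplus>\<^bsub>?S\<^esub>i\<in>{i. f i \<noteq> 0}. f i * y ^ i) ?F (gsub (insert y (set gs)))"
      proof (rule bij_betwI')
        fix f g assume fg: "f \<in> ?F" "g \<in> ?F"
        show "((\<Oplus>\<^bsub>?S\<^esub>i\<in>{i. f i \<noteq> 0}. f i * y ^ i) = (\<Oplus>\<^bsub>?S\<^esub>i\<in>{i. g i \<noteq> 0}. g i * y ^ i)) = (f = g)"
        proof
          assume eq: "(\<Oplus>\<^bsub>?S\<^esub>i\<in>{i. f i \<noteq> 0}. f i * y ^ i) = (\<Oplus>\<^bsub>?S\<^esub>i\<in>{i. g i \<noteq> 0}. g i * y ^ i)"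
          obtain p where "{i. f i \<noteq> 0} \<subseteq> {..p}" using bound[OF fg(1)] ..
          moreover obtain p' where "{i. g i \<noteq> 0} \<subseteq> {..p'}" using bound[OF fg(2)] ..
          ultimately have mx: "{i. f i \<noteq> 0} \<subseteq> {..max p p'}" "{i. g i \<noteq> 0} \<subseteq> {..max p p'}" by auto
          have "(\<Sum>i\<le>max p p'. (f i - g i) * y ^ i) = 0"
            using eq sum[OF fg(1) mx(1)] sum[OF fg(2) mx(2)] by (simp add: left_diff_distrib sum_subtractf)
          then have "f i - g i = 0" if "i \<le> max p p'" for i
            using left_freeD[OF free, of "max p p'" "\<lambda>i. f i - g i" i] fg that by (auto intro: gsub_diff)
          moreover have "f i = g i" if "\<not> i \<le> max p p'" for i
            using subsetD[OF mx(1), of i] subsetD[OF mx(2), of i] that by (metis atMost_iff mem_Collect_eq)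
          ultimately show "f = g" by (metis ext eq_iff_diff_eq_0)
        qed simp
      next
        fix f assume "f \<in> ?F"
        then obtain p where "{i. f i \<noteq> 0} \<subseteq> {..p}" using bound by iprover
        then show "(\<Oplus>\<^bsub>?S\<^esub>i\<in>{i. f i \<noteq> 0}. f i * y ^ i) \<in> gsub (insert y (set gs))"
          unfolding sum[OF \<open>f \<in> ?F\<close> \<open>{i. f i \<noteq> 0} \<subseteq> {..p}\<close>]
          using \<open>f \<in> ?F\<close> sub yS by (intro gsub_sum gsub.mult gsub_power) auto
      next
        fix a assume "a \<in> gsub (insert y (set gs))"
        then obtain k where "a \<in> low k" using gsub_insert_low by blast
        then obtain h where h: "\<forall>i. h i \<in> R" "a = (\<Sum>i<k. h i * y ^ i)" using low_sum by blast
        define f where "f i = (if i < k then h i else 0)" for i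
        have "f \<in> ?F" using h by (auto simp: f_def intro: gsub_zero)
        moreover have "{i. f i \<noteq> 0} \<subseteq> {..k}" by (auto simp: f_def split: if_splits)
        ultimately have "(\<Oplus>\<^bsub>?S\<^esub>i\<in>{i. f i \<noteq> 0}. f i * y ^ i) = (\<Sum>i\<le>k. f i * y ^ i)" by (rule sum)
        also have "\<dots> = a" unfolding h(2) lessThan_Suc_atMost[symmetric] by (simp add: f_def)
        finally show "\<exists>f\<in>?F. a = (\<Oplus>\<^bsub>?S\<^esub>i\<in>{i. f i \<noteq> 0}. f i * y ^ i)"
          by (rule bexI[OF sym \<open>f \<in> ?F\<close>])
      qed
      then show "bij_betw (\<lambda>f. \<Oplus>\<^bsub>?S\<^esub>i\<in>{i. f i \<noteq> \<zero>\<^bsub>?S\<^esub>}. f i \<otimes>\<^bsub>?S\<^esub> y [^]\<^bsub>?S\<^esub> i)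
       {f :: nat \<Rightarrow> 'a. (\<forall>i. f i \<in> R) \<and> finite {i. f i \<noteq> \<zero>\<^bsub>?S\<^esub>}} (carrier ?S)"
        by (simp add: alg_rec_pow)
    qed
  qed
qed

text \<open>A finite family, adjoined in the order of an injective numbering, extends a tower if each
  member satisfies the two conditions over its predecessors. The induction removes the member with
  the largest number.\<close>

lemma tower_family:
  fixes g :: "nat \<times> nat \<Rightarrow> 'a" and key :: "nat \<times> nat \<Rightarrow> nat"
  assumes "finite S" "inj_on key S" "tower gs"
    and skew: "\<And>s. s \<in> S \<Longrightarrow> skew_over (set gs \<union> g ` {t\<in>S. key t < key s}) (g s)"
    and free: "\<And>s. s \<in> S \<Longrightarrow> left_free (gsub (set gs \<union> g ` {t\<in>S. key t < key s})) (g s)"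
  shows "\<exists>hs. tower hs \<and> set hs = set gs \<union> g ` S"
  using assms(1,2,4,5)
proof (induction "card S" arbitrary: S)
  case 0
  then show ?case using assms(3) by auto
next
  case (Suc n)
  then have ne: "S \<noteq> {}" by auto
  define s where "s = (SOME s. s \<in> S \<and> key s = Max (key ` S))"
  have "Max (key ` S) \<in> key ` S" using Suc.prems ne by simp
  then have "\<exists>s. s \<in> S \<and> key s = Max (key ` S)" by force
  then have s: "s \<in> S" "key s = Max (key ` S)" unfolding s_def by (metis (mono_tags, lifting) someI_ex)+
  have le: "key t \<le> key s" if "t \<in> S" for t using that s Suc.prems by simp
  then have less: "key t < key s" if "t \<in> S - {s}" for t
    using that s(1) Suc.prems(2) by (metis DiffD1 DiffD2 inj_onD insertI1 order_le_less)
  have "{t\<in>S. key t < key s} = S - {s}" using less by auto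
  moreover have "{t\<in>S - {s}. key t < key u} = {t\<in>S. key t < key u}" if "u \<in> S - {s}" for u
    using less[OF that] by auto
  moreover have "\<exists>hs. tower hs \<and> set hs = set gs \<union> g ` (S - {s})"
  proof (rule Suc.hyps(1))
    show "n = card (S - {s})" using Suc s by simp
    show "inj_on key (S - {s})" using Suc.prems by (auto intro: inj_on_subset)
  qed (use Suc.prems calculation in auto)
  ultimately obtain hs where hs: "tower hs" "set hs = set gs \<union> g ` {t\<in>S. key t < key s}" by auto
  have "tower (g s # hs)"
    by (rule tower.Cons) (use hs Suc.prems(3,4)[OF s(1)] in auto)
  moreover have "set (g s # hs) = set gs \<union> g ` S"
    using hs s \<open>{t\<in>S. key t < key s} = S - {s}\<close> by auto
  ultimately show ?case by blast
qed

end

text \<open>All nonzero entries lie on the graph of an increasing map, so only the identity permutation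
  contributes, with sign \<open>1\<close>.\<close>

lemma (in kalgebra) qdet_permutation_matrix:
  assumes "sorted_wrt (<) is" "strict_mono_on (set is) f"
    and "\<And>i j. i \<in> set is \<Longrightarrow> z i j = (if j = f i then 1 else 0)"
  shows "qdet q z is (f ` set is) = 1"
  using assms
proof (induction "is")
  case (Cons i "is")
  have lt: "f i < f k" if "k \<in> set is" for k
    using Cons.prems(1,2) that by (auto simp: strict_mono_on_def)
  define K where "K = f ` set (i # is)"
  have K: "K - {f i} = f ` set is" "f i \<in> K" "finite K" using lt by (fastforce simp: K_def)+
  have "{l\<in>K. l < f i} = {}" using lt by (auto simp: K_def dest: order.asym)
  then have c: "card {l\<in>K. l < f i} = 0" by (simp only: card.empty)
  have IH: "qdet q z is (f ` set is) = 1"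
    by (rule Cons.IH) (use Cons.prems in \<open>auto simp: strict_mono_on_def\<close>)
  have "qdet q z (i # is) K = (\<Sum>j\<in>K. if j = f i then 1 else 0)"
    unfolding qdet.simps
  proof (intro sum.cong refl)
    fix j show "(- q) ^ card {l\<in>K. l < j} \<cdot> (z i j * qdet q z is (K - {j})) = (if j = f i then 1 else 0)"
      using Cons.prems(3)[of i j] by (cases "j = f i") (simp_all add: K(1) IH c)
  qed
  also have "\<dots> = 1" using K by (simp add: sum.delta)
  finally show ?case by (simp add: K_def del: qdet.simps)
qed simp

lemma ex_strict_mono_bij:
  fixes A B :: "nat set"
  assumes "finite A" "finite B" "card A = card B"
  shows "\<exists>f. strict_mono_on A f \<and> f ` A = B"
proof -
  define f where "f i = sorted_list_of_set B ! card {a\<in>A. a < i}" for i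
  have lt: "card {a\<in>A. a < i} < card A" if "i \<in> A" for i
    by (rule psubset_card_mono) (use assms that in auto)
  have mono: "f i < f k" if "i \<in> A" "k \<in> A" "i < k" for i k
  proof -
    have "card {a\<in>A. a < i} < card {a\<in>A. a < k}"
      by (rule psubset_card_mono) (use assms that in auto)
    then show ?thesis unfolding f_def
      using strict_sorted_list_of_set[of B] lt[OF that(2)] assms by (simp add: sorted_wrt_iff_nth_less)
  qed
  have "inj_on f A" using mono by (metis inj_onI less_irrefl nat_neq_iff)
  moreover have "f ` A \<subseteq> B"
  proof (rule image_subsetI)
    fix i assume "i \<in> A"
    then have "f i \<in> set (sorted_list_of_set B)"
      unfolding f_def using lt assms by (intro nth_mem) simp
    then show "f i \<in> B" using assms by simp
  qed
  ultimately have "f ` A = B" using assms by (metis card_image card_subset_eq)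
  then show ?thesis using mono by (auto simp: strict_mono_on_def)
qed

text \<open>Numbering of pairs in lexicographic order.\<close>

lemma lex_key: "j \<le> n \<Longrightarrow> l \<le> n \<Longrightarrow> i * Suc n + j < k * Suc n + l \<longleftrightarrow> i < k \<or> i = k \<and> j < (l::nat)"
proof -
  assume *: "j \<le> n" "l \<le> n"
  have "i * Suc n + j < k * Suc n + l" if "i < k" "j \<le> n" for i j k l :: nat
  proof -
    have "i * Suc n + j < Suc i * Suc n" using \<open>j \<le> n\<close> by simp
    also have "\<dots> \<le> k * Suc n" using that by (intro mult_le_mono1) simp
    finally show ?thesis by simp
  qed
  then show ?thesis using * by (metis add_less_cancel_left less_asym' linorder_neqE_nat)
qed

context universal_qmat
begin

section \<open>The subalgebra of a minor as a tower\<close>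

text \<open>Row-major order. For the relation on a diagonal the correction term \<open>x\<^sub>i\<^sub>l x\<^sub>k\<^sub>j\<close> consists of
  entries that precede \<open>x\<^sub>k\<^sub>l\<close> and lie in the same rows and columns, hence in the rectangle.\<close>

lemma rectangle_tower:
  assumes "I \<subseteq> {1..m}" "J \<subseteq> {1..n}"
  shows "\<exists>gs. tower gs \<and> set gs = {x i j | i j. i \<in> I \<and> j \<in> J}"
proof -
  define g where "g = (\<lambda>(i, j). x i j)"
  define key where "key = (\<lambda>(i, j). i * Suc n + j)"
  have key: "key (i, j) < key (k, l) \<longleftrightarrow> i < k \<or> i = k \<and> j < l" if "j \<in> J" "l \<in> J" for i j k l
  proof -
    have "j \<le> n" "l \<le> n" using that assms(2) by auto
    then show ?thesis unfolding key_def using lex_key[of j n l i k] by simp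
  qed
  have fin: "finite I" "finite J" using assms finite_subset by blast+
  have inj: "inj_on key (I \<times> J)"
  proof (rule inj_onI)
    fix s t assume "s \<in> I \<times> J" "t \<in> I \<times> J" "key s = key t"
    then show "s = t" using key[of "snd s" "snd t" "fst s" "fst t"] key[of "snd t" "snd s" "fst t" "fst s"]
      by (cases s; cases t) auto
  qed
  let ?E = "\<lambda>s. set [] \<union> g ` {t\<in>I \<times> J. key t < key s}"
  have E: "?E (k, l) = {x i j | i j. i \<in> I \<and> j \<in> J \<and> (i < k \<or> i = k \<and> j < l)}" if "l \<in> J" for k l
  proof -
    have "{t\<in>I \<times> J. key t < key (k, l)} = {(i, j). i \<in> I \<and> j \<in> J \<and> (i < k \<or> i = k \<and> j < l)}"
      using that by (auto simp: key)
    then have "?E (k, l) = g ` {(i, j). i \<in> I \<and> j \<in> J \<and> (i < k \<or> i = k \<and> j < l)}" by simp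
    also have "\<dots> = {x i j | i j. i \<in> I \<and> j \<in> J \<and> (i < k \<or> i = k \<and> j < l)}"
      unfolding g_def by (auto simp only: image_def mem_Collect_eq case_prod_conv split: prod.splits)
    finally show ?thesis .
  qed
  have "\<exists>hs. tower hs \<and> set hs = set [] \<union> g ` (I \<times> J)"
  proof (rule tower_family[OF _ inj tower.Nil])
    show "finite (I \<times> J)" using fin by simp
    fix s assume "s \<in> I \<times> J"
    then obtain k l where s: "s = (k, l)" "k \<in> I" "l \<in> J" by auto
    have gs: "g s = x k l" by (simp add: s g_def)
    show "left_free (gsub (?E s)) (g s)"
      unfolding gs
    proof (rule left_free_mono[OF entry_free gsub_mono])
      show "?E s \<subseteq> before k l" unfolding s E[OF s(3)] by (auto simp: before_def)
    qed (use s assms in auto)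
    show "skew_over (?E s) (g s)"
      unfolding skew_over_def gs
    proof
      fix z assume "z \<in> ?E s"
      then obtain i j where z: "z = x i j" "i \<in> I" "j \<in> J" "i < k \<or> i = k \<and> j < l"
        unfolding s E[OF s(3)] by blast
      consider "i = k" "j < l" | "i < k" "j = l" | "i < k" "j > l" | "i < k" "j < l"
        using z(4) by (metis linorder_neqE_nat)
      then show "\<exists>c d. c \<noteq> 0 \<and> d \<in> gsub (?E s) \<and> x k l * z = c \<cdot> (z * x k l) + d"
      proof cases
        case 1
        then show ?thesis using qmat_row[OF qmat_x, of j l k] q_nonzero
          by (intro exI[of _ "inverse q"] exI[of _ 0]) (simp add: z gsub_zero)
      next
        case 2
        then show ?thesis using qmat_col[OF qmat_x, of i k l] q_nonzero
          by (intro exI[of _ "inverse q"] exI[of _ 0]) (simp add: z gsub_zero)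
      next
        case 3
        then show ?thesis using qmat_anti[OF qmat_x, of i k l j]
          by (intro exI[of _ 1] exI[of _ 0]) (simp add: z gsub_zero)
      next
        case 4
        have "x i l \<in> ?E s" "x k j \<in> ?E s" unfolding s E[OF s(3)] using 4 z s by blast+
        then have "- ((q - inverse q) \<cdot> (x i l * x k j)) \<in> gsub (?E s)"
          by (intro gsub_minus gsub.scale gsub.mult gsub.gen)
        then show ?thesis using qmat_diag[OF qmat_x 4]
          by (intro exI[of _ 1] exI[of _ "- ((q - inverse q) \<cdot> (x i l * x k j))"]) (simp add: z)
      qed
    qed
  qed
  moreover have "set [] \<union> g ` (I \<times> J) = {x i j | i j. i \<in> I \<and> j \<in> J}" by (auto simp: g_def)
  ultimately show ?thesis by simp
qed

lemma G_domain:
  assumes "a \<in> G" "b \<in> G" "a * b = 0" shows "a = 0 \<or> b = 0"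
proof -
  obtain gs where gs: "tower gs" "set gs = {x i j | i j. i \<in> {1..m} \<and> j \<in> {1..n}}"
    using rectangle_tower[of "{1..m}" "{1..n}"] by auto
  have "z \<in> gsub (set gs)" if z: "z \<in> entries x" for z
  proof -
    obtain i j where "z = x i j" using z by (auto simp: entries_def)
    then show ?thesis using x_outside[of i j] gsub_zero[of "set gs"]
      by (cases "i \<in> {1..m} \<and> j \<in> {1..n}") (auto simp: gs(2) intro!: gsub.gen)
  qed
  then have "a \<in> gsub (set gs)" "b \<in> gsub (set gs)" using assms gsub_least by blast+
  then show ?thesis using tower_domain[OF gs(1)] assms(3) by blast
qed

text \<open>The matrix of the increasing bijection from \<open>A\<close> to \<open>B\<close> is a quantum matrix over the ground
  field: no two of its nonzero entries lie in a common row, in a common column or on an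
  antidiagonal. The corresponding character maps the minor to \<open>1\<close>.\<close>

lemma minor_nonzero:
  assumes "A \<subseteq> {1..m}" "B \<subseteq> {1..n}" "card A = card B"
  shows "minor q x A B \<noteq> 0"
proof -
  interpret F: kalgebra "(*) :: 'k \<Rightarrow> 'k \<Rightarrow> 'k" by standard (auto simp: algebra_simps)
  have fin: "finite A" "finite B" using assms finite_subset by blast+
  obtain f where f: "strict_mono_on A f" "f ` A = B" using ex_strict_mono_bij fin assms(3) by blast
  define z where "z i j = (if i \<in> A \<and> j = f i then 1 else 0 :: 'k)" for i j
  have "F.qmat q z"
  proof -
    have row: "z i j * z i l = 0" "z i l * z i j = 0" if "j < l" for i j l using that by (auto simp: z_def)
    have mono: "z i l * z k j = 0" if "i < k" "j \<le> l" for i j k l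
      using that f(1) unfolding z_def strict_mono_on_def by force
    show ?thesis unfolding F.qmat_def
    proof (intro conjI allI impI; (elim conjE)?)
      fix i j l :: nat assume "j < l"
      then show "z i j * z i l = q * (z i l * z i j)" by (simp only: row mult_zero_right)
    next
      fix i j k :: nat assume "i < k"
      then show "z i j * z k j = q * (z k j * z i j)"
        by (simp only: mono[OF _ order.refl] mult.commute[of "z k j"] mult_zero_right)
    next
      fix i j k l :: nat assume "i < k" "j < l"
      then show "z i j * z k l = z k l * z i j + (q - inverse q) * (z i l * z k j)"
        by (simp only: mono[OF _ less_imp_le] mult_zero_right mult_zero_left add_0_right mult.commute)
    next
      fix i j k l :: nat assume "i < k" "j < l"
      show "z i l * z k j = z k j * z i l" by (rule mult.commute)
    qed
  qed
  moreover have "z i j = 0" if "i \<notin> {1..m} \<or> j \<notin> {1..n}" for i j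
    using that assms f(2) by (auto simp: z_def)
  ultimately obtain \<phi> where \<phi>: "alg_hom (*) G \<phi>" "\<And>i j. \<phi> (x i j) = z i j"
    using hom_field by blast
  have "\<phi> (minor q x A B) = F.qdet q z (sorted_list_of_set A) B"
    unfolding minor_def by (subst hom_qdet[OF \<phi>(1) F.kalgebra_axioms]) (auto simp: x_in_G \<phi>(2))
  also have "\<dots> = F.qdet q z (sorted_list_of_set A) (f ` set (sorted_list_of_set A))"
    using f(2) fin by simp
  also have "\<dots> = 1"
    by (rule F.qdet_permutation_matrix) (use f fin in \<open>auto simp: z_def\<close>)
  finally show ?thesis using hom_zero[OF \<phi>(1) F.kalgebra_axioms] by auto
qed

text \<open>Downward induction on \<open>b\<close> among the indices of \<open>B\<close> below \<open>c\<close>. For the largest one, the shear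
  from column \<open>c\<close> to column \<open>b\<close> produces the minor of \<open>A\<close> and \<open>B\<close> itself as coefficient of \<open>\<beta>\<close>,
  which is regular; the earlier generators are mapped to diagonal operators since \<open>x\<^sub>i\<^sub>c\<close> is not
  among them. For smaller \<open>b\<close> the shear between \<open>b\<close> and its successor leads to the minor for that
  successor.\<close>

lemma column_minor_free:
  assumes A: "A \<subseteq> {1..m}" and B: "B \<subseteq> {1..n}" "card A = card B"
    and bc: "b \<in> B" "c \<in> {1..n} - B" "b < c"
  shows "left_free (gsub ({x i d | i d. d \<in> B \<or> c < d} \<union>
      {minor q x A (insert c (B - {e})) | e. e \<in> B \<and> e < b})) (minor q x A (insert c (B - {b})))"
proof -
  define Y where "Y b = {x i d | i d. d \<in> B \<or> c < d} \<union>
      {minor q x A (insert c (B - {e})) | e. e \<in> B \<and> e < b}" for b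
  let ?y = "\<lambda>b. minor q x A (insert c (B - {b}))"
  have fin: "finite A" "finite B" using assms finite_subset by blast+
  have YG: "Y b \<subseteq> G" for b unfolding Y_def using fin by (auto intro: x_in_G minor_in_G)
  define L where "L = {l\<in>B. l < c}"
  have L: "finite L" "b \<in> L" using fin bc by (auto simp: L_def)
  have "left_free (gsub (Y b)) (?y b)"
    using L
  proof (induction rule: down_induct)
    case base
    define p where "p = Max L"
    have "p \<in> L" unfolding p_def by (rule Max_in) (use L in auto)
    then have p: "p \<in> B" "p < c" by (simp_all add: L_def)
    then have "p \<noteq> c" by simp
    have mid: "\<not> (p < d \<and> d < c)" if "d \<in> B" for d
    proof -
      have "d < c \<Longrightarrow> d \<le> p" unfolding p_def using that L by (intro Max_ge) (auto simp: L_def)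
      then show ?thesis by auto
    qed
    obtain \<phi> where \<phi>: "alg_hom rsm G \<phi>" "\<And>i j. \<phi> (x i j) = shear p c x i j"
      using shear_hom[OF \<open>p \<noteq> c\<close>] bc by blast
    note min = shear_hom_minor[OF \<open>p \<noteq> c\<close> _ \<phi>]
    show ?case unfolding p_def[symmetric]
    proof (rule free_of_regular_shift[OF \<phi>(1) YG])
      show "?y p \<in> G" "minor q x A B \<in> G" using fin by (auto intro: minor_in_G)
      have "insert p (insert c (B - {p}) - {c}) = B" using p bc by auto
      then show "\<phi> (?y p) = dg (?y p) * kp (-1) + dg (minor q x A B) * bt"
        using min(3)[of "insert c (B - {p})" A] p fin mid by auto
      show "r = 0" if "r \<in> G" "r * minor q x A B = 0" for r
        using G_domain[OF that(1) _ that(2)] minor_nonzero[OF A B] minor_in_G fin by auto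
      fix z assume "z \<in> Y p"
      then consider i d where "z = x i d" "d \<in> B \<or> c < d" | e where "z = ?y e" "e \<in> B" "e < p"
        by (auto simp: Y_def)
      then show "diag_comps (\<phi> z) z"
      proof cases
        case 1
        then have "\<phi> z = dg z * kp (if d = p then 1 else 0)"
          using p bc mid[of d] by (auto simp: \<phi> shear_def)
        then show ?thesis unfolding diag_comps_def
          by (intro exI[of _ "\<lambda>k. z * (q powi ((if d = p then 1 else 0) * k) \<cdot> 1)"]) (simp add: kp_def dgf_mult)
      next
        case 2
        then have "\<phi> z = dg z"
          using min(4)[of "insert c (B - {e})" A] p fin mid by auto
        then show ?thesis unfolding diag_comps_def by (intro exI[of _ "\<lambda>k. z"]) simp
      qed
    qed
  next
    case (step p s)
    have ps: "p \<in> B" "s \<in> B" "p < s" "s < c" using step by (auto simp: L_def)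
    have mid: "\<not> (p < d \<and> d < s)" if "d \<in> B" for d using step(4)[of d] that ps by (auto simp: L_def)
    have "p \<noteq> s" "s \<in> {1..n}" using ps B by auto
    obtain \<phi> where \<phi>: "alg_hom rsm G \<phi>" "\<And>i j. \<phi> (x i j) = shear p s x i j"
      using shear_hom[OF \<open>p \<noteq> s\<close> \<open>s \<in> {1..n}\<close>] by blast
    have mc: "\<not> (min p s < j \<and> j < max p s)" if "j \<in> insert c (B - {e})" for j e
      using that ps mid by auto
    show ?case
    proof (rule free_of_free_shift[OF \<phi>(1) YG])
      show "?y p \<in> G" using fin by (auto intro: minor_in_G)
      have "insert p (insert c (B - {p}) - {s}) = insert c (B - {s})" using ps by auto
      moreover have "\<phi> (?y p) = dg (?y p) * kp (if s < p then 1 else -1) +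
          dg (minor q x A (insert p (insert c (B - {p}) - {s}))) * bt"
        by (rule shear_hom_minor(3)[OF \<open>p \<noteq> s\<close> _ \<phi> mc]) (use ps fin in auto)
      ultimately show "\<phi> (?y p) = dg (?y p) * kp (-1) + dg (?y s) * bt"
        using ps by simp
      have "insert c B - {p} = insert c (B - {p})" "insert c B - {s} = insert c (B - {s})" using ps bc by auto
      moreover have "minor q x A (insert c B - {p}) * minor q x A (insert c B - {s}) =
          inverse q \<cdot> (minor q x A (insert c B - {s}) * minor q x A (insert c B - {p}))"
        by (rule maximal_minors_qcommute) (use assms fin ps in auto)
      ultimately show "?y s * ?y p = q \<cdot> (?y p * ?y s)" using q_nonzero by simp
      have "insert (?y p) (Y p) = Y s"
      proof -
        have "e = p \<or> e < p" if "e \<in> B" "e < s" for e using mid[OF that(1)] that(2) by auto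
        then show ?thesis unfolding Y_def using ps by auto
      qed
      then show "left_free (gsub (insert (?y p) (Y p))) (?y s)" using step(5) by simp
      fix z assume z: "z \<in> Y p"
      then consider i d where "z = x i d" "d \<in> B \<or> c < d" | e where "z = ?y e" "e \<in> B" "e < p"
        by (auto simp: Y_def)
      then have "\<exists>e b. \<phi> z = dg z * kp e + dg b * bt \<and> b \<in> gsub (Y p)"
      proof cases
        case 1
        consider "d = s" | "d = p" | "d \<noteq> s" "d \<noteq> p" by blast
        then show ?thesis
        proof cases
          case s: 1
          have "x i p \<in> gsub (Y p)" using ps by (intro gsub.gen) (auto simp: Y_def)
          then show ?thesis using 1 s ps
            by (intro exI[of _ "-1"] exI[of _ "x i p"]) (auto simp: \<phi> shear_def)
        next
          case p: 2
          then show ?thesis using 1 ps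
            by (intro exI[of _ 1] exI[of _ 0]) (auto simp: \<phi> shear_def gsub_zero)
        next
          case 3
          then show ?thesis using 1 ps mid[of d]
            by (intro exI[of _ 0] exI[of _ 0]) (auto simp: \<phi> shear_def gsub_zero)
        qed
      next
        case 2
        then have "\<phi> z = dg z"
          unfolding 2(1)
          by (intro shear_hom_minor(4)[OF \<open>p \<noteq> s\<close> _ \<phi> mc]) (use ps fin in auto)
        then show ?thesis by (intro exI[of _ 0] exI[of _ 0]) (auto simp: gsub_zero)
      qed
      then show "lower_comps (gsub (Y p)) (\<phi> z) z"
        using lower_comps_shift[of z "gsub (Y p)"] gsub.gen[OF z] gsub_zero gsub.scale by metis
    qed
  qed
  then show ?thesis by (simp add: Y_def)
qed

text \<open>For an entry \<open>x\<^sub>i\<^sub>j\<close> of the core, the new minor commutes with it if \<open>j \<noteq> b\<close>; for \<open>j = b\<close> it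
  commutes up to \<open>q\<inverse>\<close> and a correction by the minor with the preceding index of \<open>B\<close>, which is an
  earlier generator. Two of the new minors with distinct \<open>c < c'\<close> are minors of the column set
  \<open>B \<squnion> {c, c'}\<close> with two columns omitted. The correction term of \<open>crossed_minors\<close> again consists
  of earlier generators: this dictates the order with \<open>c\<close> decreasing and \<open>b\<close> increasing.\<close>

lemma add_column_minors:
  assumes A: "A \<subseteq> {1..m}" and B: "B \<subseteq> {1..n}" "card A = card B"
    and gs: "tower gs" "{x i j | i j. i \<in> A \<and> j \<in> B} \<subseteq> set gs" "set gs \<subseteq> gsub {x i j | i j. j \<in> B}"
    and comm: "\<And>z b c. z \<in> set gs \<Longrightarrow> z \<notin> {x i j | i j. i \<in> A \<and> j \<in> B} \<Longrightarrow> b \<in> B \<Longrightarrow>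
        c \<in> {1..n} - B \<Longrightarrow> b < c \<Longrightarrow>
        minor q x A (insert c (B - {b})) * z = z * minor q x A (insert c (B - {b}))"
  shows "\<exists>hs. tower hs \<and> set hs = set gs \<union>
      {minor q x A (insert c (B - {b})) | b c. b \<in> B \<and> c \<in> {1..n} - B \<and> b < c}"
proof -
  have fin: "finite A" "finite B" using assms finite_subset by blast+
  define S where "S = {(c, b). b \<in> B \<and> c \<in> {1..n} - B \<and> b < c}"
  define g where "g = (\<lambda>(c, b). minor q x A (insert c (B - {b})))"
  \<comment> \<open>n - c reverses the order of c\<close>
  define key where "key = (\<lambda>(c, b). (n - c) * Suc n + b)"
  have key: "key (c, b) < key (c', b') \<longleftrightarrow> c' < c \<or> c = c' \<and> b < b'"
    if "(c, b) \<in> S" "(c', b') \<in> S" for b b' c c'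
    using that B lex_key[of b n b' "n - c" "n - c'"] unfolding S_def key_def by auto
  have "S \<subseteq> {1..n} \<times> B" by (auto simp: S_def)
  then have finS: "finite S" using fin finite_subset by blast
  have inj: "inj_on key S"
  proof (rule inj_onI)
    fix s t assume "s \<in> S" "t \<in> S" "key s = key t"
    then show "s = t"
      using key[of "fst s" "snd s" "fst t" "snd t"] key[of "fst t" "snd t" "fst s" "snd s"]
      by (cases s; cases t) auto
  qed
  let ?E = "\<lambda>s. set gs \<union> g ` {t\<in>S. key t < key s}"
  have gy: "g (c, b) = minor q x A (insert c (B - {b}))" for b c by (simp add: g_def)
  have "\<exists>hs. tower hs \<and> set hs = set gs \<union> g ` S"
  proof (rule tower_family[OF finS inj gs(1)])
    fix s assume s': "s \<in> S"
    then obtain c b where s: "s = (c, b)" and bc: "b \<in> B" "c \<in> {1..n}" "c \<notin> B" "b < c" by (auto simp: S_def)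
    show "left_free (gsub (?E s)) (g s)"
      unfolding s gy
    proof (rule left_free_mono[OF column_minor_free[OF A B]])
      let ?Y = "{x i d | i d. d \<in> B \<or> c < d} \<union> {minor q x A (insert c (B - {e})) | e. e \<in> B \<and> e < b}"
      have xY: "x i d \<in> gsub ?Y" if "d \<in> B \<or> c < d" for i d
        using that by (intro gsub.gen) blast
      have "{x i j | i j. j \<in> B} \<subseteq> gsub ?Y" using xY by auto
      then have "set gs \<subseteq> gsub ?Y" using gs(3) gsub_least by blast
      moreover have "g t \<in> gsub ?Y" if t: "t \<in> S" "key t < key s" for t
      proof -
        obtain c' b' where t': "t = (c', b')" by (cases t)
        then have "c < c' \<or> c' = c \<and> b' < b" using key t s s' by auto
        then show ?thesis
        proof
          assume "c < c'"
          then show ?thesis unfolding t' gy using fin by (intro minor_in_gsub xY) auto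
        next
          assume "c' = c \<and> b' < b"
          then show ?thesis using t unfolding t' gy by (intro gsub.gen) (auto simp: S_def)
        qed
      qed
      ultimately have "?E s \<subseteq> gsub ?Y" by auto
      then show "gsub (set gs \<union> g ` {t \<in> S. key t < key (c, b)}) \<subseteq> gsub ?Y"
        using gsub_least s by blast
    qed (use bc in auto)
    have earlier: "g (c', b') \<in> gsub (?E s)" if "b' \<in> B" "c' \<in> {1..n}" "c' \<notin> B" "b' < c'" "c < c' \<or> c' = c \<and> b' < b" for c' b'
    proof (rule gsub.gen)
      have "(c', b') \<in> S" using that by (auto simp: S_def)
      moreover have "key (c', b') < key s" using key[of c' b' c b] calculation s s' that by auto
      ultimately show "g (c', b') \<in> ?E s" by blast
    qed
    have core: "x i j \<in> gsub (?E s)" if "i \<in> A" "j \<in> B" for i j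
      using that gs(2) by (intro gsub.gen) blast
    show "skew_over (?E s) (g s)"
      unfolding skew_over_def
    proof
      fix z assume "z \<in> ?E s"
      then have "z \<in> set gs \<or> (\<exists>t\<in>S. key t < key s \<and> z = g t)" by blast
      then consider i j where "z = x i j" "i \<in> A" "j \<in> B"
        | "z \<in> set gs" "z \<notin> {x i j | i j. i \<in> A \<and> j \<in> B}"
        | c' b' where "z = g (c', b')" "(c', b') \<in> S" "key (c', b') < key s"
        by fast
      then show "\<exists>d' d. d' \<noteq> 0 \<and> d \<in> gsub (?E s) \<and> g s * z = d' \<cdot> (z * g s) + d"
      proof cases
        case 1
        have yb: "insert c (B - {b}) = insert c B - {b}" using bc by auto
        have card: "card (insert c B) = Suc (card A)" "card (insert c B - {b}) = card A"
          using bc fin B(2) by auto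
        show ?thesis
        proof (cases "j = b")
          case False
          have "g s * z = z * g s" unfolding s gy yb 1(1)
            by (rule central_entry) (use 1 False fin A B bc card in auto)
          then show ?thesis by (intro exI[of _ 1] exI[of _ 0]) (simp add: gsub_zero)
        next
          case True
          show ?thesis
          proof (cases "\<exists>l\<in>B. l < b")
            case False
            have "g s * z = inverse q \<cdot> (z * g s)" unfolding s gy yb 1(1) True
              by (rule entry_left) (use 1 False fin A bc card in \<open>auto simp: not_less order.order_iff_strict\<close>)
            then show ?thesis using q_nonzero by (intro exI[of _ "inverse q"] exI[of _ 0]) (simp add: gsub_zero)
          next
            case ex: True
            define p where "p = Max {l\<in>B. l < b}"
            have "p \<in> {l\<in>B. l < b}" unfolding p_def by (rule Max_in) (use ex fin in auto)
            then have p: "p \<in> B" "p < b" by auto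
            have mid: "\<not> (p < l \<and> l < b)" if "l \<in> insert c B" for l
            proof (cases "l \<in> B")
              case True
              have "l < b \<Longrightarrow> l \<le> p" unfolding p_def using True fin by (intro Max_ge) auto
              then show ?thesis by auto
            qed (use that bc in auto)
            have yp: "insert c B - {p} = insert c (B - {p})" using p bc by auto
            have "g s * z = inverse q \<cdot> (z * g s) +
               (x i p * g (c, p) - inverse q \<cdot> (g (c, p) * x i p))"
              unfolding s gy yb yp[symmetric] 1(1) True
              by (rule shifted_entry) (use 1 fin A B bc card p mid in auto)
            moreover have "x i p * g (c, p) - inverse q \<cdot> (g (c, p) * x i p) \<in> gsub (?E s)"
              using p bc 1 by (intro gsub_diff gsub.scale gsub.mult core earlier) auto
            ultimately show ?thesis using q_nonzero
              by (intro exI[of _ "inverse q"] exI[of _ "x i p * g (c, p) - inverse q \<cdot> (g (c, p) * x i p)"]) auto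
          qed
        qed
      next
        case 2
        then have "g s * z = z * g s" unfolding s gy using comm[OF 2] bc by simp
        then show ?thesis by (intro exI[of _ 1] exI[of _ 0]) (simp add: gsub_zero)
      next
        case 3
        then have b': "b' \<in> B" "c' \<in> {1..n}" "c' \<notin> B" "b' < c'" by (auto simp: S_def)
        have ord: "c < c' \<or> c' = c \<and> b' < b" using key[of c' b' c b] 3 s s' by auto
        show ?thesis
        proof (cases "c' = c")
          case True
          have "insert c B - {b} = insert c (B - {b})" "insert c B - {b'} = insert c (B - {b'})" using b' bc True by auto
          moreover have "minor q x A (insert c B - {b'}) * minor q x A (insert c B - {b}) =
              inverse q \<cdot> (minor q x A (insert c B - {b}) * minor q x A (insert c B - {b'}))"
            by (rule maximal_minors_qcommute) (use A B fin bc b' ord True in auto)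
          ultimately have "g s * z = q \<cdot> (z * g s)" unfolding s 3(1) gy True using q_nonzero by simp
          then show ?thesis using q_nonzero by (intro exI[of _ q] exI[of _ 0]) (simp add: gsub_zero)
        next
          case False
          then have cc: "c < c'" using ord by simp
          define J where "J = insert c (insert c' B)"
          have J: "finite J" "card J = Suc (Suc (card A))" "J \<subseteq> {1..n}"
            using fin bc b' cc B by (auto simp: J_def)
          have "J - {u, c'} = insert c (B - {u})" "J - {u, c} = insert c' (B - {u})" if "u \<in> B" for u
            using that bc b' cc by (auto simp: J_def)
          then have Y: "minor q x A (J - {u, c'}) = g (c, u)" "minor q x A (J - {u, c}) = g (c', u)" if "u \<in> B" for u
            using that by (simp_all add: gy)
          consider "b = b'" | "b < b'" | "b' < b" by linarith
          then show ?thesis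
          proof cases
            case 1
            have "minor q x A (J - {b} - {c}) * minor q x A (J - {b} - {c'}) =
              inverse q \<cdot> (minor q x A (J - {b} - {c'}) * minor q x A (J - {b} - {c}))"
              by (rule maximal_minors_qcommute) (use A J fin bc b' cc in \<open>auto simp: J_def\<close>)
            moreover have "J - {b} - {c'} = J - {b, c'}" "J - {b} - {c} = J - {b, c}" by auto
            ultimately have "g (c', b) * g (c, b) = inverse q \<cdot> (g (c, b) * g (c', b))"
              using Y[OF bc(1)] by simp
            then have "g s * z = q \<cdot> (z * g s)" unfolding s 3(1) 1 using q_nonzero by simp
            then show ?thesis using q_nonzero by (intro exI[of _ q] exI[of _ 0]) (simp add: gsub_zero)
          next
            case 2
            have "minor q x A (J - {b, c'}) * minor q x A (J - {b', c}) =
               minor q x A (J - {b', c}) * minor q x A (J - {b, c'})"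
              by (rule nested_minors_commute) (use A J fin bc b' cc 2 in \<open>auto simp: J_def\<close>)
            then have "g s * z = z * g s" unfolding s 3(1) using Y bc b' by simp
            then show ?thesis by (intro exI[of _ 1] exI[of _ 0]) (simp add: gsub_zero)
          next
            case 3
            have "minor q x A (J - {b', c}) * minor q x A (J - {b, c'}) =
               minor q x A (J - {b, c'}) * minor q x A (J - {b', c}) -
                 (q - inverse q) \<cdot> (minor q x A (J - {b', c'}) * minor q x A (J - {b, c}))"
              by (rule crossed_minors) (use A J fin bc b' cc 3 in \<open>auto simp: J_def\<close>)
            then have "g s * z = 1 \<cdot> (z * g s) + (q - inverse q) \<cdot> (g (c, b') * g (c', b))"
              unfolding s \<open>z = g (c', b')\<close> using Y bc b' by simp
            moreover have "(q - inverse q) \<cdot> (g (c, b') * g (c', b)) \<in> gsub (?E s)"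
              using bc b' cc 3 by (intro gsub.scale gsub.mult earlier) auto
            ultimately show ?thesis
              by (intro exI[of _ 1] exI[of _ "(q - inverse q) \<cdot> (g (c, b') * g (c', b))"]) auto
          qed
        qed
      qed
    qed
  qed
  moreover have "g ` S = {minor q x A (insert c (B - {b})) | b c. b \<in> B \<and> c \<in> {1..n} - B \<and> b < c}"
    by (force simp: g_def S_def)
  ultimately show ?thesis by simp
qed

text \<open>The row minors are added first, as column minors of the transposed matrix. They commute with
  the column minors by \<open>opposite_minors_commute\<close>, since both are minors of \<open>A \<squnion> {r}\<close> and \<open>B \<squnion> {c}\<close>
  with one row and one column omitted.\<close>

theorem minor_tower:
  assumes A: "A \<subseteq> {1..m}" and B: "B \<subseteq> {1..n}" and card: "card A = card B"
  shows "\<exists>gs. tower gs \<and> set gs = {x i j | i j. i \<in> A \<and> j \<in> B} \<union>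
      {minor q x A (insert c (B - {b})) | b c. b \<in> B \<and> c \<in> {1..n} - B \<and> b < c} \<union>
      {minor q x (insert r (A - {a})) B | a r. a \<in> A \<and> r \<in> {1..m} - A \<and> a < r}"
proof -
  interpret T: universal_qmat sm q n m "\<lambda>i j. x j i" by (rule transpose)
  have fin: "finite A" "finite B" using assms finite_subset by blast+
  obtain gs where gs: "tower gs" "set gs = {x i j | i j. i \<in> A \<and> j \<in> B}"
    using rectangle_tower[OF A B] by blast
  have coreT: "{x j i | i j. i \<in> B \<and> j \<in> A} = {x i j | i j. i \<in> A \<and> j \<in> B}" by blast
  have ex: "\<exists>hs. tower hs \<and> set hs = set gs \<union>
      {minor q (\<lambda>i j. x j i) B (insert r (A - {a})) | a r. a \<in> A \<and> r \<in> {1..m} - A \<and> a < r}"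
  proof (rule T.add_column_minors[OF B A card[symmetric] gs(1)])
    show "set gs \<subseteq> gsub {x j i | i j. j \<in> A}" unfolding gs(2) by (auto intro!: gsub.gen)
  qed (unfold coreT gs(2), auto)
  have "minor q (\<lambda>i j. x j i) B (insert r (A - {a})) = minor q x (insert r (A - {a})) B"
    if "a \<in> A" "r \<in> {1..m} - A" for a r
    using that fin card card_Suc_Diff1[of A a] by (intro minor_transpose[symmetric] qmat_x) auto
  then have eq: "{minor q (\<lambda>i j. x j i) B (insert r (A - {a})) | a r. a \<in> A \<and> r \<in> {1..m} - A \<and> a < r} =
     {minor q x (insert r (A - {a})) B | a r. a \<in> A \<and> r \<in> {1..m} - A \<and> a < r}"
    by (intro Collect_cong ex_cong1) auto
  from ex obtain hs where hs: "tower hs" "set hs = {x i j | i j. i \<in> A \<and> j \<in> B} \<union>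
     {minor q x (insert r (A - {a})) B | a r. a \<in> A \<and> r \<in> {1..m} - A \<and> a < r}"
    unfolding gs(2) eq by iprover
  have "\<exists>ks. tower ks \<and> set ks = set hs \<union>
      {minor q x A (insert c (B - {b})) | b c. b \<in> B \<and> c \<in> {1..n} - B \<and> b < c}"
  proof (rule add_column_minors[OF A B card hs(1)])
    show "{x i j | i j. i \<in> A \<and> j \<in> B} \<subseteq> set hs" using hs(2) by blast
    have "minor q x (insert r (A - {a})) B \<in> gsub {x i j | i j. j \<in> B}" for r a
      using fin by (intro minor_in_gsub gsub.gen) auto
    moreover have "x i j \<in> gsub {x i j | i j. j \<in> B}" if "j \<in> B" for i j using that by (intro gsub.gen) blast
    ultimately show "set hs \<subseteq> gsub {x i j | i j. j \<in> B}" unfolding hs(2) by blast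
  next
    fix z b c assume z: "z \<in> set hs" "z \<notin> {x i j | i j. i \<in> A \<and> j \<in> B}"
      and bc: "b \<in> B" "c \<in> {1..n} - B" "b < c"
    then obtain a r where ar: "z = minor q x (insert r (A - {a})) B" "a \<in> A" "r \<in> {1..m} - A" "a < r"
      using hs(2) by blast
    have "insert r A - {r} = A" "insert c B - {c} = B" "insert c B - {b} = insert c (B - {b})"
      "insert r A - {a} = insert r (A - {a})" using ar bc by auto
    moreover have "minor q x (insert r A - {r}) (insert c B - {b}) * minor q x (insert r A - {a}) (insert c B - {c}) =
       minor q x (insert r A - {a}) (insert c B - {c}) * minor q x (insert r A - {r}) (insert c B - {b})"
      by (rule opposite_minors_commute) (use A B card fin ar bc in auto)
    ultimately show "minor q x A (insert c (B - {b})) * z = z * minor q x A (insert c (B - {b}))"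
      unfolding ar(1) by simp
  qed
  then show ?thesis unfolding hs(2) by (simp add: Un_ac)
qed

end

section \<open>Iterated Ore extensions and isomorphisms\<close>

definition alg_iso :: "('k::field, 'a, 'b) module_scheme \<Rightarrow> ('k, 'c, 'd) module_scheme \<Rightarrow> ('a \<Rightarrow> 'c) \<Rightarrow> bool" where
  "alg_iso S S' h \<longleftrightarrow> bij_betw h (carrier S) (carrier S') \<and> h \<one>\<^bsub>S\<^esub> = \<one>\<^bsub>S'\<^esub> \<and>
     (\<forall>a\<in>carrier S. \<forall>b\<in>carrier S. h (a \<otimes>\<^bsub>S\<^esub> b) = h a \<otimes>\<^bsub>S'\<^esub> h b \<and> h (a \<oplus>\<^bsub>S\<^esub> b) = h a \<oplus>\<^bsub>S'\<^esub> h b) \<and>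
     (\<forall>c. \<forall>a\<in>carrier S. h (c \<odot>\<^bsub>S\<^esub> a) = c \<odot>\<^bsub>S'\<^esub> h a)"

lemma assoc_algebra_subalgebra:
  assumes "assoc_algebra S" "unital_subalgebra S R"
  shows "assoc_algebra (S\<lparr>carrier := R\<rparr>)"
proof -
  interpret assoc_algebra S by fact
  have sub: "subring R S" and sc: "\<And>c x. x \<in> R \<Longrightarrow> c \<odot>\<^bsub>S\<^esub> x \<in> R"
    using assms(2) by (auto simp: unital_subalgebra_def)
  have "ring (S\<lparr>carrier := R\<rparr>)" by (rule subring_is_ring[OF sub])
  moreover have "R \<subseteq> carrier S" using subringE(1)[OF sub] .
  ultimately show ?thesis
    by (intro assoc_algebra.intro assoc_algebra_axioms.intro)
       (auto simp: sc smult_add_left smult_add_right smult_smult smult_one smult_mult_left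
          smult_mult_right subsetD)
qed

text \<open>In the induction step the subalgebra, the new generator, the twist and the derivation are
  all transported along \<open>h\<close>; the expansion map of the target is \<open>h\<close> composed with the expansion
  map of the source and the transport of coefficient sequences.\<close>

lemma iterated_ore_extension_iso:
  assumes "iterated_ore_extension S" "assoc_algebra S'" "alg_iso S S' h"
  shows "iterated_ore_extension S'"
  using assms
proof (induction arbitrary: S' h rule: iterated_ore_extension.induct)
  case (base R)
  interpret R: assoc_algebra R by fact
  have "bij_betw (h \<circ> (\<lambda>c. c \<odot>\<^bsub>R\<^esub> \<one>\<^bsub>R\<^esub>)) UNIV (carrier S')"
    using base by (intro bij_betw_trans) (auto simp: alg_iso_def)
  moreover have "(h \<circ> (\<lambda>c. c \<odot>\<^bsub>R\<^esub> \<one>\<^bsub>R\<^esub>)) = (\<lambda>c. c \<odot>\<^bsub>S'\<^esub> \<one>\<^bsub>S'\<^esub>)"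
    using base by (auto simp: alg_iso_def)
  ultimately show ?case using base by (intro iterated_ore_extension.base) auto
next
  case (step R S y \<sigma> \<delta>)
  note ore = step(2)[unfolded ore_extension_def]
  interpret S: assoc_algebra S using ore by blast
  interpret S': assoc_algebra S' by fact
  have sub: "subring R S" and usub: "unital_subalgebra S R" using ore by (auto simp: unital_subalgebra_def)
  note RE = subringE[OF sub]
  have RS: "R \<subseteq> carrier S" by (rule RE(1))
  have bij: "bij_betw h (carrier S) (carrier S')" and h1: "h \<one>\<^bsub>S\<^esub> = \<one>\<^bsub>S'\<^esub>"
    and hm: "\<And>a b. a \<in> carrier S \<Longrightarrow> b \<in> carrier S \<Longrightarrow> h (a \<otimes>\<^bsub>S\<^esub> b) = h a \<otimes>\<^bsub>S'\<^esub> h b"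
    and ha: "\<And>a b. a \<in> carrier S \<Longrightarrow> b \<in> carrier S \<Longrightarrow> h (a \<oplus>\<^bsub>S\<^esub> b) = h a \<oplus>\<^bsub>S'\<^esub> h b"
    and hs: "\<And>c a. a \<in> carrier S \<Longrightarrow> h (c \<odot>\<^bsub>S\<^esub> a) = c \<odot>\<^bsub>S'\<^esub> h a"
    using step(5) by (auto simp: alg_iso_def)
  have hc: "h a \<in> carrier S'" if "a \<in> carrier S" for a using bij that by (auto simp: bij_betw_def)
  have inj: "inj_on h (carrier S)" and surj: "h ` carrier S = carrier S'" using bij by (auto simp: bij_betw_def)
  have h0: "h \<zero>\<^bsub>S\<^esub> = \<zero>\<^bsub>S'\<^esub>"
    using ha[of "\<zero>\<^bsub>S\<^esub>" "\<zero>\<^bsub>S\<^esub>"] hc[of "\<zero>\<^bsub>S\<^esub>"] S'.add.r_cancel_one'[of "h \<zero>\<^bsub>S\<^esub>" "h \<zero>\<^bsub>S\<^esub>"] by simp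
  have hneg: "h (\<ominus>\<^bsub>S\<^esub> a) = \<ominus>\<^bsub>S'\<^esub> h a" if "a \<in> carrier S" for a
  proof -
    have "h (\<ominus>\<^bsub>S\<^esub> a) \<oplus>\<^bsub>S'\<^esub> h a = \<zero>\<^bsub>S'\<^esub>" using ha[of "\<ominus>\<^bsub>S\<^esub> a" a] that by (simp add: S.l_neg h0)
    then show ?thesis using S'.minus_equality[of "h (\<ominus>\<^bsub>S\<^esub> a)" "h a"] hc that by simp
  qed
  have hpow: "h (a [^]\<^bsub>S\<^esub> (i::nat)) = h a [^]\<^bsub>S'\<^esub> i" if "a \<in> carrier S" for a i
    using that by (induction i) (auto simp: h1 hm)
  have hsum: "h (\<Oplus>\<^bsub>S\<^esub>i\<in>I. f i) = (\<Oplus>\<^bsub>S'\<^esub>i\<in>I. h (f i))" if "finite I" "f \<in> I \<rightarrow> carrier S" for f :: "nat \<Rightarrow> 'a" and I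
    using that
  proof (induction I rule: finite_induct)
    case (insert i I)
    then have "h (\<Oplus>\<^bsub>S\<^esub>i\<in>insert i I. f i) = h (f i \<oplus>\<^bsub>S\<^esub> (\<Oplus>\<^bsub>S\<^esub>i\<in>I. f i))" by (simp add: S.finsum_insert)
    also have "\<dots> = h (f i) \<oplus>\<^bsub>S'\<^esub> (\<Oplus>\<^bsub>S'\<^esub>i\<in>I. h (f i))"
      using insert by (subst ha) (auto intro: S.finsum_closed)
    also have "\<dots> = (\<Oplus>\<^bsub>S'\<^esub>i\<in>insert i I. h (f i))"
      using insert hc by (subst S'.finsum_insert) (auto simp: Pi_iff)
    finally show ?case .
  qed (simp add: h0)
  define k where "k = inv_into (carrier S) h"
  have kh: "k (h a) = a" if "a \<in> carrier S" for a using inj that by (simp add: k_def)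
  have hk: "h (k b) = b" and kc: "k b \<in> carrier S" if "b \<in> carrier S'" for b
    using surj that by (auto simp: k_def f_inv_into_f inv_into_into)
  let ?R = "h ` R"
  have kR: "k b \<in> R" if "b \<in> ?R" for b using that kh RS by auto
  have hR: "h a \<in> ?R" if "a \<in> R" for a using that by simp
  have RS': "?R \<subseteq> carrier S'" using RS hc by auto
  have y: "y \<in> carrier S" using ore by blast
  note Sc = subsetD[OF RS]
  have usub': "unital_subalgebra S' ?R"
    unfolding unital_subalgebra_def
  proof (intro conjI allI ballI)
    show "subring ?R S'"
    proof (rule S'.subringI)
      show "\<one>\<^bsub>S'\<^esub> \<in> ?R" unfolding h1[symmetric] by (rule imageI[OF RE(3)])
    next
      fix a assume "a \<in> ?R"
      then obtain u where u: "u \<in> R" "a = h u" by blast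
      then have "\<ominus>\<^bsub>S'\<^esub> a = h (\<ominus>\<^bsub>S\<^esub> u)" using hneg Sc by simp
      then show "\<ominus>\<^bsub>S'\<^esub> a \<in> ?R" using RE(5) u by simp
    next
      fix a b assume "a \<in> ?R" "b \<in> ?R"
      then obtain u v where u: "u \<in> R" "v \<in> R" "a = h u" "b = h v" by blast
      have "a \<otimes>\<^bsub>S'\<^esub> b = h (u \<otimes>\<^bsub>S\<^esub> v)" using u hm Sc by simp
      then show "a \<otimes>\<^bsub>S'\<^esub> b \<in> ?R" using RE(6) u by simp
      have "a \<oplus>\<^bsub>S'\<^esub> b = h (u \<oplus>\<^bsub>S\<^esub> v)" using u ha Sc by simp
      then show "a \<oplus>\<^bsub>S'\<^esub> b \<in> ?R" using RE(7) u by simp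
    qed (rule RS')
    fix c a assume "a \<in> ?R"
    then obtain u where u: "u \<in> R" "a = h u" by blast
    then have "c \<odot>\<^bsub>S'\<^esub> a = h (c \<odot>\<^bsub>S\<^esub> u)" using hs Sc by simp
    moreover have "c \<odot>\<^bsub>S\<^esub> u \<in> R" using usub u by (simp add: unital_subalgebra_def)
    ultimately show "c \<odot>\<^bsub>S'\<^esub> a \<in> ?R" by simp
  qed
  have IH: "iterated_ore_extension (S'\<lparr>carrier := ?R\<rparr>)"
  proof (rule step.IH)
    show "assoc_algebra (S'\<lparr>carrier := ?R\<rparr>)" by (rule assoc_algebra_subalgebra[OF step(4) usub'])
    show "alg_iso (S\<lparr>carrier := R\<rparr>) (S'\<lparr>carrier := ?R\<rparr>) h"
      using RS hm ha hs h1 inj by (auto simp: alg_iso_def bij_betw_def subsetD intro: inj_on_subset)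
  qed
  have \<sigma>iso: "\<sigma> \<in> ring_iso (S\<lparr>carrier := R\<rparr>) (S\<lparr>carrier := R\<rparr>)" 
    and \<sigma>s: "\<And>c a. a \<in> R \<Longrightarrow> \<sigma> (c \<odot>\<^bsub>S\<^esub> a) = c \<odot>\<^bsub>S\<^esub> \<sigma> a"
    using ore by (auto simp: algebra_automorphism_def)
  have \<sigma>R: "\<And>a. a \<in> R \<Longrightarrow> \<sigma> a \<in> R" and \<sigma>m: "\<And>a b. a \<in> R \<Longrightarrow> b \<in> R \<Longrightarrow> \<sigma> (a \<otimes>\<^bsub>S\<^esub> b) = \<sigma> a \<otimes>\<^bsub>S\<^esub> \<sigma> b"
    and \<sigma>a: "\<And>a b. a \<in> R \<Longrightarrow> b \<in> R \<Longrightarrow> \<sigma> (a \<oplus>\<^bsub>S\<^esub> b) = \<sigma> a \<oplus>\<^bsub>S\<^esub> \<sigma> b" and \<sigma>1: "\<sigma> \<one>\<^bsub>S\<^esub> = \<one>\<^bsub>S\<^esub>"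
    and \<sigma>bij: "bij_betw \<sigma> R R"
    using \<sigma>iso by (auto simp: ring_iso_def ring_hom_def)
  have \<delta>R: "\<And>a. a \<in> R \<Longrightarrow> \<delta> a \<in> R"
    and \<delta>a: "\<And>a b. a \<in> R \<Longrightarrow> b \<in> R \<Longrightarrow> \<delta> (a \<oplus>\<^bsub>S\<^esub> b) = \<delta> a \<oplus>\<^bsub>S\<^esub> \<delta> b"
    and \<delta>s: "\<And>c a. a \<in> R \<Longrightarrow> \<delta> (c \<odot>\<^bsub>S\<^esub> a) = c \<odot>\<^bsub>S\<^esub> \<delta> a"
    and \<delta>m: "\<And>a b. a \<in> R \<Longrightarrow> b \<in> R \<Longrightarrow> \<delta> (a \<otimes>\<^bsub>S\<^esub> b) = \<sigma> a \<otimes>\<^bsub>S\<^esub> \<delta> b \<oplus>\<^bsub>S\<^esub> \<delta> a \<otimes>\<^bsub>S\<^esub> b"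
    using ore by (auto simp: skew_derivation_def)
  define \<sigma>' where "\<sigma>' b = h (\<sigma> (k b))" for b
  define \<delta>' where "\<delta>' b = h (\<delta> (k b))" for b
  have \<sigma>h: "\<sigma>' (h a) = h (\<sigma> a)" and \<delta>h: "\<delta>' (h a) = h (\<delta> a)" if "a \<in> R" for a
    using kh Sc[OF that] by (simp_all add: \<sigma>'_def \<delta>'_def)
  have "ore_extension S' ?R (h y) \<sigma>' \<delta>'"
    unfolding ore_extension_def
  proof (intro conjI)
    show "assoc_algebra S'" "unital_subalgebra S' ?R" by fact+
    show "h y \<in> carrier S'" using y hc by blast
    have "bij_betw \<sigma>' ?R ?R"
    proof -
      have b: "bij_betw k ?R R" using kh Sc by (intro bij_betw_byWitness[where f' = h]) auto
      have "bij_betw h R ?R" by (rule inj_on_imp_bij_betw[OF inj_on_subset[OF inj RS]])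
      then have "bij_betw (h \<circ> (\<sigma> \<circ> k)) ?R ?R"
        by (rule bij_betw_trans[OF bij_betw_trans[OF b \<sigma>bij]])
      then show ?thesis by (simp add: \<sigma>'_def[abs_def] comp_def)
    qed
    moreover have "\<sigma>' \<in> ring_hom (S'\<lparr>carrier := ?R\<rparr>) (S'\<lparr>carrier := ?R\<rparr>)"
    proof (rule ring_hom_memI)
      fix a assume "a \<in> carrier (S'\<lparr>carrier := ?R\<rparr>)"
      then show "\<sigma>' a \<in> carrier (S'\<lparr>carrier := ?R\<rparr>)" using \<sigma>h \<sigma>R by auto
    next
      fix a b assume "a \<in> carrier (S'\<lparr>carrier := ?R\<rparr>)" "b \<in> carrier (S'\<lparr>carrier := ?R\<rparr>)"
      then obtain u v where u: "u \<in> R" "v \<in> R" "a = h u" "b = h v" by auto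
      show "\<sigma>' (a \<otimes>\<^bsub>S'\<lparr>carrier := ?R\<rparr>\<^esub> b) = \<sigma>' a \<otimes>\<^bsub>S'\<lparr>carrier := ?R\<rparr>\<^esub> \<sigma>' b"
        "\<sigma>' (a \<oplus>\<^bsub>S'\<lparr>carrier := ?R\<rparr>\<^esub> b) = \<sigma>' a \<oplus>\<^bsub>S'\<lparr>carrier := ?R\<rparr>\<^esub> \<sigma>' b"
        using u \<sigma>h[OF RE(6)[OF u(1,2)]] \<sigma>h[OF RE(7)[OF u(1,2)]]
        by (simp_all add: \<sigma>h \<sigma>m \<sigma>a hm ha Sc \<sigma>R)
    next
      show "\<sigma>' \<one>\<^bsub>S'\<lparr>carrier := ?R\<rparr>\<^esub> = \<one>\<^bsub>S'\<lparr>carrier := ?R\<rparr>\<^esub>"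
        using \<sigma>h[OF RE(3)] by (simp add: h1 \<sigma>1)
    qed
    moreover have sR: "c \<odot>\<^bsub>S\<^esub> u \<in> R" if "u \<in> R" for c u
      using usub that by (simp add: unital_subalgebra_def)
    have "\<sigma>' (c \<odot>\<^bsub>S'\<^esub> a) = c \<odot>\<^bsub>S'\<^esub> \<sigma>' a" if a: "a \<in> ?R" for c a
    proof -
      obtain u where u: "u \<in> R" "a = h u" using a by blast
      show ?thesis using u \<sigma>h[OF sR[OF u(1)], of c] by (simp add: \<sigma>h \<sigma>s hs Sc \<sigma>R)
    qed
    ultimately show "algebra_automorphism (S'\<lparr>carrier := ?R\<rparr>) \<sigma>'"
      by (simp add: algebra_automorphism_def ring_iso_def)
    have "\<delta>' (c \<odot>\<^bsub>S'\<^esub> a) = c \<odot>\<^bsub>S'\<^esub> \<delta>' a" if a: "a \<in> ?R" for c a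
    proof -
      obtain u where u: "u \<in> R" "a = h u" using a by blast
      show ?thesis using u \<delta>h[OF sR[OF u(1)], of c] by (simp add: \<delta>h \<delta>s hs Sc \<delta>R)
    qed
    moreover have "\<delta>' (a \<oplus>\<^bsub>S'\<^esub> b) = \<delta>' a \<oplus>\<^bsub>S'\<^esub> \<delta>' b \<and>
        \<delta>' (a \<otimes>\<^bsub>S'\<^esub> b) = \<sigma>' a \<otimes>\<^bsub>S'\<^esub> \<delta>' b \<oplus>\<^bsub>S'\<^esub> \<delta>' a \<otimes>\<^bsub>S'\<^esub> b"
      if ab: "a \<in> ?R" "b \<in> ?R" for a b
    proof -
      obtain u v where u: "u \<in> R" "v \<in> R" "a = h u" "b = h v" using ab by blast
      show ?thesis
        using u \<delta>h[OF RE(6)[OF u(1,2)]] \<delta>h[OF RE(7)[OF u(1,2)]]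
          RE(6)[OF \<sigma>R[OF u(1)] \<delta>R[OF u(2)]] RE(6)[OF \<delta>R[OF u(1)] u(2)]
        by (simp add: \<sigma>h \<delta>h \<delta>m \<delta>a hm ha Sc \<sigma>R \<delta>R)
    qed
    moreover have "\<delta>' \<in> ?R \<rightarrow> ?R" using \<delta>h \<delta>R by auto
    ultimately show "skew_derivation (S'\<lparr>carrier := ?R\<rparr>) \<sigma>' \<delta>'"
      by (simp add: skew_derivation_def)
    show "\<forall>a\<in>?R. h y \<otimes>\<^bsub>S'\<^esub> a = \<sigma>' a \<otimes>\<^bsub>S'\<^esub> h y \<oplus>\<^bsub>S'\<^esub> \<delta>' a"
    proof
      fix b assume "b \<in> ?R"
      then obtain a where a: "a \<in> R" "b = h a" by blast
      have "y \<otimes>\<^bsub>S\<^esub> a = \<sigma> a \<otimes>\<^bsub>S\<^esub> y \<oplus>\<^bsub>S\<^esub> \<delta> a" using ore a by blast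
      then have "h (y \<otimes>\<^bsub>S\<^esub> a) = h (\<sigma> a \<otimes>\<^bsub>S\<^esub> y \<oplus>\<^bsub>S\<^esub> \<delta> a)" by simp
      then show "h y \<otimes>\<^bsub>S'\<^esub> b = \<sigma>' b \<otimes>\<^bsub>S'\<^esub> h y \<oplus>\<^bsub>S'\<^esub> \<delta>' b"
        using a y Sc \<sigma>R \<delta>R by (simp add: \<sigma>h \<delta>h hm ha)
    qed
    let ?Fin = "{f :: nat \<Rightarrow> 'a. (\<forall>i. f i \<in> R) \<and> finite {i. f i \<noteq> \<zero>\<^bsub>S\<^esub>}}"
    let ?Fin' = "{f :: nat \<Rightarrow> 'd. (\<forall>i. f i \<in> ?R) \<and> finite {i. f i \<noteq> \<zero>\<^bsub>S'\<^esub>}}"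
    let ?e = "\<lambda>f. \<Oplus>\<^bsub>S\<^esub>i\<in>{i. f i \<noteq> \<zero>\<^bsub>S\<^esub>}. f i \<otimes>\<^bsub>S\<^esub> y [^]\<^bsub>S\<^esub> i"
    let ?e' = "\<lambda>f. \<Oplus>\<^bsub>S'\<^esub>i\<in>{i. f i \<noteq> \<zero>\<^bsub>S'\<^esub>}. f i \<otimes>\<^bsub>S'\<^esub> h y [^]\<^bsub>S'\<^esub> i"
    have k0: "k b = \<zero>\<^bsub>S\<^esub> \<longleftrightarrow> b = \<zero>\<^bsub>S'\<^esub>" if "b \<in> ?R" for b
      using that kh hk h0 RS' by (metis S.zero_closed subsetD)
    have h0': "h a = \<zero>\<^bsub>S'\<^esub> \<longleftrightarrow> a = \<zero>\<^bsub>S\<^esub>" if "a \<in> R" for a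
      using Sc[OF that] inj h0 by (metis S.zero_closed inj_onD)
    have b1: "bij_betw (\<lambda>f i. k (f i)) ?Fin' ?Fin"
    proof (rule bij_betw_byWitness[where f' = "\<lambda>f i. h (f i)"])
      show "\<forall>a\<in>?Fin'. (\<lambda>i. h (k (a i))) = a" using hk RS' by (auto simp: subsetD)
      show "\<forall>a\<in>?Fin. (\<lambda>i. k (h (a i))) = a" using kh Sc by auto
      show "(\<lambda>f i. k (f i)) ` ?Fin' \<subseteq> ?Fin" using kR k0 by auto
      show "(\<lambda>f i. h (f i)) ` ?Fin \<subseteq> ?Fin'" using h0' by auto
    qed
    have b2: "bij_betw ?e ?Fin (carrier S)" using ore by blast
    have "bij_betw (h \<circ> (?e \<circ> (\<lambda>f i. k (f i)))) ?Fin' (carrier S')"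
      by (rule bij_betw_trans[OF bij_betw_trans[OF b1 b2] bij])
    moreover have "(h \<circ> (?e \<circ> (\<lambda>f i. k (f i)))) f = ?e' f" if f: "f \<in> ?Fin'" for f
    proof -
      have supp: "{i. k (f i) \<noteq> \<zero>\<^bsub>S\<^esub>} = {i. f i \<noteq> \<zero>\<^bsub>S'\<^esub>}" using f k0 by auto
      have kf: "k (f i) \<in> carrier S" for i using f kR Sc by auto
      have "h (?e (\<lambda>i. k (f i))) = (\<Oplus>\<^bsub>S'\<^esub>i\<in>{i. f i \<noteq> \<zero>\<^bsub>S'\<^esub>}. h (k (f i) \<otimes>\<^bsub>S\<^esub> y [^]\<^bsub>S\<^esub> i))"
        unfolding supp using f kf y by (intro hsum) auto
      also have "\<dots> = ?e' f"
        using f kf y hc hk RS' by (intro S'.finsum_cong') (auto simp: hm hpow subsetD)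
      finally show ?thesis by simp
    qed
    ultimately show "bij_betw ?e' ?Fin' (carrier S')"
      using bij_betw_cong[of ?Fin' "h \<circ> (?e \<circ> (\<lambda>f i. k (f i)))" ?e' "carrier S'"] by blast
  qed
  then show ?case by (rule iterated_ore_extension.step[OF IH])
qed

section \<open>Minors as sums over permutations\<close>

text \<open>The number of inversions in the form in which the expansion along the first row produces it.\<close>

fun list_inversions :: "nat list \<Rightarrow> nat" where
  "list_inversions [] = 0"
| "list_inversions (j # ws) = card {l \<in> set ws. l < j} + list_inversions ws"

lemma list_inversions_card:
  "distinct ws \<Longrightarrow> list_inversions ws = card {(i, j). i < j \<and> j < length ws \<and> ws ! j < ws ! i}"
proof (induction ws)
  case (Cons a ws)
  let ?P = "\<lambda>ws. {(i, j). i < j \<and> j < length ws \<and> ws ! j < (ws ! i :: nat)}"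
  let ?f = "\<lambda>j. (0 :: nat, Suc j)" and ?g = "\<lambda>(i, j). (Suc i, Suc j)"
  have split: "?P (a # ws) = ?f ` {j. j < length ws \<and> ws ! j < a} \<union> ?g ` ?P ws"
  proof (intro equalityI subsetI)
    fix s assume "s \<in> ?P (a # ws)"
    then obtain i j where s: "s = (i, j)" "i < j" "j < Suc (length ws)" "(a # ws) ! j < (a # ws) ! i" by auto
    then obtain j' where j': "j = Suc j'" by (cases j) auto
    show "s \<in> ?f ` {j. j < length ws \<and> ws ! j < a} \<union> ?g ` ?P ws"
    proof (cases i)
      case 0
      then show ?thesis using s j' by auto
    next
      case (Suc i')
      then have "(i', j') \<in> ?P ws" using s j' by auto
      then show ?thesis using s j' Suc by (intro UnI2) (auto simp: image_iff)
    qed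
  qed auto
  have fin: "finite (?P ws)" by (rule finite_subset[of _ "{..<length ws} \<times> {..<length ws}"]) auto
  have "card (?P (a # ws)) = card (?f ` {j. j < length ws \<and> ws ! j < a}) + card (?g ` ?P ws)"
    unfolding split by (rule card_Un_disjoint) (use fin in auto)
  also have "card (?f ` {j. j < length ws \<and> ws ! j < a}) = card {j. j < length ws \<and> ws ! j < a}"
    by (rule card_image) (auto simp: inj_on_def)
  also have "\<dots> = card ((!) ws ` {j. j < length ws \<and> ws ! j < a})"
    by (rule card_image[symmetric]) (use Cons.prems in \<open>auto simp: inj_on_def nth_eq_iff_index_eq\<close>)
  also have "(!) ws ` {j. j < length ws \<and> ws ! j < a} = {l \<in> set ws. l < a}"
    by (auto simp: in_set_conv_nth)
  also have "card (?g ` ?P ws) = card (?P ws)" by (rule card_image) (auto simp: inj_on_def)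
  finally show ?case using Cons by simp
qed simp

lemma (in kalgebra) qdet_list_sum:
  assumes "finite J" "card J = length is"
  shows "qdet q x is J = (\<Sum>ws\<in>permutations_of_set J.
           (- q) ^ list_inversions ws \<cdot> prod_list (map2 x is ws))"
  using assms
proof (induction "is" arbitrary: J)
  case (Cons i "is")
  have ne: "J \<noteq> {}" using Cons.prems by auto
  have "(\<Sum>ws\<in>permutations_of_set J. (- q) ^ list_inversions ws \<cdot> prod_list (map2 x (i # is) ws)) =
    (\<Sum>j\<in>J. \<Sum>ws\<in>(#) j ` permutations_of_set (J - {j}). (- q) ^ list_inversions ws \<cdot> prod_list (map2 x (i # is) ws))"
    unfolding permutations_of_set_nonempty[OF ne]
    by (rule sum.UNION_disjoint) (use Cons.prems in auto)
  also have "\<dots> = (\<Sum>j\<in>J. (- q) ^ card {l\<in>J. l < j} \<cdot> (x i j * qdet q x is (J - {j})))"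
  proof (rule sum.cong[OF refl])
    fix j assume j: "j \<in> J"
    have inv: "list_inversions (j # ws) = card {l\<in>J. l < j} + list_inversions ws"
      if "ws \<in> permutations_of_set (J - {j})" for ws
    proof -
      have "{l \<in> set ws. l < j} = {l\<in>J. l < j}" using that by (auto dest: permutations_of_setD)
      then show ?thesis by simp
    qed
    have IH: "qdet q x is (J - {j}) = (\<Sum>ws\<in>permutations_of_set (J - {j}).
           (- q) ^ list_inversions ws \<cdot> prod_list (map2 x is ws))"
      by (rule Cons.IH) (use Cons.prems j in auto)
    have "(\<Sum>ws\<in>(#) j ` permutations_of_set (J - {j}). (- q) ^ list_inversions ws \<cdot> prod_list (map2 x (i # is) ws)) =
      (\<Sum>ws\<in>permutations_of_set (J - {j}). (- q) ^ list_inversions (j # ws) \<cdot> prod_list (map2 x (i # is) (j # ws)))"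
      by (subst sum.reindex) auto
    also have "\<dots> = (\<Sum>ws\<in>permutations_of_set (J - {j}). (- q) ^ card {l\<in>J. l < j} \<cdot>
        (x i j * ((- q) ^ list_inversions ws \<cdot> prod_list (map2 x is ws))))"
      by (rule sum.cong[OF refl]) (simp add: inv power_add del: list_inversions.simps)
    also have "\<dots> = (- q) ^ card {l\<in>J. l < j} \<cdot> (x i j * qdet q x is (J - {j}))"
      unfolding IH by (simp add: sum_distrib_left scale_sum_right del: sm_mult_right)
    finally show "(\<Sum>ws\<in>(#) j ` permutations_of_set (J - {j}). (- q) ^ list_inversions ws \<cdot> prod_list (map2 x (i # is) ws)) =
      (- q) ^ card {l\<in>J. l < j} \<cdot> (x i j * qdet q x is (J - {j}))" .
  qed
  finally show ?case by simp
qed simp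

text \<open>A permutation \<open>\<sigma>\<close> corresponds to the arrangement \<open>b\<^sub>\<sigma>\<^sub>(\<^sub>1\<^sub>)\<close>, \<dots>, \<open>b\<^sub>\<sigma>\<^sub>(\<^sub>t\<^sub>)\<close> of \<open>B\<close>, with the same
  inversions because the \<open>b\<^sub>k\<close> increase.\<close>

lemma (in kalgebra) minor_permutations:
  assumes "finite A" "finite B" "card A = card B" and t: "t = card A"
  shows "minor q x A B = (\<Sum>\<sigma>\<in>{\<sigma>. \<sigma> permutes {..<t}}. (- q) ^ perm_length t \<sigma> \<cdot>
     prod_list (map (\<lambda>k. x (sorted_list_of_set A ! k) (sorted_list_of_set B ! \<sigma> k)) [0..<t]))"
proof -
  define as bs where "as = sorted_list_of_set A" and "bs = sorted_list_of_set B"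
  have as: "length as = t" and bs: "length bs = t" "distinct bs" "set bs = B" "sorted_wrt (<) bs"
    using assms by (simp_all add: as_def bs_def strict_sorted_list_of_set)
  define w where "w \<sigma> = map (\<lambda>k. bs ! \<sigma> k) [0..<t]" for \<sigma> :: "nat \<Rightarrow> nat"
  have lt: "\<sigma> k < t" if "\<sigma> permutes {..<t}" "k < t" for \<sigma> k
    using permutes_in_image[OF that(1), of k] that(2) by simp
  have w_in: "w \<sigma> \<in> permutations_of_set B" if "\<sigma> permutes {..<t}" for \<sigma>
  proof (rule permutations_of_setI)
    have im: "\<sigma> ` {..<t} = {..<t}" by (rule permutes_image[OF that])
    have "set (w \<sigma>) = (\<lambda>k. bs ! k) ` (\<sigma> ` {..<t})" unfolding w_def by (auto simp: image_iff)
    also have "\<dots> = B" unfolding im using bs by (auto simp: in_set_conv_nth image_iff)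
    finally show "set (w \<sigma>) = B" .
    show "distinct (w \<sigma>)" unfolding w_def
      using permutes_inj[OF that] lt[OF that] bs by (auto simp: distinct_map inj_on_def nth_eq_iff_index_eq)
  qed
  have inj: "inj_on w {\<sigma>. \<sigma> permutes {..<t}}"
  proof (rule inj_onI)
    fix \<sigma> \<tau> assume \<sigma>\<tau>: "\<sigma> \<in> {\<sigma>. \<sigma> permutes {..<t}}" "\<tau> \<in> {\<sigma>. \<sigma> permutes {..<t}}" "w \<sigma> = w \<tau>"
    have "\<sigma> k = \<tau> k" for k
    proof (cases "k < t")
      case True
      have "w \<sigma> ! k = w \<tau> ! k" using \<sigma>\<tau>(3) by simp
      then show ?thesis using True lt \<sigma>\<tau> bs by (auto simp: w_def nth_eq_iff_index_eq)
    next
      case False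
      then show ?thesis using \<sigma>\<tau> by (simp add: permutes_def)
    qed
    then show "\<sigma> = \<tau>" by auto
  qed
  have "w ` {\<sigma>. \<sigma> permutes {..<t}} = permutations_of_set B"
  proof (rule card_subset_eq)
    show "finite (permutations_of_set B)" by simp
    show "w ` {\<sigma>. \<sigma> permutes {..<t}} \<subseteq> permutations_of_set B" using w_in by auto
    have "card (w ` {\<sigma>. \<sigma> permutes {..<t}}) = fact t"
      using card_permutations[of "{..<t}" t] by (simp add: card_image[OF inj])
    then show "card (w ` {\<sigma>. \<sigma> permutes {..<t}}) = card (permutations_of_set B)"
      using assms by simp
  qed
  then have "minor q x A B = (\<Sum>ws\<in>w ` {\<sigma>. \<sigma> permutes {..<t}}. (- q) ^ list_inversions ws \<cdot> prod_list (map2 x as ws))"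
    unfolding minor_def using assms as by (subst qdet_list_sum) (simp_all add: as_def)
  also have "\<dots> = (\<Sum>\<sigma>\<in>{\<sigma>. \<sigma> permutes {..<t}}. (- q) ^ list_inversions (w \<sigma>) \<cdot> prod_list (map2 x as (w \<sigma>)))"
    by (subst sum.reindex[OF inj]) simp
  also have "\<dots> = (\<Sum>\<sigma>\<in>{\<sigma>. \<sigma> permutes {..<t}}. (- q) ^ perm_length t \<sigma> \<cdot>
     prod_list (map (\<lambda>k. x (as ! k) (bs ! \<sigma> k)) [0..<t]))"
  proof (rule sum.cong[OF refl])
    fix \<sigma> assume "\<sigma> \<in> {\<sigma>. \<sigma> permutes {..<t}}"
    then have \<sigma>: "\<sigma> permutes {..<t}" by simp
    have mono: "bs ! i < bs ! j \<longleftrightarrow> i < j" if "i < t" "j < t" for i j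
      using that bs(1,4) by (metis linorder_neqE_nat order.asym sorted_wrt_nth_less)
    have "list_inversions (w \<sigma>) = card {(i, j). i < j \<and> j < length (w \<sigma>) \<and> w \<sigma> ! j < w \<sigma> ! i}"
      by (rule list_inversions_card) (use w_in[OF \<sigma>] in \<open>auto dest: permutations_of_setD\<close>)
    also have "{(i, j). i < j \<and> j < length (w \<sigma>) \<and> w \<sigma> ! j < w \<sigma> ! i} = {(i, j). i < j \<and> j < t \<and> \<sigma> j < \<sigma> i}"
      using lt[OF \<sigma>] by (auto simp: w_def mono)
    finally have "list_inversions (w \<sigma>) = perm_length t \<sigma>" by (simp add: perm_length_def)
    moreover have "map2 x as (w \<sigma>) = map (\<lambda>k. x (as ! k) (bs ! \<sigma> k)) [0..<t]"
      by (rule nth_equalityI) (auto simp: w_def as)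
    ultimately show "(- q) ^ list_inversions (w \<sigma>) \<cdot> prod_list (map2 x as (w \<sigma>)) =
       (- q) ^ perm_length t \<sigma> \<cdot> prod_list (map (\<lambda>k. x (as ! k) (bs ! \<sigma> k)) [0..<t])" by simp
  qed
  finally show ?thesis by (simp add: as_def bs_def)
qed

section \<open>The free algebra\<close>

text \<open>Multiplication and unit of the free algebra, freed from the record.\<close>

definition conv :: "('x list \<Rightarrow> 'k::field) \<Rightarrow> ('x list \<Rightarrow> 'k) \<Rightarrow> 'x list \<Rightarrow> 'k" where
  "conv f g = (\<lambda>w. \<Sum>i\<le>length w. f (take i w) * g (drop i w))"

definition word_one :: "'x list \<Rightarrow> 'k::field" where
  "word_one = (\<lambda>w. if w = [] then 1 else 0)"

lemma free_algebra_simps: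
  "carrier (free_algebra X) = {f. finite {w. f w \<noteq> 0} \<and> {w. f w \<noteq> 0} \<subseteq> lists X}"
  "f \<otimes>\<^bsub>free_algebra X\<^esub> g = conv f g" "\<one>\<^bsub>free_algebra X\<^esub> = word_one"
  "\<zero>\<^bsub>free_algebra X\<^esub> = (\<lambda>w. 0)" "f \<oplus>\<^bsub>free_algebra X\<^esub> g = (\<lambda>w. f w + g w)"
  "c \<odot>\<^bsub>free_algebra X\<^esub> f = (\<lambda>w. c * f w)"
  by (simp_all add: free_algebra_def conv_def word_one_def)

text \<open>Both sides are sums over the factorizations of a word into three factors.\<close>

lemma conv_assoc:
  fixes f g h :: "'x list \<Rightarrow> 'k::field"
  shows "conv (conv f g) h = conv f (conv g h)"
proof
  fix w :: "'x list"
  let ?n = "length w"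
  define G where "G i d = f (take i w) * (g (take d (drop i w)) * h (drop (i + d) w))" for i d
  have "conv (conv f g) h w = (\<Sum>k\<le>?n. \<Sum>i\<le>k. G i (k - i))"
    unfolding conv_def
  proof (intro sum.cong refl)
    fix k assume k: "k \<in> {..?n}"
    have "(\<Sum>i\<le>length (take k w). f (take i (take k w)) * g (drop i (take k w))) * h (drop k w) =
      (\<Sum>i\<le>k. f (take i (take k w)) * g (drop i (take k w)) * h (drop k w))"
      using k by (simp add: sum_distrib_right min_absorb2)
    also have "\<dots> = (\<Sum>i\<le>k. G i (k - i))"
      by (intro sum.cong refl) (simp add: G_def drop_take min_absorb1 mult.assoc)
    finally show "(\<Sum>i\<le>length (take k w). f (take i (take k w)) * g (drop i (take k w))) * h (drop k w) =
      (\<Sum>i\<le>k. G i (k - i))" .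
  qed
  also have "\<dots> = (\<Sum>(i, d)\<in>{(i, d). i + d \<le> ?n}. G i d)"
    by (rule sum.triangle_reindex_eq[symmetric])
  also have "{(i, d). i + d \<le> ?n} = Sigma {..?n} (\<lambda>i. {..?n - i})" by auto
  also have "(\<Sum>(i, d)\<in>Sigma {..?n} (\<lambda>i. {..?n - i}). G i d) = (\<Sum>i\<le>?n. \<Sum>d\<le>?n - i. G i d)"
    by (rule sum.Sigma[symmetric]) auto
  also have "\<dots> = conv f (conv g h) w"
    unfolding conv_def by (simp add: G_def sum_distrib_left add.commute)
  finally show "conv (conv f g) h w = conv f (conv g h) w" .
qed

lemma conv_one_left [simp]: "conv word_one f = f"
proof
  fix w
  have "conv word_one f w = (\<Sum>i\<le>length w. if i = 0 then f w else 0)"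
    unfolding conv_def word_one_def by (intro sum.cong refl) auto
  then show "conv word_one f w = f w" by simp
qed

lemma conv_one_right [simp]: "conv f word_one = f"
proof
  fix w
  have "conv f word_one w = (\<Sum>i\<le>length w. if i = length w then f w else 0)"
    unfolding conv_def word_one_def by (intro sum.cong refl) auto
  then show "conv f word_one w = f w" by simp
qed

lemma conv_add_left: "conv (\<lambda>w. f w + g w) h = (\<lambda>w. conv f h w + conv g h w)"
  and conv_add_right: "conv h (\<lambda>w. f w + g w) = (\<lambda>w. conv h f w + conv h g w)"
  and conv_diff_right: "conv h (\<lambda>w. f w - g w) = (\<lambda>w. conv h f w - conv h g w)"
  and conv_diff_left: "conv (\<lambda>w. f w - g w) h = (\<lambda>w. conv f h w - conv g h w)"
  and conv_scale_left: "conv (\<lambda>w. c * f w) h = (\<lambda>w. c * conv f h w)"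
  and conv_scale_right: "conv h (\<lambda>w. c * f w) = (\<lambda>w. c * conv h f w)"
  by (auto simp: conv_def fun_eq_iff algebra_simps sum.distrib sum_subtractf sum_distrib_left)

lemma conv_support:
  "{w. conv f g w \<noteq> 0} \<subseteq> (\<lambda>(a, b). a @ b) ` ({w. f w \<noteq> 0} \<times> {w. g w \<noteq> 0})"
proof
  fix w assume "w \<in> {w. conv f g w \<noteq> 0}"
  then obtain i where "f (take i w) * g (drop i w) \<noteq> 0"
    unfolding conv_def by (metis (mono_tags, lifting) mem_Collect_eq sum.neutral)
  then have "(take i w, drop i w) \<in> {w. f w \<noteq> 0} \<times> {w. g w \<noteq> 0}" by auto
  then show "w \<in> (\<lambda>(a, b). a @ b) ` ({w. f w \<noteq> 0} \<times> {w. g w \<noteq> 0})"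
    by (intro image_eqI[of _ _ "(take i w, drop i w)"]) auto
qed

lemma conv_closed:
  assumes "f \<in> carrier (free_algebra X)" "g \<in> carrier (free_algebra X)"
  shows "conv f g \<in> carrier (free_algebra X)"
proof -
  let ?S = "(\<lambda>(a, b). a @ b) ` ({w. f w \<noteq> 0} \<times> {w. g w \<noteq> 0})"
  have "finite ?S" using assms by (simp add: free_algebra_simps)
  moreover have "?S \<subseteq> lists X"
    using assms unfolding free_algebra_simps(1) by (auto simp: in_lists_conv_set subset_iff)
  ultimately show ?thesis unfolding free_algebra_simps(1) mem_Collect_eq
    using conv_support[of f g] by (metis (no_types, lifting) finite_subset subset_trans)
qed

lemma free_algebra_closed:
  assumes "f \<in> carrier (free_algebra X)" "g \<in> carrier (free_algebra X)"
  shows "(\<lambda>w. f w + g w) \<in> carrier (free_algebra X)" "(\<lambda>w. f w - g w) \<in> carrier (free_algebra X)"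
    "(\<lambda>w. c * f w) \<in> carrier (free_algebra X)"
proof -
  have fin: "finite ({w. f w \<noteq> 0} \<union> {w. g w \<noteq> 0})" "{w. f w \<noteq> 0} \<union> {w. g w \<noteq> 0} \<subseteq> lists X"
    using assms by (auto simp: free_algebra_simps)
  have "{w. f w + g w \<noteq> 0} \<subseteq> {w. f w \<noteq> 0} \<union> {w. g w \<noteq> 0}"
    "{w. f w - g w \<noteq> 0} \<subseteq> {w. f w \<noteq> 0} \<union> {w. g w \<noteq> 0}"
    "{w. c * f w \<noteq> 0} \<subseteq> {w. f w \<noteq> 0} \<union> {w. g w \<noteq> 0}" by auto
  note * = this[THEN finite_subset, OF fin(1)] this[THEN subset_trans, OF fin(2)]
  show "(\<lambda>w. f w + g w) \<in> carrier (free_algebra X)" "(\<lambda>w. f w - g w) \<in> carrier (free_algebra X)"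
    "(\<lambda>w. c * f w) \<in> carrier (free_algebra X)"
    using * unfolding free_algebra_simps by simp_all
qed

lemma word_one_closed: "word_one \<in> carrier (free_algebra X)"
  and zero_closed: "(\<lambda>w. 0) \<in> carrier (free_algebra X)"
  by (auto simp: free_algebra_simps word_one_def)

lemma free_gen_closed: "j \<in> X \<Longrightarrow> free_gen j \<in> carrier (free_algebra X)"
  by (auto simp: free_algebra_simps free_gen_def)

lemma ring_free_algebra: "ring (free_algebra X)"
proof (rule ringI)
  show "abelian_group (free_algebra X)"
  proof (rule abelian_groupI)
    fix f assume "f \<in> carrier (free_algebra X)"
    then show "\<exists>g\<in>carrier (free_algebra X). g \<oplus>\<^bsub>free_algebra X\<^esub> f = \<zero>\<^bsub>free_algebra X\<^esub>"
      using free_algebra_closed(3)[of f X f "-1"]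
      by (intro bexI[of _ "\<lambda>w. -1 * f w"]) (auto simp: free_algebra_simps(2-))
  qed (auto simp: free_algebra_simps(2-) add_ac intro: free_algebra_closed zero_closed)
  show "monoid (free_algebra X)"
    by (rule monoidI) (auto simp: free_algebra_simps(2-) conv_assoc intro: conv_closed word_one_closed)
qed (auto simp: free_algebra_simps(2-) conv_add_left conv_add_right)

lemma free_algebra_minus:
  assumes "f \<in> carrier (free_algebra X)" "g \<in> carrier (free_algebra X)"
  shows "f \<ominus>\<^bsub>free_algebra X\<^esub> g = (\<lambda>w. f w - g w)"
proof -
  interpret F: ring "free_algebra X" by (rule ring_free_algebra)
  have "\<ominus>\<^bsub>free_algebra X\<^esub> g = (\<lambda>w. - g w)"
    using free_algebra_closed(3)[OF assms(2,2), of "-1"] assms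
    by (intro F.minus_equality) (auto simp: free_algebra_simps(2-))
  then show ?thesis by (simp add: a_minus_def free_algebra_simps(2-))
qed

lemma conv_pairs:
  assumes "finite A" "finite B" "{w. f w \<noteq> 0} \<subseteq> A" "{w. g w \<noteq> 0} \<subseteq> B"
  shows "conv f g w = (\<Sum>a\<in>A. \<Sum>b\<in>B. if a @ b = w then f a * g b else 0)"
proof -
  let ?s = "\<lambda>i. (take i w, drop i w)"
  let ?t = "\<lambda>p. f (fst p) * g (snd p)"
  have inj: "inj_on ?s {..length w}"
  proof (rule inj_onI)
    fix i j assume "i \<in> {..length w}" "j \<in> {..length w}" "?s i = ?s j"
    then have "length (take i w) = length (take j w)" by simp
    then show "i = j" using \<open>i \<in> {..length w}\<close> \<open>j \<in> {..length w}\<close> by (simp add: min_absorb2)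
  qed
  have im: "?s ` {..length w} = {p. fst p @ snd p = w}"
  proof (intro equalityI subsetI)
    fix p assume "p \<in> {p. fst p @ snd p = w}"
    then show "p \<in> ?s ` {..length w}"
      by (intro image_eqI[of _ _ "length (fst p)"]) (auto simp: prod_eq_iff)
  qed auto
  have "conv f g w = (\<Sum>p\<in>{p. fst p @ snd p = w}. ?t p)"
    unfolding conv_def im[symmetric] by (subst sum.reindex[OF inj]) simp
  also have "\<dots> = (\<Sum>p\<in>{p \<in> A \<times> B. fst p @ snd p = w}. ?t p)"
  proof (rule sum.mono_neutral_right)
    show "finite {p. fst p @ snd p = w}" unfolding im[symmetric] by simp
    show "\<forall>p\<in>{p. fst p @ snd p = w} - {p \<in> A \<times> B. fst p @ snd p = w}. ?t p = 0"
      using assms(3,4) by (auto simp: mem_Times_iff)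
  qed auto
  also have "\<dots> = (\<Sum>p\<in>A \<times> B. if fst p @ snd p = w then ?t p else 0)"
    using assms by (intro sum.inter_filter) simp
  also have "\<dots> = (\<Sum>a\<in>A. \<Sum>b\<in>B. if a @ b = w then f a * g b else 0)"
    by (subst sum.cartesian_product) (auto intro: sum.cong)
  finally show ?thesis .
qed

lemma word_one_Nil: "word_one [] = 1"
  by (simp add: word_one_def)

subsection \<open>Evaluation\<close>

context kalgebra
begin

text \<open>The homomorphism of the free algebra given by the images of the generators.\<close>

definition ev :: "('x \<Rightarrow> 'a) \<Rightarrow> ('x list \<Rightarrow> 'k) \<Rightarrow> 'a" where
  "ev y u = (\<Sum>w\<in>{w. u w \<noteq> 0}. u w \<cdot> prod_list (map y w))"

lemma ev_superset:
  assumes "finite S" "{w. u w \<noteq> 0} \<subseteq> S"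
  shows "ev y u = (\<Sum>w\<in>S. u w \<cdot> prod_list (map y w))"
  unfolding ev_def by (rule sum.mono_neutral_left) (use assms in auto)

lemma ev_add:
  assumes "f \<in> carrier (free_algebra X)" "g \<in> carrier (free_algebra X)"
  shows "ev y (\<lambda>w. f w + g w) = ev y f + ev y g"
proof -
  let ?S = "{w. f w \<noteq> 0} \<union> {w. g w \<noteq> 0}"
  have S: "finite ?S" using assms by (auto simp: free_algebra_simps)
  have "ev y (\<lambda>w. f w + g w) = (\<Sum>w\<in>?S. (f w + g w) \<cdot> prod_list (map y w))"
    by (rule ev_superset[OF S]) auto
  also have "\<dots> = (\<Sum>w\<in>?S. f w \<cdot> prod_list (map y w)) + (\<Sum>w\<in>?S. g w \<cdot> prod_list (map y w))"
    by (simp add: scale_left_distrib sum.distrib)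
  also have "\<dots> = ev y f + ev y g"
    by (intro arg_cong2[where f = "(+)"] ev_superset[OF S, symmetric]) auto
  finally show ?thesis .
qed

lemma ev_scale:
  assumes "f \<in> carrier (free_algebra X)"
  shows "ev y (\<lambda>w. c * f w) = c \<cdot> ev y f"
proof -
  have "ev y (\<lambda>w. c * f w) = (\<Sum>w\<in>{w. f w \<noteq> 0}. (c * f w) \<cdot> prod_list (map y w))"
    by (rule ev_superset) (use assms in \<open>auto simp: free_algebra_simps\<close>)
  then show ?thesis by (simp add: ev_def scale_sum_right)
qed

lemma ev_diff:
  assumes "f \<in> carrier (free_algebra X)" "g \<in> carrier (free_algebra X)"
  shows "ev y (\<lambda>w. f w - g w) = ev y f - ev y g"
  using ev_add[OF assms(1) free_algebra_closed(3)[OF assms(2,2), of "-1"], of y] ev_scale[OF assms(2), of y "-1"]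
  by simp

lemma ev_conv:
  assumes "f \<in> carrier (free_algebra X)" "g \<in> carrier (free_algebra X)"
  shows "ev y (conv f g) = ev y f * ev y g"
proof -
  let ?A = "{w. f w \<noteq> 0}" and ?B = "{w. g w \<noteq> 0}" and ?Y = "\<lambda>w. prod_list (map y w)"
  let ?C = "(\<lambda>(a, b). a @ b) ` (?A \<times> ?B)"
  have fin: "finite ?A" "finite ?B" using assms by (auto simp: free_algebra_simps)
  have "ev y (conv f g) = (\<Sum>w\<in>?C. conv f g w \<cdot> ?Y w)"
    by (rule ev_superset) (use fin conv_support in auto)
  also have "\<dots> = (\<Sum>w\<in>?C. \<Sum>a\<in>?A. \<Sum>b\<in>?B. if a @ b = w then (f a * g b) \<cdot> ?Y w else 0)"
    unfolding conv_pairs[OF fin order.refl order.refl] scale_sum_left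
    by (intro sum.cong refl) auto
  also have "\<dots> = (\<Sum>a\<in>?A. \<Sum>b\<in>?B. \<Sum>w\<in>?C. if a @ b = w then (f a * g b) \<cdot> ?Y w else 0)"
    by (rule trans[OF sum.swap sum.cong[OF refl sum.swap]])
  also have "\<dots> = (\<Sum>a\<in>?A. \<Sum>b\<in>?B. (f a \<cdot> ?Y a) * (g b \<cdot> ?Y b))"
  proof (intro sum.cong refl)
    fix a b assume ab: "a \<in> ?A" "b \<in> ?B"
    have "finite ?C" "a @ b \<in> ?C" using fin ab by auto
    then show "(\<Sum>w\<in>?C. if a @ b = w then (f a * g b) \<cdot> ?Y w else 0) = (f a \<cdot> ?Y a) * (g b \<cdot> ?Y b)"
      by (subst sum.delta') (simp_all add: mult.commute)
  qed
  also have "\<dots> = ev y f * ev y g" by (simp only: ev_def sum_product)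
  finally show ?thesis .
qed

lemma ev_one: "ev y word_one = 1"
  by (subst ev_superset[of "{[]}"]) (auto simp: word_one_def)

lemma ev_gen: "ev y (free_gen j) = y j"
  by (subst ev_superset[of "{[j]}"]) (auto simp: free_gen_def)

lemma ev_in: "ev y u \<in> gsub (range y)"
proof -
  have "prod_list (map y w) \<in> gsub (range y)" for w
    by (induction w) (auto intro: gsub.intros)
  then show ?thesis unfolding ev_def by (intro gsub_sum gsub.scale)
qed

lemma ev_ring_hom: 
  fixes y :: "'x \<Rightarrow> 'a" shows "ring_hom_ring (free_algebra X) (alg_rec (gsub (range y))) (ev y)"
proof -
  interpret F: ring "free_algebra X :: ('k, 'x list \<Rightarrow> 'k) module" by (rule ring_free_algebra)
  interpret A: assoc_algebra "alg_rec (gsub (range y))" by (rule assoc_algebra_alg_rec)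
  show ?thesis
  proof (rule ring_hom_ringI2[OF F.ring_axioms A.ring_axioms], rule ring_hom_memI)
    fix f g :: "'x list \<Rightarrow> 'k"
    assume *: "f \<in> carrier (free_algebra X)" "g \<in> carrier (free_algebra X)"
    show "ev y (f \<otimes>\<^bsub>free_algebra X\<^esub> g) = ev y f \<otimes>\<^bsub>alg_rec (gsub (range y))\<^esub> ev y g"
      unfolding free_algebra_simps(2) by (simp add: ev_conv[OF *])
    show "ev y (f \<oplus>\<^bsub>free_algebra X\<^esub> g) = ev y f \<oplus>\<^bsub>alg_rec (gsub (range y))\<^esub> ev y g"
      unfolding free_algebra_simps(5) by (simp add: ev_add[OF *])
  next
    fix f :: "'x list \<Rightarrow> 'k"
    show "ev y f \<in> carrier (alg_rec (gsub (range y)))" by (simp add: ev_in)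
  next
    show "ev y \<one>\<^bsub>free_algebra X\<^esub> = \<one>\<^bsub>alg_rec (gsub (range y))\<^esub>"
      unfolding free_algebra_simps(3) by (simp add: ev_one)
  qed
qed

text \<open>The kernel is an ideal of the free algebra; it is a kernel in the sense of the algebraic
  hierarchy after restricting the target to a record algebra.\<close>

lemma ev_ideal:
  assumes "\<And>r. r \<in> Rel \<Longrightarrow> r \<in> carrier (free_algebra X) \<and> ev y r = 0"
    and "u \<in> genideal (free_algebra X) Rel"
  shows "ev y u = 0"
proof -
  interpret H: ring_hom_ring "free_algebra X" "alg_rec (gsub (range y))" "ev y" by (rule ev_ring_hom)
  have "genideal (free_algebra X) Rel \<subseteq> a_kernel (free_algebra X) (alg_rec (gsub (range y))) (ev y)"
  proof (rule H.R.genideal_minimal[OF H.kernel_is_ideal], rule subsetI)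
    fix r assume "r \<in> Rel"
    from assms(1)[OF this] show "r \<in> a_kernel (free_algebra X) (alg_rec (gsub (range y))) (ev y)"
      unfolding a_kernel_def' by simp
  qed
  then have "u \<in> a_kernel (free_algebra X) (alg_rec (gsub (range y))) (ev y)" using assms(2) by (rule subsetD)
  then show ?thesis unfolding a_kernel_def' by simp
qed

end

lemma kalgebra_field: "kalgebra ((*) :: 'k::field \<Rightarrow> 'k \<Rightarrow> 'k)"
  by standard (auto simp: algebra_simps)

section \<open>A faithful representation of a presented algebra\<close>

text \<open>The relations are assumed to have no constant term. This keeps the representation below
  simple, because the constant term is then a character of the presented algebra.\<close>

locale presented_algebra =
  fixes X :: "'x set" and Rel :: "('x list \<Rightarrow> 'k::field) set"
  assumes Rel: "r \<in> Rel \<Longrightarrow> r \<in> carrier (free_algebra X)" and Rel_augmented: "r \<in> Rel \<Longrightarrow> r [] = 0"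
begin

abbreviation F where "F \<equiv> free_algebra X :: ('k, 'x list \<Rightarrow> 'k) module"
abbreviation I where "I \<equiv> genideal F Rel"

sublocale F: ring F by (rule ring_free_algebra)

sublocale I: ideal I F using Rel by (intro F.genideal_ideal) auto

lemma I_in_F: "u \<in> I \<Longrightarrow> u \<in> carrier F" by (rule I.Icarr)

lemma I_add: "u \<in> I \<Longrightarrow> v \<in> I \<Longrightarrow> (\<lambda>w. u w + v w) \<in> I"
  using I.a_closed by (simp add: free_algebra_simps(2-))

lemma I_left: "u \<in> I \<Longrightarrow> v \<in> carrier F \<Longrightarrow> conv v u \<in> I"
  using I.I_l_closed by (simp add: free_algebra_simps(2-))

lemma I_scale: "u \<in> I \<Longrightarrow> (\<lambda>w. c * u w) \<in> I"
  using I_left[OF _ free_algebra_closed(3)[OF word_one_closed word_one_closed], of u c] 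
  by (simp add: conv_scale_left)

lemma I_zero: "(\<lambda>w. 0) \<in> I"
  using I.zero_closed by (simp add: free_algebra_simps(2-))

lemma I_augmented:
  assumes "u \<in> I" shows "u [] = 0"
proof -
  interpret K: kalgebra "(*) :: 'k \<Rightarrow> 'k \<Rightarrow> 'k" by (rule kalgebra_field)
  have ev0: "K.ev (\<lambda>_. 0) f = f []" if "f \<in> carrier F" for f
  proof -
    have "K.ev (\<lambda>_. 0) f = (\<Sum>w\<in>insert [] {w. f w \<noteq> 0}. f w * prod_list (map (\<lambda>_. 0) w))"
      by (rule K.ev_superset) (use that in \<open>auto simp: free_algebra_simps\<close>)
    also have "\<dots> = (\<Sum>w\<in>insert [] {w. f w \<noteq> 0}. if w = [] then f [] else 0)"
      by (intro sum.cong refl) (auto simp: neq_Nil_conv)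
    also have "\<dots> = f []" using that by (subst sum.delta) (auto simp: free_algebra_simps)
    finally show ?thesis .
  qed
  have "K.ev (\<lambda>_. 0) u = 0"
  proof (rule K.ev_ideal[OF _ assms])
    fix r assume "r \<in> Rel"
    then show "r \<in> carrier F \<and> K.ev (\<lambda>_. 0) r = 0" using Rel[of r] Rel_augmented[of r] ev0[of r] by simp
  qed
  then show ?thesis unfolding ev0[OF I_in_F[OF assms]] .
qed

text \<open>\<open>E\<close> is the projection onto a linear complement of the ideal inside the free algebra,
  preceded by an arbitrary linear projection of all functions on words onto the free algebra. Thus
  \<open>E u\<close> is a representative of the coset of \<open>u\<close> that depends only on the coset.\<close>

lemma ex_normal_form:
  "\<exists>E. (\<forall>f g. E (\<lambda>w. f w + g w) = (\<lambda>w. E f w + E g w)) \<and> (\<forall>c f. E (\<lambda>w. c * f w) = (\<lambda>w. c * E f w)) \<and>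
     (\<forall>f. E f \<in> carrier F) \<and> (\<forall>u\<in>carrier F. (\<lambda>w. u w - E u w) \<in> I) \<and> (\<forall>u\<in>I. E u = (\<lambda>w. 0)) \<and>
     (\<forall>f. E (E f) = E f)"
proof -
  define sc where "sc = (\<lambda>(c :: 'k) (f :: 'x list \<Rightarrow> 'k) w. c * f w)"
  interpret V: vector_space sc
    by standard (auto simp: sc_def fun_eq_iff algebra_simps)
  interpret VV: vector_space_pair sc sc ..
  have plus: "f + g = (\<lambda>w. f w + g w)" and zero: "(0 :: 'x list \<Rightarrow> 'k) = (\<lambda>w. 0)" for f g :: "'x list \<Rightarrow> 'k"
    by (auto simp: fun_eq_iff)
  have "V.subspace (carrier F)"
    by (rule V.subspaceI) (unfold plus zero sc_def, auto intro: free_algebra_closed zero_closed)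
  from VV.linear_exists_left_inverse_on[OF V.linear_id this]
  obtain R where R: "range R \<subseteq> carrier F" "Vector_Spaces.linear sc sc R" "\<And>v. v \<in> carrier F \<Longrightarrow> R v = v"
    by auto
  have "V.subspace I"
    by (rule V.subspaceI) (unfold plus zero sc_def, auto intro: I_add I_scale I_zero)
  from VV.linear_exists_left_inverse_on[OF V.linear_id this]
  obtain P where P: "range P \<subseteq> I" "Vector_Spaces.linear sc sc P" "\<And>v. v \<in> I \<Longrightarrow> P v = v"
    by auto
  interpret R: Vector_Spaces.linear sc sc R by fact
  interpret P: Vector_Spaces.linear sc sc P by fact
  \<comment> \<open>\<open>R\<close> is a projection onto the free algebra, \<open>P\<close> one onto the ideal\<close>
  define E where "E f = (\<lambda>w. R f w - P (R f) w)" for f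
  have E': "E f = R f - P (R f)" for f by (auto simp: E_def fun_eq_iff)
  have EF: "E f \<in> carrier F" for f
    unfolding E_def
  proof (rule free_algebra_closed(2))
    show "R f \<in> carrier F" using R(1) by blast
    have "P (R f) \<in> I" using P(1) by blast
    then show "P (R f) \<in> carrier F" by (rule I_in_F)
  qed
  show ?thesis
  proof (intro exI[of _ E] conjI allI ballI)
    fix f g
    show "E (\<lambda>w. f w + g w) = (\<lambda>w. E f w + E g w)"
      unfolding plus[symmetric] unfolding E' by (simp add: R.add P.add fun_eq_iff)
    show "E f \<in> carrier F" by (rule EF)
    show "E (E f) = E f"
    proof -
      have "R (E f) = E f" by (rule R(3)[OF EF])
      moreover have "P (P (R f)) = P (R f)" using P(1) by (intro P(3)) blast
      then have "P (E f) = 0" unfolding E' by (simp add: P.diff)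
      ultimately show ?thesis by (simp add: E'[of "E f"])
    qed
  next
    fix c f
    have "E (sc c f) = sc c (E f)" unfolding E' by (simp add: R.scale P.scale V.scale_right_diff_distrib)
    then show "E (\<lambda>w. c * f w) = (\<lambda>w. c * E f w)" by (simp add: sc_def)
  next
    fix u assume "u \<in> carrier F"
    then have "(\<lambda>w. u w - E u w) = P u" by (auto simp: E_def R(3) fun_eq_iff)
    then show "(\<lambda>w. u w - E u w) \<in> I" using P(1) by auto
  next
    fix u assume "u \<in> I"
    then show "E u = (\<lambda>w. 0)" by (simp add: E_def R(3) P(3) I_in_F)
  qed
qed

definition E :: "('x list \<Rightarrow> 'k) \<Rightarrow> ('x list \<Rightarrow> 'k)" where
  "E = (SOME E. (\<forall>f g. E (\<lambda>w. f w + g w) = (\<lambda>w. E f w + E g w)) \<and> (\<forall>c f. E (\<lambda>w. c * f w) = (\<lambda>w. c * E f w)) \<and>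
     (\<forall>f. E f \<in> carrier F) \<and> (\<forall>u\<in>carrier F. (\<lambda>w. u w - E u w) \<in> I) \<and> (\<forall>u\<in>I. E u = (\<lambda>w. 0)) \<and>
     (\<forall>f. E (E f) = E f))"

lemma E_add: "E (\<lambda>w. f w + g w) = (\<lambda>w. E f w + E g w)" and E_scale: "E (\<lambda>w. c * f w) = (\<lambda>w. c * E f w)"
  and E_in: "E f \<in> carrier F" and E_cong: "u \<in> carrier F \<Longrightarrow> (\<lambda>w. u w - E u w) \<in> I"
  and E_I: "u \<in> I \<Longrightarrow> E u = (\<lambda>w. 0)" and E_E: "E (E f) = E f"
  using someI_ex[OF ex_normal_form] unfolding E_def[symmetric] by blast+

lemma E_diff: "E (\<lambda>w. f w - g w) = (\<lambda>w. E f w - E g w)"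
  using E_add[of f "\<lambda>w. - 1 * g w"] E_scale[of "- 1" g] by simp

lemma E_conv_E:
  assumes "u \<in> carrier F" "v \<in> carrier F" shows "E (conv u (E v)) = E (conv u v)"
proof -
  have "E (conv u (\<lambda>w. v w - E v w)) = (\<lambda>w. 0)"
    using E_I I_left E_cong assms by blast
  then show ?thesis unfolding conv_diff_right E_diff by (auto simp: fun_eq_iff)
qed

text \<open>The left multiplication by \<open>u\<close> on normal forms, extended to all functions on words by
  letting \<open>u\<close> act on the complement of the range of \<open>E\<close> through its constant term. The second
  summand makes the representation unital.\<close>

definition iota :: "('x list \<Rightarrow> 'k) \<Rightarrow> ('x list, 'k) rop" where
  "iota u = Rop (\<lambda>f w. E (conv u (E f)) w + u [] * (f w - E f w))"

lemma rapp_iota: "rapp (iota u) f = (\<lambda>w. E (conv u (E f)) w + u [] * (f w - E f w))"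
proof -
  have "E (\<lambda>w. f w * a) = (\<lambda>w. E f w * a)" for f a using E_scale[of a f] by (simp add: mult.commute)
  moreover have "conv u (\<lambda>w. f w * a) = (\<lambda>w. conv u f w * a)" for f a
    using conv_scale_right[of u a f] by (simp add: mult.commute)
  ultimately show ?thesis unfolding iota_def
    by (subst Rop_inverse) (simp_all add: E_add conv_add_right algebra_simps)
qed

abbreviation LS :: "'k \<Rightarrow> ('x list, 'k) rop \<Rightarrow> ('x list, 'k) rop" where
  "LS \<equiv> kalgebra.rsm (*)"

lemma rapp_LS: "rapp (LS c T) f w = c * rapp T f w"
  by (rule kalgebra.rapp_rsm[OF kalgebra_field])

lemma kalgebra_LS: "kalgebra LS"
  by (rule kalgebra.kalgebra_rsm[OF kalgebra_field])

lemma iota_add: "iota (\<lambda>w. u w + v w) = iota u + iota v"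
  by (rule rop_eqI) (simp add: rapp_iota conv_add_left E_add algebra_simps)

lemma iota_scale: "iota (\<lambda>w. c * u w) = LS c (iota u)"
  by (rule rop_eqI) (simp add: rapp_iota rapp_LS conv_scale_left E_scale algebra_simps)

lemma iota_diff: "iota (\<lambda>w. u w - v w) = iota u - iota v"
  by (rule rop_eqI) (simp add: rapp_iota conv_diff_left E_diff algebra_simps)

lemma iota_one: "iota word_one = 1"
  by (rule rop_eqI) (simp add: rapp_iota E_E word_one_Nil)

lemma iota_mult:
  assumes "u \<in> carrier F" "v \<in> carrier F"
  shows "iota (conv u v) = iota u * iota v"
proof (rule rop_eqI)
  fix f w
  let ?g = "rapp (iota v) f"
  have "E ?g = (\<lambda>w. E (E (conv v (E f))) w + v [] * (E f w - E (E f) w))"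
    unfolding rapp_iota E_add E_scale E_diff ..
  then have Eg: "E ?g = E (conv v (E f))" by (simp add: E_E)
  have "E (conv u (E ?g)) = E (conv u (conv v (E f)))"
    unfolding Eg by (intro E_conv_E assms conv_closed E_in)
  moreover have "?g w - E ?g w = v [] * (f w - E f w)" unfolding Eg by (simp add: rapp_iota)
  moreover have "conv u v [] = u [] * v []" by (simp add: conv_def)
  ultimately show "rapp (iota (conv u v)) f w = rapp (iota u * iota v) f w"
    by (simp add: rapp_iota[of u] rapp_iota[of "conv u v"] conv_assoc)
qed

text \<open>Faithfulness is seen on the word \<open>[]\<close>: if \<open>u\<close> acts as zero, then \<open>E u\<close> is a multiple of
  \<open>1 - E 1\<close>, which lies in the ideal.\<close>

lemma iota_eq_0_iff:
  assumes "u \<in> carrier F" shows "iota u = 0 \<longleftrightarrow> u \<in> I"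
proof
  assume "u \<in> I"
  have "E (conv u (E f)) = (\<lambda>w. 0)" for f
    using E_I I.I_r_closed[OF \<open>u \<in> I\<close> E_in] by (simp add: free_algebra_simps(2-))
  then show "iota u = 0" using I_augmented[OF \<open>u \<in> I\<close>]
    by (intro rop_eqI) (simp add: rapp_iota)
next
  assume "iota u = 0"
  then have "rapp (iota u) word_one = (\<lambda>w. 0)" by (auto simp: fun_eq_iff)
  then have "E u w + u [] * (word_one w - E word_one w) = 0" for w
    using E_conv_E[OF assms word_one_closed] by (simp add: rapp_iota fun_eq_iff)
  then have "E u = (\<lambda>w. - u [] * (word_one w - E word_one w))"
    by (auto simp: fun_eq_iff eq_neg_iff_add_eq_0)
  then have "E u \<in> I" using I_scale[OF E_cong[OF word_one_closed], of "- u []"] by (simp only:)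
  from I_add[OF E_cong[OF assms] this] show "u \<in> I" by simp
qed

lemma iota_eq:
  assumes "u \<in> carrier F" "v \<in> carrier F" "iota u = iota v"
  shows "(\<lambda>w. u w - v w) \<in> I"
proof -
  interpret L: kalgebra LS by (rule kalgebra_LS)
  have "iota (\<lambda>w. u w + - 1 * v w) = iota u + LS (- 1) (iota v)" by (simp only: iota_add iota_scale)
  then have "iota (\<lambda>w. u w - v w) = 0" using assms by simp
  then show ?thesis using iota_eq_0_iff free_algebra_closed(2) assms by blast
qed

text \<open>Elements with equal image under \<open>iota\<close> differ by an element of the ideal, on which the
  evaluation vanishes.\<close>

lemma hom_of_relations:
  assumes sm: "kalgebra sm" and rel: "\<And>r. r \<in> Rel \<Longrightarrow> kalgebra.ev sm y r = 0"
  shows "\<exists>\<phi>. kalgebra.alg_hom LS sm (iota ` carrier F) \<phi> \<and> (\<forall>u\<in>carrier F. \<phi> (iota u) = kalgebra.ev sm y u)"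
proof -
  interpret B: kalgebra sm by fact
  interpret L: kalgebra LS by (rule kalgebra_LS)
  define \<phi> where "\<phi> t = B.ev y (SOME u. u \<in> carrier F \<and> iota u = t)" for t
  have \<phi>: "\<phi> (iota u) = B.ev y u" if "u \<in> carrier F" for u
  proof -
    define v where "v = (SOME v. v \<in> carrier F \<and> iota v = iota u)"
    have v: "v \<in> carrier F \<and> iota v = iota u"
      unfolding v_def by (rule someI[of _ u]) (use that in simp)
    then have "(\<lambda>w. v w - u w) \<in> I" using iota_eq that by blast
    then have "B.ev y (\<lambda>w. v w - u w) = 0" by (rule B.ev_ideal[rotated]) (use rel Rel in auto)
    then show ?thesis using B.ev_diff[of v X u y] v that by (simp add: \<phi>_def v_def[symmetric])
  qed
  have "L.alg_hom sm (iota ` carrier F) \<phi>"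
    unfolding L.alg_hom_def
  proof (intro conjI allI ballI)
    show "\<phi> 1 = 1" using \<phi>[OF word_one_closed] by (simp add: iota_one B.ev_one)
    fix c a assume "a \<in> iota ` carrier F"
    then obtain u where u: "u \<in> carrier F" "a = iota u" by blast
    then show "\<phi> (LS c a) = sm c (\<phi> a)"
      using \<phi>[OF free_algebra_closed(3)[OF u(1) u(1), of c]] by (simp add: iota_scale B.ev_scale \<phi>)
  next
    fix a b assume "a \<in> iota ` carrier F" "b \<in> iota ` carrier F"
    then obtain u v where u: "u \<in> carrier F" "a = iota u" "v \<in> carrier F" "b = iota v" by blast
    then show "\<phi> (a + b) = \<phi> a + \<phi> b" "\<phi> (a * b) = \<phi> a * \<phi> b"
      using \<phi>[OF free_algebra_closed(1)[OF u(1,3)]] \<phi>[OF conv_closed[OF u(1,3)]]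
      by (simp_all add: iota_add iota_mult B.ev_add B.ev_conv \<phi>)
  qed
  then show ?thesis using \<phi> by blast
qed

lemma gsub_in_image:
  assumes "Y \<subseteq> iota ` carrier F" "t \<in> kalgebra.gsub LS Y" shows "t \<in> iota ` carrier F"
proof -
  interpret L: kalgebra LS by (rule kalgebra_LS)
  show ?thesis using assms(2)
  proof induction
    case one
    show ?case unfolding iota_one[symmetric] by (rule imageI[OF word_one_closed])
  next
    case (add a b)
    then obtain u v where u: "u \<in> carrier F" "v \<in> carrier F" "a = iota u" "b = iota v" by blast
    show ?case unfolding u(3,4) iota_add[symmetric] by (rule imageI[OF free_algebra_closed(1)[OF u(1,2)]])
  next
    case (mult a b)
    then obtain u v where u: "u \<in> carrier F" "v \<in> carrier F" "a = iota u" "b = iota v" by blast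
    show ?case unfolding u(3,4) iota_mult[OF u(1,2), symmetric] by (rule imageI[OF conv_closed[OF u(1,2)]])
  next
    case (scale a c)
    then obtain u where u: "u \<in> carrier F" "a = iota u" by blast
    show ?case unfolding u(2) iota_scale[symmetric] by (rule imageI[OF free_algebra_closed(3)[OF u(1) u(1)]])
  qed (use assms(1) in auto)
qed

subsection \<open>The quotient algebra\<close>

abbreviation Q where "Q \<equiv> quotient_algebra F I"

text \<open>On a coset \<open>iota\<close> is constant.\<close>

definition rep :: "('x list \<Rightarrow> 'k) set \<Rightarrow> ('x list, 'k) rop" where
  "rep C = the_elem (iota ` C)"

lemma Q_simps:
  "carrier Q = (\<lambda>u. I +>\<^bsub>F\<^esub> u) ` carrier F" "C \<otimes>\<^bsub>Q\<^esub> D = C \<otimes>\<^bsub>F Quot I\<^esub> D"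
  "C \<oplus>\<^bsub>Q\<^esub> D = C \<oplus>\<^bsub>F Quot I\<^esub> D" "\<one>\<^bsub>Q\<^esub> = I +>\<^bsub>F\<^esub> word_one" "\<zero>\<^bsub>Q\<^esub> = \<zero>\<^bsub>F Quot I\<^esub>"
  by (auto simp: quotient_algebra_def FactRing_def A_RCOSETS_def' free_algebra_simps(2-))

lemma coset_add: "u \<in> carrier F \<Longrightarrow> v \<in> carrier F \<Longrightarrow>
    (I +>\<^bsub>F\<^esub> u) \<oplus>\<^bsub>Q\<^esub> (I +>\<^bsub>F\<^esub> v) = I +>\<^bsub>F\<^esub> (\<lambda>w. u w + v w)"
  unfolding Q_simps FactRing_def using I.a_rcos_sum[of u v] by (simp add: free_algebra_simps(2-))

lemma coset_mult: "u \<in> carrier F \<Longrightarrow> v \<in> carrier F \<Longrightarrow>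
    (I +>\<^bsub>F\<^esub> u) \<otimes>\<^bsub>Q\<^esub> (I +>\<^bsub>F\<^esub> v) = I +>\<^bsub>F\<^esub> (conv u v)"
  unfolding Q_simps FactRing_def using I.rcoset_mult_add[of u v] by (simp add: free_algebra_simps(2-))

lemma coset_eq: "v \<in> I \<Longrightarrow> u \<in> carrier F \<Longrightarrow> I +>\<^bsub>F\<^esub> (\<lambda>w. v w + u w) = I +>\<^bsub>F\<^esub> u"
  using I.a_repr_independence'[OF F.a_rcosI[OF _ I.a_subset, of v u]] by (simp add: free_algebra_simps(2-))

lemma coset_scale:
  assumes "u \<in> carrier F" shows "c \<odot>\<^bsub>Q\<^esub> (I +>\<^bsub>F\<^esub> u) = I +>\<^bsub>F\<^esub> (\<lambda>w. c * u w)"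
proof -
  have "I +>\<^bsub>F\<^esub> (c \<odot>\<^bsub>F\<^esub> x) = I +>\<^bsub>F\<^esub> (\<lambda>w. c * u w)" if x: "x \<in> I +>\<^bsub>F\<^esub> u" for x
  proof -
    obtain v where v: "v \<in> I" "x = (\<lambda>w. v w + u w)"
      using x by (auto simp: a_r_coset_def' free_algebra_simps(2-))
    have "I +>\<^bsub>F\<^esub> (c \<odot>\<^bsub>F\<^esub> x) = I +>\<^bsub>F\<^esub> (\<lambda>w. c * v w + c * u w)"
      by (simp add: v free_algebra_simps(2-) distrib_left)
    also have "\<dots> = I +>\<^bsub>F\<^esub> (\<lambda>w. c * u w)"
      by (rule coset_eq[OF I_scale[OF v(1)] free_algebra_closed(3)[OF assms assms]])
    finally show ?thesis .
  qed
  moreover have "u \<in> I +>\<^bsub>F\<^esub> u" using I.a_rcos_self[OF assms] .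
  ultimately show ?thesis by (auto simp: quotient_algebra_def)
qed

lemma rep_coset:
  assumes "u \<in> carrier F" shows "rep (I +>\<^bsub>F\<^esub> u) = iota u"
proof -
  interpret L: kalgebra LS by (rule kalgebra_LS)
  have "iota x = iota u" if x: "x \<in> I +>\<^bsub>F\<^esub> u" for x
  proof -
    obtain v where v: "v \<in> I" "x = (\<lambda>w. v w + u w)"
      using x by (auto simp: a_r_coset_def' free_algebra_simps(2-))
    have "iota v = 0" using iota_eq_0_iff v(1) I_in_F by blast
    then show ?thesis by (simp add: v(2) iota_add)
  qed
  moreover have "u \<in> I +>\<^bsub>F\<^esub> u" using I.a_rcos_self[OF assms] .
  ultimately have "iota ` (I +>\<^bsub>F\<^esub> u) = {iota u}" by blast
  then show ?thesis by (simp add: rep_def)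
qed

lemma assoc_algebra_Q: "assoc_algebra Q"
proof -
  have "ring (F Quot I)" by (rule I.quotient_is_ring)
  then interpret R: ring "F Quot I" .
  have "abelian_group Q"
  proof (rule abelian_groupI)
    fix C assume "C \<in> carrier Q"
    then have "C \<in> carrier (F Quot I)" by (simp add: quotient_algebra_def)
    then have "(\<ominus>\<^bsub>F Quot I\<^esub> C) \<in> carrier Q" "(\<ominus>\<^bsub>F Quot I\<^esub> C) \<oplus>\<^bsub>Q\<^esub> C = \<zero>\<^bsub>Q\<^esub>"
      by (simp_all add: quotient_algebra_def R.l_neg)
    then show "\<exists>D\<in>carrier Q. D \<oplus>\<^bsub>Q\<^esub> C = \<zero>\<^bsub>Q\<^esub>" by blast
  qed (simp_all add: quotient_algebra_def R.a_ac)
  moreover have "Group.monoid Q"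
    by (rule Group.monoidI) (simp_all add: quotient_algebra_def R.m_assoc)
  ultimately have ring: "ring Q"
    by (rule ringI) (simp_all add: quotient_algebra_def R.l_distr R.r_distr)
  show ?thesis
    by (intro assoc_algebra.intro assoc_algebra_axioms.intro ring)
       (auto simp: Q_simps(1) coset_scale coset_add coset_mult free_algebra_closed conv_closed
          conv_scale_left conv_scale_right algebra_simps)
qed

lemma rep_inj: "inj_on rep (carrier Q)"
proof (rule inj_onI)
  fix C D assume "C \<in> carrier Q" "D \<in> carrier Q" "rep C = rep D"
  then obtain u v where u: "u \<in> carrier F" "v \<in> carrier F" "C = I +>\<^bsub>F\<^esub> u" "D = I +>\<^bsub>F\<^esub> v"
    by (auto simp: Q_simps(1))
  then have "iota u = iota v" using \<open>rep C = rep D\<close> rep_coset by metis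
  from coset_eq[OF iota_eq[OF u(1,2) this] u(2)] show "C = D" using u by simp
qed

lemma rep_hom:
  assumes "C \<in> carrier Q" "D \<in> carrier Q"
  shows "rep (C \<otimes>\<^bsub>Q\<^esub> D) = rep C * rep D" "rep (C \<oplus>\<^bsub>Q\<^esub> D) = rep C + rep D"
    "rep (c \<odot>\<^bsub>Q\<^esub> C) = LS c (rep C)"
  using assms
  by (auto simp: Q_simps(1) coset_mult coset_add coset_scale rep_coset conv_closed free_algebra_closed
      iota_mult iota_add iota_scale)

lemma rep_one: "rep \<one>\<^bsub>Q\<^esub> = 1"
  by (simp add: Q_simps rep_coset word_one_closed iota_one)

text \<open>One inclusion is the induction over \<open>gsub\<close>, the other one the minimality of the generated
  subalgebra among those whose image is contained in \<open>gsub\<close>.\<close>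

lemma generated_subalgebra_props:
  assumes "S \<subseteq> carrier Q"
  shows "unital_subalgebra Q (generated_subalgebra Q S)" "S \<subseteq> generated_subalgebra Q S"
    "rep ` generated_subalgebra Q S = kalgebra.gsub LS (rep ` S)"
proof -
  interpret L: kalgebra LS by (rule kalgebra_LS)
  interpret Q: assoc_algebra Q by (rule assoc_algebra_Q)
  let ?T = "generated_subalgebra Q S"
  have full: "unital_subalgebra Q (carrier Q)"
    unfolding unital_subalgebra_def using Q.smult_closed by (auto intro!: Q.subringI)
  have TQ: "?T \<subseteq> carrier Q" unfolding generated_subalgebra_def using full assms by blast
  show ST: "S \<subseteq> ?T" unfolding generated_subalgebra_def by blast
  have least: "?T \<subseteq> V" if "unital_subalgebra Q V" "S \<subseteq> V" for V
    unfolding generated_subalgebra_def using that by blast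
  have TI: "z \<in> ?T" if "\<And>V. unital_subalgebra Q V \<Longrightarrow> S \<subseteq> V \<Longrightarrow> z \<in> V" for z
    unfolding generated_subalgebra_def using that by blast
  have one: "\<one>\<^bsub>Q\<^esub> \<in> ?T" by (rule TI) (auto simp: unital_subalgebra_def dest: subringE(3))
  have neg: "\<ominus>\<^bsub>Q\<^esub> a \<in> ?T" if "a \<in> ?T" for a
    by (rule TI) (use that least in \<open>auto simp: unital_subalgebra_def intro!: subringE(5)\<close>)
  have mult: "a \<otimes>\<^bsub>Q\<^esub> b \<in> ?T" and add: "a \<oplus>\<^bsub>Q\<^esub> b \<in> ?T" if "a \<in> ?T" "b \<in> ?T" for a b
    by (rule TI; use that least in \<open>auto simp: unital_subalgebra_def intro!: subringE(6,7)\<close>)+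
  have smult: "c \<odot>\<^bsub>Q\<^esub> a \<in> ?T" if "a \<in> ?T" for a c
  proof (rule TI)
    fix V assume V: "unital_subalgebra Q V" "S \<subseteq> V"
    then have "a \<in> V" using least that by blast
    then show "c \<odot>\<^bsub>Q\<^esub> a \<in> V" using V(1) by (auto simp: unital_subalgebra_def)
  qed
  show "unital_subalgebra Q ?T"
    unfolding unital_subalgebra_def using one neg mult add smult TQ by (auto intro!: Q.subringI)
  show "rep ` ?T = L.gsub (rep ` S)"
  proof (intro equalityI subsetI)
    fix t assume "t \<in> L.gsub (rep ` S)"
    then show "t \<in> rep ` ?T"
    proof induction
      case (gen t)
      then show ?case using ST by blast
    next
      case one
      show ?case unfolding rep_one[symmetric] by (rule imageI[OF \<open>\<one>\<^bsub>Q\<^esub> \<in> ?T\<close>])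
    next
      case (add s t)
      then obtain a b where ab: "a \<in> ?T" "b \<in> ?T" "s = rep a" "t = rep b" by blast
      then have "s + t = rep (a \<oplus>\<^bsub>Q\<^esub> b)" using rep_hom(2) TQ by (simp add: subsetD)
      then show ?case using \<open>\<And>b a. a \<in> ?T \<Longrightarrow> b \<in> ?T \<Longrightarrow> a \<oplus>\<^bsub>Q\<^esub> b \<in> ?T\<close> ab by simp
    next
      case (mult s t)
      then obtain a b where ab: "a \<in> ?T" "b \<in> ?T" "s = rep a" "t = rep b" by blast
      then have "s * t = rep (a \<otimes>\<^bsub>Q\<^esub> b)" using rep_hom(1) TQ by (simp add: subsetD)
      then show ?case using \<open>\<And>b a. a \<in> ?T \<Longrightarrow> b \<in> ?T \<Longrightarrow> a \<otimes>\<^bsub>Q\<^esub> b \<in> ?T\<close> ab by simp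
    next
      case (scale t c)
      then obtain a where a: "a \<in> ?T" "t = rep a" by blast
      then have "LS c t = rep (c \<odot>\<^bsub>Q\<^esub> a)" using rep_hom(3)[of a a c] TQ by (simp add: subsetD)
      then show ?case using smult a by simp
    qed
  next
    let ?V = "{C \<in> carrier Q. rep C \<in> L.gsub (rep ` S)}"
    have "unital_subalgebra Q ?V"
      unfolding unital_subalgebra_def
    proof (intro conjI allI ballI)
      show "subring ?V Q"
      proof (rule Q.subringI)
        fix C assume C: "C \<in> ?V"
        have "\<ominus>\<^bsub>Q\<^esub> C = (- 1) \<odot>\<^bsub>Q\<^esub> C"
        proof (rule Q.minus_equality)
          have "(- 1) \<odot>\<^bsub>Q\<^esub> C \<oplus>\<^bsub>Q\<^esub> C = (- 1 + 1) \<odot>\<^bsub>Q\<^esub> C"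
            using C Q.smult_add_left[of C "- 1" 1] Q.smult_one[of C] by simp
          also have "\<dots> = \<zero>\<^bsub>Q\<^esub>"
            using C Q.smult_add_left[of C 0 0] Q.smult_closed[of C 0] Q.add.r_cancel_one'[of "0 \<odot>\<^bsub>Q\<^esub> C" "0 \<odot>\<^bsub>Q\<^esub> C"] by simp
          finally show "(- 1) \<odot>\<^bsub>Q\<^esub> C \<oplus>\<^bsub>Q\<^esub> C = \<zero>\<^bsub>Q\<^esub>" .
        qed (use C Q.smult_closed in auto)
        moreover have "rep ((- 1) \<odot>\<^bsub>Q\<^esub> C) \<in> L.gsub (rep ` S)"
          using C by (subst rep_hom(3)[of C C]) (auto intro: L.gsub.scale simp del: L.scale_minus_left)
        ultimately show "\<ominus>\<^bsub>Q\<^esub> C \<in> ?V" using C Q.smult_closed by auto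
      qed (auto simp: rep_hom rep_one intro: L.gsub.intros)
      fix c C assume "C \<in> ?V"
      then show "c \<odot>\<^bsub>Q\<^esub> C \<in> ?V" using rep_hom(3)[of C C c] Q.smult_closed L.gsub.scale by auto
    qed
    moreover have "S \<subseteq> ?V" using assms L.gsub.gen by auto
    ultimately have "?T \<subseteq> ?V" by (rule least)
    then show "t \<in> L.gsub (rep ` S)" if "t \<in> rep ` ?T" for t using that by auto
  qed
qed

lemma rep_prod:
  assumes "\<And>k. k \<in> set ks \<Longrightarrow> f k \<in> carrier Q"
  shows "foldr (\<otimes>\<^bsub>Q\<^esub>) (map f ks) \<one>\<^bsub>Q\<^esub> \<in> carrier Q \<and>
     rep (foldr (\<otimes>\<^bsub>Q\<^esub>) (map f ks) \<one>\<^bsub>Q\<^esub>) = prod_list (map (\<lambda>k. rep (f k)) ks)"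
proof -
  interpret Q: assoc_algebra Q by (rule assoc_algebra_Q)
  show ?thesis using assms by (induction ks) (auto simp: rep_one rep_hom)
qed

lemma rep_finsum:
  assumes "finite S" "\<And>s. s \<in> S \<Longrightarrow> f s \<in> carrier Q"
  shows "(\<Oplus>\<^bsub>Q\<^esub>s\<in>S. f s) \<in> carrier Q \<and> rep (\<Oplus>\<^bsub>Q\<^esub>s\<in>S. f s) = (\<Sum>s\<in>S. rep (f s))"
proof -
  interpret Q: assoc_algebra Q by (rule assoc_algebra_Q)
  have zero: "rep \<zero>\<^bsub>Q\<^esub> = 0" using rep_hom(2)[of "\<zero>\<^bsub>Q\<^esub>" "\<zero>\<^bsub>Q\<^esub>"] by simp
  show ?thesis using assms
  proof (induction S rule: finite_induct)
    case (insert s S)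
    then have "f \<in> S \<rightarrow> carrier Q" "f s \<in> carrier Q" by auto
    then show ?case using insert by (simp add: Q.finsum_insert rep_hom)
  qed (simp add: zero)
qed

end

section \<open>The algebra of quantum matrices\<close>

declare One_nat_def [simp del]

locale quantum_matrix_algebra =
  fixes q :: "'k::field" and m n :: nat
  assumes q: "q \<noteq> 0"
begin

lemma scale_closed: "f \<in> carrier (free_algebra X) \<Longrightarrow> (\<lambda>w. c * f w) \<in> carrier (free_algebra X)"
  by (rule free_algebra_closed(3))

lemma conv_gens_closed:
  assumes "i \<in> {1..m}" "k \<in> {1..m}" "j \<in> {1..n}" "l \<in> {1..n}"
  shows "conv (free_gen (i, j)) (free_gen (k, l)) \<in> carrier (free_algebra ({1..m} \<times> {1..n}))"
  using assms by (intro conv_closed free_gen_closed) auto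

text \<open>The relations with the record operations of the free algebra replaced by pointwise
  operations and convolution.\<close>

lemma relations_eq:
  "qmat_relations q m n =
    {\<lambda>w. conv (free_gen (i, j)) (free_gen (i, l)) w - q * conv (free_gen (i, l)) (free_gen (i, j)) w | i j l.
       i \<in> {1..m} \<and> j \<in> {1..n} \<and> l \<in> {1..n} \<and> j < l} \<union>
    {\<lambda>w. conv (free_gen (i, j)) (free_gen (k, j)) w - q * conv (free_gen (k, j)) (free_gen (i, j)) w | i j k.
       i \<in> {1..m} \<and> k \<in> {1..m} \<and> j \<in> {1..n} \<and> i < k} \<union>
    {\<lambda>w. conv (free_gen (i, j)) (free_gen (k, l)) w - conv (free_gen (k, l)) (free_gen (i, j)) w | i j k l.
       i \<in> {1..m} \<and> k \<in> {1..m} \<and> j \<in> {1..n} \<and> l \<in> {1..n} \<and> k < i \<and> j < l} \<union>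
    {\<lambda>w. (conv (free_gen (i, j)) (free_gen (k, l)) w - conv (free_gen (k, l)) (free_gen (i, j)) w)
       - (q - inverse q) * conv (free_gen (i, l)) (free_gen (k, j)) w | i j k l.
       i \<in> {1..m} \<and> k \<in> {1..m} \<and> j \<in> {1..n} \<and> l \<in> {1..n} \<and> i < k \<and> j < l}"
proof -
  let ?F = "free_algebra ({1..m} \<times> {1..n}) :: ('k, _) module"
  note c = conv_gens_closed
  have m: "u \<ominus>\<^bsub>?F\<^esub> v = (\<lambda>w. u w - v w)" "u \<ominus>\<^bsub>?F\<^esub> a \<odot>\<^bsub>?F\<^esub> v = (\<lambda>w. u w - a * v w)"
    if "u \<in> carrier ?F" "v \<in> carrier ?F" for u v a
    using free_algebra_minus[OF that] free_algebra_minus[OF that(1) free_algebra_closed(3)[OF that(2,2)]]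
    by (simp_all add: free_algebra_simps(6))
  show ?thesis
    unfolding qmat_relations_def Let_def free_algebra_simps(2)
    apply (intro arg_cong2[where f = "(\<union>)"] Collect_cong ex_cong1 rev_conj_cong refl; elim conjE)
    subgoal by (subst m(2)) (assumption | rule c refl)+
    subgoal by (subst m(2)) (assumption | rule c refl)+
    subgoal by (subst m(1)) (assumption | rule c refl)+
    subgoal by (subst m(1), (assumption | rule c)+, subst m(2), (assumption | rule c refl free_algebra_closed(2))+)
    done
qed

lemma relation_cases:
  assumes "r \<in> qmat_relations q m n"
  obtains
    (row) i j l where "i \<in> {1..m}" "j \<in> {1..n}" "l \<in> {1..n}" "j < l"
      "r = (\<lambda>w. conv (free_gen (i, j)) (free_gen (i, l)) w - q * conv (free_gen (i, l)) (free_gen (i, j)) w)"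
  | (col) i j k where "i \<in> {1..m}" "k \<in> {1..m}" "j \<in> {1..n}" "i < k"
      "r = (\<lambda>w. conv (free_gen (i, j)) (free_gen (k, j)) w - q * conv (free_gen (k, j)) (free_gen (i, j)) w)"
  | (anti) i j k l where "i \<in> {1..m}" "k \<in> {1..m}" "j \<in> {1..n}" "l \<in> {1..n}" "k < i" "j < l"
      "r = (\<lambda>w. conv (free_gen (i, j)) (free_gen (k, l)) w - conv (free_gen (k, l)) (free_gen (i, j)) w)"
  | (diag) i j k l where "i \<in> {1..m}" "k \<in> {1..m}" "j \<in> {1..n}" "l \<in> {1..n}" "i < k" "j < l"
      "r = (\<lambda>w. (conv (free_gen (i, j)) (free_gen (k, l)) w - conv (free_gen (k, l)) (free_gen (i, j)) w)
         - (q - inverse q) * conv (free_gen (i, l)) (free_gen (k, j)) w)"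
  using assms unfolding relations_eq
proof (elim UnE CollectE exE conjE, goal_cases)
  case (1 i j l)
  show ?case by (rule 1(1)[of i j l]; fact)
next
  case (2 i j k)
  show ?case by (rule 2(2)[of i k j]; fact)
next
  case (3 i j k l)
  show ?case by (rule 3(3)[of i k j l]; fact)
next
  case (4 i j k l)
  show ?case by (rule 4(4)[of i k j l]; fact)
qed

sublocale presented_algebra "{1..m} \<times> {1..n}" "qmat_relations q m n"
proof
  fix r assume "r \<in> qmat_relations q m n"
  then show "r \<in> carrier (free_algebra ({1..m} \<times> {1..n}))"
  proof (cases rule: relation_cases)
    case (row i j l)
    then show ?thesis by (auto intro!: free_algebra_closed(2) scale_closed conv_gens_closed)
  next
    case (col i j k)
    then show ?thesis by (auto intro!: free_algebra_closed(2) scale_closed conv_gens_closed)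
  next
    case (anti i j k l)
    then show ?thesis by (auto intro!: free_algebra_closed(2) scale_closed conv_gens_closed)
  next
    case (diag i j k l)
    then show ?thesis by (auto intro!: free_algebra_closed(2) scale_closed conv_gens_closed)
  qed
  show "r [] = 0"
    using \<open>r \<in> qmat_relations q m n\<close>
    by (cases rule: relation_cases) (simp_all add: conv_def free_gen_def)
qed

lemma ev_relations:
  assumes "kalgebra sm" and y: "kalgebra.qmat sm q y" and r: "r \<in> qmat_relations q m n"
  shows "kalgebra.ev sm (\<lambda>(i, j). y i j) r = 0"
proof -
  interpret B: kalgebra sm by fact
  have ev: "B.ev (\<lambda>(i, j). y i j) (conv (free_gen (i, j)) (free_gen (k, l))) = y i j * y k l"
    if "i \<in> {1..m}" "k \<in> {1..m}" "j \<in> {1..n}" "l \<in> {1..n}" for i j k l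
    using that by (subst B.ev_conv[of _ "{1..m} \<times> {1..n}"]) (auto simp: B.ev_gen intro: free_gen_closed)
  from r show ?thesis
  proof (cases rule: relation_cases)
    case (row i j l)
    note c = conv_gens_closed[OF row(1,1,2,3)] conv_gens_closed[OF row(1,1,3,2)]
    show ?thesis unfolding row(5) B.ev_diff[OF c(1) free_algebra_closed(3)[OF c(2) c(2)]] B.ev_scale[OF c(2)]
      using row B.qmat_row[OF y row(4), of i] by (simp add: ev)
  next
    case (col i j k)
    note c = conv_gens_closed[OF col(1,2,3,3)] conv_gens_closed[OF col(2,1,3,3)]
    show ?thesis unfolding col(5) B.ev_diff[OF c(1) free_algebra_closed(3)[OF c(2) c(2)]] B.ev_scale[OF c(2)]
      using col B.qmat_col[OF y col(4), of j] by (simp add: ev)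
  next
    case (anti i j k l)
    note c = conv_gens_closed[OF anti(1,2,3,4)] conv_gens_closed[OF anti(2,1,4,3)]
    show ?thesis unfolding anti(7) B.ev_diff[OF c]
      using anti B.qmat_anti[OF y anti(5,6)] by (simp add: ev)
  next
    case (diag i j k l)
    note c = conv_gens_closed[OF diag(1,2,3,4)] conv_gens_closed[OF diag(2,1,4,3)] conv_gens_closed[OF diag(1,2,4,3)]
    show ?thesis
      unfolding diag(7) B.ev_diff[OF free_algebra_closed(2)[OF c(1,2)] free_algebra_closed(3)[OF c(3) c(3)]]
        B.ev_diff[OF c(1,2)] B.ev_scale[OF c(3)]
      using diag B.qmat_diag[OF y diag(5,6)] by (simp add: ev)
  qed
qed

text \<open>The images of the generators, extended by zero.\<close>

definition x :: "nat \<Rightarrow> nat \<Rightarrow> ((nat \<times> nat) list, 'k) rop" where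
  "x i j = (if i \<in> {1..m} \<and> j \<in> {1..n} then iota (free_gen (i, j)) else 0)"

lemma x_in_image: "x i j \<in> iota ` carrier F"
proof (cases "i \<in> {1..m} \<and> j \<in> {1..n}")
  case True
  then show ?thesis unfolding x_def by (auto intro!: imageI free_gen_closed)
next
  case False
  have "iota (\<lambda>w. 0) = 0" using iota_eq_0_iff[OF zero_closed] I_zero by blast
  then show ?thesis using False zero_closed unfolding x_def by (metis imageI)
qed

lemma x_prod:
  assumes "i \<in> {1..m}" "k \<in> {1..m}" "j \<in> {1..n}" "l \<in> {1..n}"
  shows "x i j * x k l = iota (conv (free_gen (i, j)) (free_gen (k, l)))"
  using assms by (subst iota_mult) (auto simp: x_def intro: free_gen_closed)

lemma iota_relation: "r \<in> qmat_relations q m n \<Longrightarrow> iota r = 0"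
  using iota_eq_0_iff[OF Rel] F.genideal_self[of "qmat_relations q m n"] Rel
  by blast

lemma relationI:
  "i \<in> {1..m} \<Longrightarrow> j \<in> {1..n} \<Longrightarrow> l \<in> {1..n} \<Longrightarrow> j < l \<Longrightarrow>
     (\<lambda>w. conv (free_gen (i, j)) (free_gen (i, l)) w - q * conv (free_gen (i, l)) (free_gen (i, j)) w)
       \<in> qmat_relations q m n"
  "i \<in> {1..m} \<Longrightarrow> k \<in> {1..m} \<Longrightarrow> j \<in> {1..n} \<Longrightarrow> i < k \<Longrightarrow>
     (\<lambda>w. conv (free_gen (i, j)) (free_gen (k, j)) w - q * conv (free_gen (k, j)) (free_gen (i, j)) w)
       \<in> qmat_relations q m n"
  "i \<in> {1..m} \<Longrightarrow> k \<in> {1..m} \<Longrightarrow> j \<in> {1..n} \<Longrightarrow> l \<in> {1..n} \<Longrightarrow> k < i \<Longrightarrow> j < l \<Longrightarrow>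
     (\<lambda>w. conv (free_gen (i, j)) (free_gen (k, l)) w - conv (free_gen (k, l)) (free_gen (i, j)) w)
       \<in> qmat_relations q m n"
  "i \<in> {1..m} \<Longrightarrow> k \<in> {1..m} \<Longrightarrow> j \<in> {1..n} \<Longrightarrow> l \<in> {1..n} \<Longrightarrow> i < k \<Longrightarrow> j < l \<Longrightarrow>
     (\<lambda>w. (conv (free_gen (i, j)) (free_gen (k, l)) w - conv (free_gen (k, l)) (free_gen (i, j)) w)
         - (q - inverse q) * conv (free_gen (i, l)) (free_gen (k, j)) w) \<in> qmat_relations q m n"
  unfolding relations_eq
  subgoal by (rule UnI1, rule UnI1, rule UnI1, rule CollectI, rule exI[of _ i], rule exI[of _ j], rule exI[of _ l], simp)
  subgoal by (rule UnI1, rule UnI1, rule UnI2, rule CollectI, rule exI[of _ i], rule exI[of _ j], rule exI[of _ k], simp)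
  subgoal by (rule UnI1, rule UnI2, rule CollectI, rule exI[of _ i], rule exI[of _ j], rule exI[of _ k], rule exI[of _ l], simp)
  subgoal by (rule UnI2, rule CollectI, rule exI[of _ i], rule exI[of _ j], rule exI[of _ k], rule exI[of _ l], simp)
  done

lemma qmat_x: "kalgebra.qmat LS q x"
proof -
  interpret L: kalgebra LS by (rule kalgebra_LS)
  have out: "x i j = 0" if "\<not> (i \<in> {1..m} \<and> j \<in> {1..n})" for i j using that by (auto simp: x_def)
  show ?thesis
    unfolding L.qmat_def
  proof (intro conjI allI impI)
    fix i j l :: nat assume "j < l"
    show "x i j * x i l = LS q (x i l * x i j)"
    proof (cases "i \<in> {1..m} \<and> j \<in> {1..n} \<and> l \<in> {1..n}")
      case True
      then show ?thesis
        using iota_relation[OF relationI(1)[of i j l]] \<open>j < l\<close> by (simp add: iota_diff iota_scale x_prod)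
    next
      case False
      then show ?thesis using out[of i j] out[of i l] by fastforce
    qed
  next
    fix i j k :: nat assume "i < k"
    show "x i j * x k j = LS q (x k j * x i j)"
    proof (cases "i \<in> {1..m} \<and> k \<in> {1..m} \<and> j \<in> {1..n}")
      case True
      then show ?thesis
        using iota_relation[OF relationI(2)[of i k j]] \<open>i < k\<close> by (simp add: iota_diff iota_scale x_prod)
    next
      case False
      then show ?thesis using out[of i j] out[of k j] by fastforce
    qed
  next
    fix i j k l :: nat assume lt: "i < k \<and> j < l"
    show "x i l * x k j = x k j * x i l"
    proof (cases "i \<in> {1..m} \<and> k \<in> {1..m} \<and> j \<in> {1..n} \<and> l \<in> {1..n}")
      case True
      then show ?thesis
        using iota_relation[OF relationI(3)[of k i j l]] lt by (simp add: iota_diff x_prod)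
    next
      case False
      then show ?thesis using out[of i l] out[of k j] by fastforce
    qed
    show "x i j * x k l = x k l * x i j + LS (q - inverse q) (x i l * x k j)"
    proof (cases "i \<in> {1..m} \<and> k \<in> {1..m} \<and> j \<in> {1..n} \<and> l \<in> {1..n}")
      case True
      then have "x i j * x k l - x k l * x i j - LS (q - inverse q) (x i l * x k j) = 0"
        using iota_relation[OF relationI(4)[of i k j l]] lt
        by (simp only: iota_diff iota_scale x_prod atLeastAtMost_iff simp_thms)
      then show ?thesis by (simp add: algebra_simps)
    next
      case False
      then have "x i j = 0 \<or> x k l = 0" "x i l = 0 \<or> x k j = 0"
        using out[of i j] out[of k l] out[of i l] out[of k j] by blast+
      then show ?thesis by fastforce
    qed
  qed
qed

lemma restrict_hom:
  assumes sm: "kalgebra sm" and y: "kalgebra.qmat sm q y"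
    and out: "\<And>i j. i \<notin> {1..m} \<or> j \<notin> {1..n} \<Longrightarrow> y i j = 0"
  shows "\<exists>\<phi>. kalgebra.alg_hom LS sm (kalgebra.gsub LS (kalgebra.entries x)) \<phi> \<and> (\<forall>i j. \<phi> (x i j) = y i j)"
proof -
  interpret B: kalgebra sm by fact
  interpret L: kalgebra LS by (rule kalgebra_LS)
  obtain \<phi> where \<phi>: "L.alg_hom sm (iota ` carrier F) \<phi>"
      "\<And>u. u \<in> carrier F \<Longrightarrow> \<phi> (iota u) = B.ev (\<lambda>(i, j). y i j) u"
    using hom_of_relations[OF sm ev_relations[OF sm y]] by blast
  have sub: "a \<in> iota ` carrier F" if "a \<in> L.gsub (L.entries x)" for a
    by (rule gsub_in_image[OF _ that]) (use x_in_image in \<open>auto simp: L.entries_def\<close>)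
  have "L.alg_hom sm (L.gsub (L.entries x)) \<phi>"
    using \<phi>(1) sub unfolding L.alg_hom_def by blast
  moreover have "\<phi> (x i j) = y i j" for i j
  proof (cases "i \<in> {1..m} \<and> j \<in> {1..n}")
    case True
    then show ?thesis using \<phi>(2)[OF free_gen_closed[of "(i, j)"]] by (simp add: x_def B.ev_gen)
  next
    case False
    have "iota (\<lambda>w. 0) = 0" using iota_eq_0_iff[OF zero_closed] I_zero by blast
    then have "\<phi> 0 = 0" using \<phi>(2)[OF zero_closed] by (simp add: B.ev_def)
    then show ?thesis using False out[of i j] by (auto simp: x_def)
  qed
  ultimately show ?thesis by blast
qed

text \<open>All results on shears, towers and minors become available for the representation of the
  presented algebra.\<close>

sublocale U: universal_qmat LS q m n x
proof -
  interpret L: kalgebra LS by (rule kalgebra_LS)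
  have rop: "kalgebra (L.rsm :: 'k \<Rightarrow> (int, ((nat \<times> nat) list, 'k) rop) rop \<Rightarrow> _)" by (rule L.kalgebra_rsm)
  show "universal_qmat LS q m n x"
    by unfold_locales
      (use q qmat_x restrict_hom[OF rop] restrict_hom[OF kalgebra_field] in \<open>auto simp: x_def\<close>)
qed

lemma rep_gen:
  assumes "i \<in> {1..m}" "j \<in> {1..n}"
  shows "qmat_gen q m n i j \<in> carrier Q" "rep (qmat_gen q m n i j) = x i j"
proof -
  have g: "free_gen (i, j) \<in> carrier F" using assms by (intro free_gen_closed) simp
  have "qmat_gen q m n i j = I +>\<^bsub>F\<^esub> free_gen (i, j)" by (simp add: qmat_gen_def Let_def)
  then show "qmat_gen q m n i j \<in> carrier Q" "rep (qmat_gen q m n i j) = x i j"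
    using g assms by (auto simp: Q_simps(1) rep_coset x_def)
qed

lemma Q_quantum_matrices: "quantum_matrices q m n = Q"
  by (simp add: quantum_matrices_def Let_def)

lemma rep_minor:
  assumes "C \<subseteq> {1..m}" "D \<subseteq> {1..n}" "card C = card D"
  shows "quantum_minor q m n C D \<in> carrier Q" "rep (quantum_minor q m n C D) = U.minor q x C D"
proof -
  interpret Q: assoc_algebra Q by (rule assoc_algebra_Q)
  have fin: "finite C" "finite D" using assms finite_subset by blast+
  define t where "t = card C"
  define g where "g \<sigma> k = qmat_gen q m n (sorted_list_of_set C ! k) (sorted_list_of_set D ! \<sigma> k)" for \<sigma> :: "nat \<Rightarrow> nat" and k
  define P where "P \<sigma> = foldr (\<otimes>\<^bsub>Q\<^esub>) (map (g \<sigma>) [0..<t]) \<one>\<^bsub>Q\<^esub>" for \<sigma>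
  have rng: "sorted_list_of_set C ! k \<in> {1..m}" "sorted_list_of_set D ! \<sigma> k \<in> {1..n}"
    if "\<sigma> permutes {..<t}" "k < t" for \<sigma> k
  proof -
    have "\<sigma> k < t" using permutes_in_image[OF that(1), of k] that(2) by simp
    then have "sorted_list_of_set C ! k \<in> C" "sorted_list_of_set D ! \<sigma> k \<in> D"
      using fin assms(3) that(2) nth_mem[of k "sorted_list_of_set C"] nth_mem[of "\<sigma> k" "sorted_list_of_set D"]
      by (simp_all add: t_def)
    then show "sorted_list_of_set C ! k \<in> {1..m}" "sorted_list_of_set D ! \<sigma> k \<in> {1..n}"
      using assms by blast+
  qed
  have g: "g \<sigma> k \<in> carrier Q" "rep (g \<sigma> k) = x (sorted_list_of_set C ! k) (sorted_list_of_set D ! \<sigma> k)"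
    if "\<sigma> permutes {..<t}" "k < t" for \<sigma> k
    unfolding g_def by (rule rep_gen[OF rng[OF that]])+
  have P: "P \<sigma> \<in> carrier Q"
      "rep (P \<sigma>) = prod_list (map (\<lambda>k. x (sorted_list_of_set C ! k) (sorted_list_of_set D ! \<sigma> k)) [0..<t])"
    if "\<sigma> permutes {..<t}" for \<sigma>
  proof -
    have eq: "map (\<lambda>k. rep (g \<sigma> k)) [0..<t] =
        map (\<lambda>k. x (sorted_list_of_set C ! k) (sorted_list_of_set D ! \<sigma> k)) [0..<t]"
      using g(2)[OF that] by (intro map_cong refl) simp
    have "P \<sigma> \<in> carrier Q \<and> rep (P \<sigma>) = prod_list (map (\<lambda>k. rep (g \<sigma> k)) [0..<t])"
      unfolding P_def by (rule rep_prod) (use g(1)[OF that] in simp)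
    then show "P \<sigma> \<in> carrier Q"
      "rep (P \<sigma>) = prod_list (map (\<lambda>k. x (sorted_list_of_set C ! k) (sorted_list_of_set D ! \<sigma> k)) [0..<t])"
      unfolding eq by blast+
  qed
  have eq: "quantum_minor q m n C D =
      (\<Oplus>\<^bsub>Q\<^esub>\<sigma>\<in>{\<sigma>. \<sigma> permutes {..<t}}. (- q) ^ perm_length t \<sigma> \<odot>\<^bsub>Q\<^esub> P \<sigma>)"
    unfolding quantum_minor_def Let_def Q_quantum_matrices P_def g_def t_def ..
  have fs: "quantum_minor q m n C D \<in> carrier Q \<and> rep (quantum_minor q m n C D) =
      (\<Sum>\<sigma>\<in>{\<sigma>. \<sigma> permutes {..<t}}. rep ((- q) ^ perm_length t \<sigma> \<odot>\<^bsub>Q\<^esub> P \<sigma>))"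
    unfolding eq by (rule rep_finsum) (auto intro!: Q.smult_closed P(1) finite_permutations)
  then show "quantum_minor q m n C D \<in> carrier Q" by blast
  have "rep (quantum_minor q m n C D) = (\<Sum>\<sigma>\<in>{\<sigma>. \<sigma> permutes {..<t}}. LS ((- q) ^ perm_length t \<sigma>)
      (prod_list (map (\<lambda>k. x (sorted_list_of_set C ! k) (sorted_list_of_set D ! \<sigma> k)) [0..<t])))"
    unfolding fs[THEN conjunct2] by (intro sum.cong refl) (simp add: rep_hom(3)[OF P(1) P(1)] P(2))
  also have "\<dots> = U.minor q x C D"
    by (rule U.minor_permutations[OF fin assms(3) t_def, symmetric])
  finally show "rep (quantum_minor q m n C D) = U.minor q x C D" .
qed

text \<open>The representation maps the subalgebra of the minor isomorphically onto the algebra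
  generated by the tower of \<open>minor_tower\<close>.\<close>

lemma minor_subalgebra_iterated_ore:
  assumes A: "A \<subseteq> {1..m}" and B: "B \<subseteq> {1..n}" and card: "card A = card B"
  shows "iterated_ore_extension (Q\<lparr>carrier := minor_subalgebra q m n A B\<rparr>)"
proof -
  have fin: "finite A" "finite B" using A B finite_subset by blast+
  let ?T = "minor_subalgebra q m n A B" and ?S = "minor_core q m n A B"
  let ?G = "{qmat_gen q m n a b | a b. a \<in> A \<and> b \<in> B}"
  let ?Y = "{quantum_minor q m n A (insert c (B - {b})) | b c. b \<in> B \<and> c \<in> {1..n} - B \<and> b < c}"
  let ?Z = "{quantum_minor q m n (insert r (A - {a})) B | a r. a \<in> A \<and> r \<in> {1..m} - A \<and> a < r}"
  let ?G' = "{x i j | i j. i \<in> A \<and> j \<in> B}"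
  let ?Y' = "{U.minor q x A (insert c (B - {b})) | b c. b \<in> B \<and> c \<in> {1..n} - B \<and> b < c}"
  let ?Z' = "{U.minor q x (insert r (A - {a})) B | a r. a \<in> A \<and> r \<in> {1..m} - A \<and> a < r}"
  have gen: "qmat_gen q m n a b \<in> carrier Q" "rep (qmat_gen q m n a b) = x a b" if "a \<in> A" "b \<in> B" for a b
    using rep_gen[OF subsetD[OF A that(1)] subsetD[OF B that(2)]] by blast+
  have Y: "quantum_minor q m n A (insert c (B - {b})) \<in> carrier Q"
      "rep (quantum_minor q m n A (insert c (B - {b}))) = U.minor q x A (insert c (B - {b}))"
    if "b \<in> B" "c \<in> {1..n} - B" for b c
  proof -
    have "insert c (B - {b}) \<subseteq> {1..n}" "card A = card (insert c (B - {b}))"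
      using that B fin card card_Suc_Diff1[of B b] by auto
    from rep_minor[OF A this] show "quantum_minor q m n A (insert c (B - {b})) \<in> carrier Q"
      "rep (quantum_minor q m n A (insert c (B - {b}))) = U.minor q x A (insert c (B - {b}))" by blast+
  qed
  have Z: "quantum_minor q m n (insert r (A - {a})) B \<in> carrier Q"
      "rep (quantum_minor q m n (insert r (A - {a})) B) = U.minor q x (insert r (A - {a})) B"
    if "a \<in> A" "r \<in> {1..m} - A" for a r
  proof -
    have "insert r (A - {a}) \<subseteq> {1..m}" "card (insert r (A - {a})) = card B"
      using that A fin card card_Suc_Diff1[of A a] by auto
    from rep_minor[OF this(1) B this(2)] show "quantum_minor q m n (insert r (A - {a})) B \<in> carrier Q"
      "rep (quantum_minor q m n (insert r (A - {a})) B) = U.minor q x (insert r (A - {a})) B" by blast+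
  qed
  have GQ: "?G \<subseteq> carrier Q" and YQ: "?Y \<subseteq> carrier Q" and ZQ: "?Z \<subseteq> carrier Q"
    using gen(1) Y(1) Z(1) by auto
  have rep_set: "f ` {a b c | b c. R b c} = {f (a b c) | b c. R b c}" for f a R by blast
  have G': "rep ` ?G = ?G'"
    unfolding rep_set by (intro Collect_cong ex_cong1 rev_conj_cong refl; elim conjE; simp only: gen(2))
  have Y': "rep ` ?Y = ?Y'"
    unfolding rep_set by (intro Collect_cong ex_cong1 rev_conj_cong refl; elim conjE; simp only: Y(2))
  have Z': "rep ` ?Z = ?Z'"
    unfolding rep_set by (intro Collect_cong ex_cong1 rev_conj_cong refl; elim conjE; simp only: Z(2))
  have S: "unital_subalgebra Q ?S" "rep ` ?S = U.gsub ?G'"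
    unfolding minor_core_def Q_quantum_matrices using generated_subalgebra_props[OF GQ] G' by simp_all
  have SQ: "?S \<subseteq> carrier Q" using S(1) unfolding unital_subalgebra_def by (blast dest: subringE(1))
  have gens: "?S \<union> ?Y \<union> ?Z \<subseteq> carrier Q" using SQ YQ ZQ by blast
  obtain gs where gs: "U.tower gs" "set gs = ?G' \<union> ?Y' \<union> ?Z'"
    using U.minor_tower[OF A B card] by blast
  have T: "unital_subalgebra Q ?T" "rep ` ?T = U.gsub (U.gsub ?G' \<union> ?Y' \<union> ?Z')"
    unfolding minor_subalgebra_def Q_quantum_matrices
    using generated_subalgebra_props[OF gens] unfolding image_Un S(2) Y' Z' by simp_all
  have "U.gsub (U.gsub ?G' \<union> ?Y' \<union> ?Z') = U.gsub (set gs)"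
  proof (intro equalityI subsetI)
    fix t assume "t \<in> U.gsub (U.gsub ?G' \<union> ?Y' \<union> ?Z')"
    moreover have "U.gsub ?G' \<union> ?Y' \<union> ?Z' \<subseteq> U.gsub (set gs)"
      using U.gsub_mono[of ?G' "set gs"] unfolding gs(2) by (blast intro: U.gsub.gen)
    ultimately show "t \<in> U.gsub (set gs)" by (rule U.gsub_least)
  next
    fix t assume "t \<in> U.gsub (set gs)"
    moreover have "set gs \<subseteq> U.gsub ?G' \<union> ?Y' \<union> ?Z'"
      unfolding gs(2) by (blast intro: U.gsub.gen)
    ultimately show "t \<in> U.gsub (U.gsub ?G' \<union> ?Y' \<union> ?Z')" using U.gsub_mono by blast
  qed
  then have repT: "rep ` ?T = U.gsub (set gs)" using T(2) by simp
  have TQ: "?T \<subseteq> carrier Q" using T(1) unfolding unital_subalgebra_def by (blast dest: subringE(1))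
  let ?h = "inv_into ?T rep"
  have inj: "inj_on rep ?T" by (rule inj_on_subset[OF rep_inj TQ])
  have h: "?h (rep C) = C" if "C \<in> ?T" for C by (rule inv_into_f_f[OF inj that])
  have sub: "subring ?T Q" and scT: "\<And>c C. C \<in> ?T \<Longrightarrow> c \<odot>\<^bsub>Q\<^esub> C \<in> ?T"
    using T(1) unfolding unital_subalgebra_def by blast+
  have "alg_iso (U.alg_rec (U.gsub (set gs))) (Q\<lparr>carrier := ?T\<rparr>) ?h"
    unfolding alg_iso_def
  proof (intro conjI ballI allI)
    show "bij_betw ?h (carrier (U.alg_rec (U.gsub (set gs)))) (carrier (Q\<lparr>carrier := ?T\<rparr>))"
      using bij_betw_inv_into[OF inj_on_imp_bij_betw[OF inj]] by (simp add: repT)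
    show "?h \<one>\<^bsub>U.alg_rec (U.gsub (set gs))\<^esub> = \<one>\<^bsub>Q\<lparr>carrier := ?T\<rparr>\<^esub>"
      using h[OF subringE(3)[OF sub]] by (simp add: rep_one)
  next
    fix a b assume "a \<in> carrier (U.alg_rec (U.gsub (set gs)))" "b \<in> carrier (U.alg_rec (U.gsub (set gs)))"
    then obtain C D where C: "C \<in> ?T" "a = rep C" and D: "D \<in> ?T" "b = rep D"
      unfolding U.alg_rec_simps repT[symmetric] by blast
    have CD: "C \<in> carrier Q" "D \<in> carrier Q" using C D TQ by auto
    show "?h (a \<otimes>\<^bsub>U.alg_rec (U.gsub (set gs))\<^esub> b) = ?h a \<otimes>\<^bsub>Q\<lparr>carrier := ?T\<rparr>\<^esub> ?h b"
      using h[OF subringE(6)[OF sub C(1) D(1)]] C D by (simp add: rep_hom(1)[OF CD] h)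
    show "?h (a \<oplus>\<^bsub>U.alg_rec (U.gsub (set gs))\<^esub> b) = ?h a \<oplus>\<^bsub>Q\<lparr>carrier := ?T\<rparr>\<^esub> ?h b"
      using h[OF subringE(7)[OF sub C(1) D(1)]] C D by (simp add: rep_hom(2)[OF CD] h)
  next
    fix c a assume "a \<in> carrier (U.alg_rec (U.gsub (set gs)))"
    then obtain C where C: "C \<in> ?T" "a = rep C"
      unfolding U.alg_rec_simps repT[symmetric] by blast
    have CQ: "C \<in> carrier Q" using C TQ by auto
    show "?h (c \<odot>\<^bsub>U.alg_rec (U.gsub (set gs))\<^esub> a) = c \<odot>\<^bsub>Q\<lparr>carrier := ?T\<rparr>\<^esub> ?h a"
      using h[OF scT[OF C(1)], of c] C by (simp add: rep_hom(3)[OF CQ CQ] h)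
  qed
  then show ?thesis
    by (rule iterated_ore_extension_iso[OF U.tower_iterated_ore[OF gs(1)]
          assoc_algebra_subalgebra[OF assoc_algebra_Q T(1)]])
qed

end

section \<open>The theorem\<close>

theorem corollary5p5:
  fixes q :: "'k::field" and m n :: nat and A B :: "nat set"
  assumes "q \<noteq> 0" and "m \<ge> 1" and "n \<ge> 1"
    and "A \<subseteq> {1..m}" and "B \<subseteq> {1..n}" and "card A = card B"
  shows "iterated_ore_extension
           ((quantum_matrices q m n)\<lparr>carrier := minor_subalgebra q m n A B\<rparr>)"
proof -
  interpret quantum_matrix_algebra q m n by standard fact
  show ?thesis unfolding Q_quantum_matrices by (rule minor_subalgebra_iterated_ore[OF assms(4-6)])
qed

end
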